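(* Let $(T,u,m)$ and $(P,\eta,\mu)$ be pseudomonads on a 2-category $\mathscr C$. In the pseudomonoidal presentation of pseudodistributive laws of $T$ over $P$, the axioms (W8), (W9) and (W10) are redundant, i.e. they follow from (W1)–(W5). Moreover, the functor from the category of data $(\lambda,\omega_1,\omega_2,\omega_3,\omega_4)$ satisfying the eight axioms (W1)–(W5), (W8), (W9), (W10) to the category of such data satisfying the five axioms (W1)–(W5), which leaves the data unchanged, is an isomorphism.
   Context: **Conventions.** A pseudomonad $(T,u,m)$ on $\mathscr C$ is a pseudofunctor $T$ with pseudonatural $u\colon 1\to T$, $m\colon T^2\to T$ and invertible modifications $m\cdot uT\cong \mathrm{id}$, $m\cdot Tu\cong\mathrm{id}$, $m\cdot Tm\cong m\cdot mT$ satisfying the usual triangle and pentagon equations. Composition of 1-cells is written $\cdot$ (right to left), whiskering by juxtaposition. In the chains of 2-cells, "$\cong$" is the canonical isomorphism built from pseudonaturality constraints, pseudofunctor constraints and the structure modifications of $T$ and $P$; whiskerings of named cells are implicit. All named cells are invertible. Morphisms are modifications $\lambda\Rightarrow\lambda'$ such that the evident pasting diagrams with the $\omega_i$ and $\omega_i'$ agree. **Data.** A pseudonatural transformation $\lambda\colon TP\to PT$ with invertible modifications $\omega_1\colon Pu\Rightarrow\lambda\cdot uP$, $\omega_2\colon\lambda\cdot T\eta\Rightarrow\eta T$, $\omega_3\colon Pm\cdot\lambda T\cdot T\lambda\Rightarrow\lambda\cdot mP$, $\omega_4\colon\lambda\cdot T\mu\Rightarrow\mu T\cdot P\lambda\cdot\lambda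 P$. **Axioms.** (W1) $\lambda\cong Pm\cdot PTu\cdot\lambda\cong Pm\cdot\lambda T\cdot TPu\xrightarrow{T\omega_1}Pm\cdot\lambda T\cdot T\lambda\cdot TuP\xrightarrow{\omega_3}\lambda\cdot mP\cdot TuP\cong\lambda$ is the identity. (W2) $\lambda\cong\lambda\cdot T\mu\cdot T\eta P\xrightarrow{\omega_4}\mu T\cdot P\lambda\cdot\lambda P\cdot T\eta P\xrightarrow{\omega_2P}\mu T\cdot P\lambda\cdot\eta TP\cong\mu T\cdot\eta PT\cdot\lambda\cong\lambda$ is the identity. (W3) The two 2-cells $Pm\cdot PTm\cdot\lambda T^2\cdot T\lambda T\cdot T^2\lambda\Rightarrow\lambda\cdot mP\cdot mTP$ agree: first $\cong Pm\cdot\lambda T\cdot TPm\cdot T\lambda T\cdot T^2\lambda\xrightarrow{T\omega_3}Pm\cdot\lambda T\cdot T\lambda\cdot TmP\xrightarrow{\omega_3}\lambda\cdot mP\cdot TmP\cong\lambda\cdot mP\cdot mTP$; second $\cong Pm\cdot PmT\cdot\lambda T^2\cdot T\lambda T\cdot T^2\lambda\xrightarrow{\omega_3T}Pm\cdot\lambda T\cdot mPT\cdot T^2\lambda\cong Pm\cdot\lambda T\cdot T\lambda\cdot mTP\xrightarrow{\omega_3}\lambda\cdot mP\cdot mTP$. (W4) The two 2-cells $\lambda\cdot T\mu\cdot TP\mu\Rightarrow\mu T\cdot\mu PT\cdot P^2\lambda\cdot P\lambda P\cdot\lambda P^2$ agree: first $\cong\lambda\cdot T\mu\cdot T\mu P\xrightarrow{\omega_4}\mu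 T\cdot P\lambda\cdot\lambda P\cdot T\mu P\xrightarrow{\omega_4P}\mu T\cdot P\lambda\cdot\mu TP\cdot P\lambda P\cdot\lambda P^2\cong\mu T\cdot\mu PT\cdot P^2\lambda\cdot P\lambda P\cdot\lambda P^2$; second $\xrightarrow{\omega_4}\mu T\cdot P\lambda\cdot\lambda P\cdot TP\mu\cong\mu T\cdot P\lambda\cdot PT\mu\cdot\lambda P^2\xrightarrow{P\omega_4}\mu T\cdot P\mu T\cdot P^2\lambda\cdot P\lambda P\cdot\lambda P^2\cong$ target. (W5) The two 2-cells $Pm\cdot\lambda T\cdot T\lambda\cdot T^2\mu\Rightarrow\mu T\cdot P\lambda\cdot\lambda P\cdot mP^2$ agree: first $\xrightarrow{T\omega_4}Pm\cdot\lambda T\cdot T\mu T\cdot TP\lambda\cdot T\lambda P\xrightarrow{\omega_4T}Pm\cdot\mu T^2\cdot P\lambda T\cdot\lambda PT\cdot TP\lambda\cdot T\lambda P\cong\mu T\cdot P^2m\cdot P\lambda T\cdot PT\lambda\cdot\lambda TP\cdot T\lambda P\xrightarrow{P\omega_3}\mu T\cdot P\lambda\cdot PmP\cdot\lambda TP\cdot T\lambda P\xrightarrow{\omega_3P}\mu T\cdot P\lambda\cdot\lambda P\cdot mP^2$; second $\xrightarrow{\omega_3}\lambda\cdot mP\cdot T^2\mu\cong\lambda\cdot T\mu\cdot mP^2\xrightarrow{\omega_4}\mu T\cdot P\lambda\cdot\lambda P\cdot mP^2$. (W8) The composites $Pm\cdot\lambda T\cdot T\lambda\cdot T^2\eta\xrightarrow{\omega_3}\lambda\cdot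 mP\cdot T^2\eta\cong\lambda\cdot T\eta\cdot m\xrightarrow{\omega_2}\eta T\cdot m$ and $Pm\cdot\lambda T\cdot T\lambda\cdot T^2\eta\xrightarrow{T\omega_2}Pm\cdot\lambda T\cdot T\eta T\xrightarrow{\omega_2T}Pm\cdot\eta T^2\cong\eta T\cdot m$ are equal. (W9) The composites $Pu\cdot\mu\xrightarrow{\omega_1}\lambda\cdot uP\cdot\mu\cong\lambda\cdot T\mu\cdot uP^2\xrightarrow{\omega_4}\mu T\cdot P\lambda\cdot\lambda P\cdot uP^2$ and $Pu\cdot\mu\cong\mu T\cdot P^2u\xrightarrow{P\omega_1}\mu T\cdot P\lambda\cdot PuP\xrightarrow{\omega_1P}\mu T\cdot P\lambda\cdot\lambda P\cdot uP^2$ are equal. (W10) The composite $Pu\cdot\eta\xrightarrow{\omega_1}\lambda\cdot uP\cdot\eta\cong\lambda\cdot T\eta\cdot u\xrightarrow{\omega_2}\eta T\cdot u$ equals the canonical isomorphism $Pu\cdot\eta\cong\eta T\cdot u$. *)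

theory Defs
  imports Main "HOL-Library.FuncSet"
begin

section \<open>Strict 2-categories\<close>

record ('o, 'a, 'c) two_cat =
  Ob :: "'o set"
  Arr :: "'a set"
  Src :: "'a \<Rightarrow> 'o"
  Trg :: "'a \<Rightarrow> 'o"
  Id1 :: "'o \<Rightarrow> 'a"
  comp1 :: "'a \<Rightarrow> 'a \<Rightarrow> 'a" (infixr "\<cdot>\<index>" 80)
  Cell :: "'c set"
  Dom :: "'c \<Rightarrow> 'a"
  Cod :: "'c \<Rightarrow> 'a"
  Id2 :: "'a \<Rightarrow> 'c"
  vcomp :: "'c \<Rightarrow> 'c \<Rightarrow> 'c" (infixr "\<Zsemi>\<index>" 65)
  hcomp :: "'c \<Rightarrow> 'c \<Rightarrow> 'c" (infixr "\<star>\<index>" 80)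

text \<open>
  Composition of 1-cells and horizontal composition of 2-cells are written from right to left;
  vertical composition is written in diagrammatic order: \<open>\<alpha> \<Zsemi> \<beta>\<close> is first \<open>\<alpha>\<close>, then \<open>\<beta>\<close>.
\<close>

definition hom1 :: "('o, 'a, 'c) two_cat \<Rightarrow> 'o \<Rightarrow> 'o \<Rightarrow> 'a set" where
  "hom1 C X Y = {f \<in> Arr C. Src C f = X \<and> Trg C f = Y}"

definition hom2 :: "('o, 'a, 'c) two_cat \<Rightarrow> 'a \<Rightarrow> 'a \<Rightarrow> 'c set" where
  "hom2 C f g = {\<alpha> \<in> Cell C. Dom C \<alpha> = f \<and> Cod C \<alpha> = g}"

locale two_category =
  fixes C :: "('o, 'a, 'c) two_cat" (structure)
  assumes Src_Ob: "f \<in> Arr C \<Longrightarrow> Src C f \<in> Ob C"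
    and Trg_Ob: "f \<in> Arr C \<Longrightarrow> Trg C f \<in> Ob C"
    and Dom_Arr: "\<alpha> \<in> Cell C \<Longrightarrow> Dom C \<alpha> \<in> Arr C"
    and Cod_Arr: "\<alpha> \<in> Cell C \<Longrightarrow> Cod C \<alpha> \<in> Arr C"
    and parallel_Src: "\<alpha> \<in> Cell C \<Longrightarrow> Src C (Cod C \<alpha>) = Src C (Dom C \<alpha>)"
    and parallel_Trg: "\<alpha> \<in> Cell C \<Longrightarrow> Trg C (Cod C \<alpha>) = Trg C (Dom C \<alpha>)"
    and Id1_hom: "X \<in> Ob C \<Longrightarrow> Id1 C X \<in> hom1 C X X"
    and comp1_hom: "\<lbrakk>f \<in> hom1 C X Y; g \<in> hom1 C Y Z\<rbrakk> \<Longrightarrow> g \<cdot> f \<in> hom1 C X Z"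
    and comp1_assoc: "\<lbrakk>f \<in> hom1 C W X; g \<in> hom1 C X Y; h \<in> hom1 C Y Z\<rbrakk> \<Longrightarrow>
          (h \<cdot> g) \<cdot> f = h \<cdot> (g \<cdot> f)"
    and comp1_Id1_right: "f \<in> hom1 C X Y \<Longrightarrow> f \<cdot> Id1 C X = f"
    and comp1_Id1_left: "f \<in> hom1 C X Y \<Longrightarrow> Id1 C Y \<cdot> f = f"
    and Id2_hom: "f \<in> Arr C \<Longrightarrow> Id2 C f \<in> hom2 C f f"
    and vcomp_hom: "\<lbrakk>\<alpha> \<in> hom2 C f g; \<beta> \<in> hom2 C g h\<rbrakk> \<Longrightarrow> \<alpha> \<Zsemi> \<beta> \<in> hom2 C f h"
    and vcomp_assoc: "\<lbrakk>\<alpha> \<in> hom2 C f g; \<beta> \<in> hom2 C g h; \<gamma> \<in> hom2 C h k\<rbrakk> \<Longrightarrow>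
          (\<alpha> \<Zsemi> \<beta>) \<Zsemi> \<gamma> = \<alpha> \<Zsemi> (\<beta> \<Zsemi> \<gamma>)"
    and vcomp_Id2_left: "\<alpha> \<in> hom2 C f g \<Longrightarrow> Id2 C f \<Zsemi> \<alpha> = \<alpha>"
    and vcomp_Id2_right: "\<alpha> \<in> hom2 C f g \<Longrightarrow> \<alpha> \<Zsemi> Id2 C g = \<alpha>"
    and hcomp_hom: "\<lbrakk>f \<in> hom1 C X Y; h \<in> hom1 C Y Z; \<alpha> \<in> hom2 C f g; \<beta> \<in> hom2 C h k\<rbrakk> \<Longrightarrow>
          \<beta> \<star> \<alpha> \<in> hom2 C (h \<cdot> f) (k \<cdot> g)"
    and hcomp_assoc: "\<lbrakk>f \<in> hom1 C W X; g \<in> hom1 C X Y; h \<in> hom1 C Y Z;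
          \<alpha> \<in> hom2 C f f'; \<beta> \<in> hom2 C g g'; \<gamma> \<in> hom2 C h h'\<rbrakk> \<Longrightarrow>
          (\<gamma> \<star> \<beta>) \<star> \<alpha> = \<gamma> \<star> (\<beta> \<star> \<alpha>)"
    and hcomp_Id_right: "\<lbrakk>f \<in> hom1 C X Y; \<alpha> \<in> hom2 C f g\<rbrakk> \<Longrightarrow> \<alpha> \<star> Id2 C (Id1 C X) = \<alpha>"
    and hcomp_Id_left: "\<lbrakk>f \<in> hom1 C X Y; \<alpha> \<in> hom2 C f g\<rbrakk> \<Longrightarrow> Id2 C (Id1 C Y) \<star> \<alpha> = \<alpha>"
    and hcomp_Id2: "\<lbrakk>f \<in> hom1 C X Y; g \<in> hom1 C Y Z\<rbrakk> \<Longrightarrow> Id2 C g \<star> Id2 C f = Id2 C (g \<cdot> f)"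
    and interchange: "\<lbrakk>f \<in> hom1 C X Y; h \<in> hom1 C Y Z;
          \<alpha> \<in> hom2 C f f'; \<alpha>' \<in> hom2 C f' f''; \<beta> \<in> hom2 C h h'; \<beta>' \<in> hom2 C h' h''\<rbrakk> \<Longrightarrow>
          (\<beta> \<Zsemi> \<beta>') \<star> (\<alpha> \<Zsemi> \<alpha>') = (\<beta> \<star> \<alpha>) \<Zsemi> (\<beta>' \<star> \<alpha>')"

definition lwhisk :: "('o, 'a, 'c) two_cat \<Rightarrow> 'a \<Rightarrow> 'c \<Rightarrow> 'c" (infixr "\<rhd>\<index>" 75) where
  "f \<rhd>\<^bsub>C\<^esub> \<alpha> = Id2 C f \<star>\<^bsub>C\<^esub> \<alpha>"

definition rwhisk :: "('o, 'a, 'c) two_cat \<Rightarrow> 'c \<Rightarrow> 'a \<Rightarrow> 'c" (infixl "\<lhd>\<index>" 76) where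
  "\<alpha> \<lhd>\<^bsub>C\<^esub> f = \<alpha> \<star>\<^bsub>C\<^esub> Id2 C f"

definition iso2 :: "('o, 'a, 'c) two_cat \<Rightarrow> 'a \<Rightarrow> 'a \<Rightarrow> 'c set" where
  "iso2 C f g = {\<alpha> \<in> hom2 C f g.
     \<exists>\<beta> \<in> hom2 C g f. \<alpha> \<Zsemi>\<^bsub>C\<^esub> \<beta> = Id2 C f \<and> \<beta> \<Zsemi>\<^bsub>C\<^esub> \<alpha> = Id2 C g}"

definition inv2 :: "('o, 'a, 'c) two_cat \<Rightarrow> 'c \<Rightarrow> 'c" where
  "inv2 C \<alpha> = (THE \<beta>. \<beta> \<in> hom2 C (Cod C \<alpha>) (Dom C \<alpha>) \<and>
     \<alpha> \<Zsemi>\<^bsub>C\<^esub> \<beta> = Id2 C (Dom C \<alpha>) \<and> \<beta> \<Zsemi>\<^bsub>C\<^esub> \<alpha> = Id2 C (Cod C \<alpha>))"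


section \<open>Pseudofunctors\<close>

text \<open>
  Constraints: \<open>compositor F g f : F g \<cdot> F f \<Rightarrow> F (g \<cdot> f)\<close> and \<open>unitor F X : 1 \<Rightarrow> F 1\<close>.
\<close>

record ('o, 'a, 'c) pfun =
  ob_map :: "'o \<Rightarrow> 'o"
  arr_map :: "'a \<Rightarrow> 'a"
  cell_map :: "'c \<Rightarrow> 'c"
  compositor :: "'a \<Rightarrow> 'a \<Rightarrow> 'c"
  unitor :: "'o \<Rightarrow> 'c"

locale pseudofunctor =
  fixes C :: "('o, 'a, 'c) two_cat" (structure) and F :: "('o, 'a, 'c) pfun"
  assumes ob_map: "X \<in> Ob C \<Longrightarrow> ob_map F X \<in> Ob C"
    and arr_map: "f \<in> hom1 C X Y \<Longrightarrow> arr_map F f \<in> hom1 C (ob_map F X) (ob_map F Y)"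
    and cell_map: "\<alpha> \<in> hom2 C f g \<Longrightarrow> cell_map F \<alpha> \<in> hom2 C (arr_map F f) (arr_map F g)"
    and cell_map_Id2: "f \<in> Arr C \<Longrightarrow> cell_map F (Id2 C f) = Id2 C (arr_map F f)"
    and cell_map_vcomp: "\<lbrakk>\<alpha> \<in> hom2 C f g; \<beta> \<in> hom2 C g h\<rbrakk> \<Longrightarrow>
          cell_map F (\<alpha> \<Zsemi> \<beta>) = cell_map F \<alpha> \<Zsemi> cell_map F \<beta>"
    and compositor_iso: "\<lbrakk>f \<in> hom1 C X Y; g \<in> hom1 C Y Z\<rbrakk> \<Longrightarrow>
          compositor F g f \<in> iso2 C (arr_map F g \<cdot> arr_map F f) (arr_map F (g \<cdot> f))"
    and unitor_iso: "X \<in> Ob C \<Longrightarrow>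
          unitor F X \<in> iso2 C (Id1 C (ob_map F X)) (arr_map F (Id1 C X))"
    and compositor_natural: "\<lbrakk>f \<in> hom1 C X Y; g \<in> hom1 C Y Z; \<alpha> \<in> hom2 C f f'; \<beta> \<in> hom2 C g g'\<rbrakk> \<Longrightarrow>
          compositor F g f \<Zsemi> cell_map F (\<beta> \<star> \<alpha>) =
          (cell_map F \<beta> \<star> cell_map F \<alpha>) \<Zsemi> compositor F g' f'"
    and compositor_assoc: "\<lbrakk>f \<in> hom1 C W X; g \<in> hom1 C X Y; h \<in> hom1 C Y Z\<rbrakk> \<Longrightarrow>
          (arr_map F h \<rhd> compositor F g f) \<Zsemi> compositor F h (g \<cdot> f) =
          (compositor F h g \<lhd> arr_map F f) \<Zsemi> compositor F (h \<cdot> g) f"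
    and unitor_right: "f \<in> hom1 C X Y \<Longrightarrow>
          (arr_map F f \<rhd> unitor F X) \<Zsemi> compositor F f (Id1 C X) = Id2 C (arr_map F f)"
    and unitor_left: "f \<in> hom1 C X Y \<Longrightarrow>
          (unitor F Y \<lhd> arr_map F f) \<Zsemi> compositor F (Id1 C Y) f = Id2 C (arr_map F f)"

definition pf_id :: "('o, 'a, 'c) two_cat \<Rightarrow> ('o, 'a, 'c) pfun" where
  "pf_id C = \<lparr>ob_map = (\<lambda>X. X), arr_map = (\<lambda>f. f), cell_map = (\<lambda>\<alpha>. \<alpha>),
     compositor = (\<lambda>g f. Id2 C (g \<cdot>\<^bsub>C\<^esub> f)), unitor = (\<lambda>X. Id2 C (Id1 C X))\<rparr>"

definition pf_comp ::
  "('o, 'a, 'c) two_cat \<Rightarrow> ('o, 'a, 'c) pfun \<Rightarrow> ('o, 'a, 'c) pfun \<Rightarrow> ('o, 'a, 'c) pfun" where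
  "pf_comp C G F = \<lparr>ob_map = (\<lambda>X. ob_map G (ob_map F X)), arr_map = (\<lambda>f. arr_map G (arr_map F f)),
     cell_map = (\<lambda>\<alpha>. cell_map G (cell_map F \<alpha>)),
     compositor = (\<lambda>g f. compositor G (arr_map F g) (arr_map F f) \<Zsemi>\<^bsub>C\<^esub> cell_map G (compositor F g f)),
     unitor = (\<lambda>X. unitor G (ob_map F X) \<Zsemi>\<^bsub>C\<^esub> cell_map G (unitor F X))\<rparr>"

text \<open>
  \<open>compositors C F [f\<^sub>1, \<dots>, f\<^sub>n]\<close> is the canonical 2-cell
  \<open>F f\<^sub>1 \<cdot> \<dots> \<cdot> F f\<^sub>n \<Rightarrow> F (f\<^sub>1 \<cdot> \<dots> \<cdot> f\<^sub>n)\<close>. For \<open>\<alpha> : f\<^sub>1 \<cdot> \<dots> \<cdot> f\<^sub>n \<Rightarrow> g\<^sub>1 \<cdot> \<dots> \<cdot> g\<^sub>k\<close>,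
  \<open>map_cell C F [f\<^sub>1, \<dots>, f\<^sub>n] \<alpha> [g\<^sub>1, \<dots>, g\<^sub>k]\<close> is \<open>F \<alpha>\<close> conjugated by these canonical 2-cells, from
  \<open>F f\<^sub>1 \<cdot> \<dots> \<cdot> F f\<^sub>n\<close> to \<open>F g\<^sub>1 \<cdot> \<dots> \<cdot> F g\<^sub>k\<close>. Only nonempty lists are used.
\<close>

fun comps1 :: "('o, 'a, 'c) two_cat \<Rightarrow> 'a list \<Rightarrow> 'a" where
  "comps1 C [f] = f"
| "comps1 C (f # g # fs) = f \<cdot>\<^bsub>C\<^esub> comps1 C (g # fs)"

fun compositors :: "('o, 'a, 'c) two_cat \<Rightarrow> ('o, 'a, 'c) pfun \<Rightarrow> 'a list \<Rightarrow> 'c" where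
  "compositors C F [f] = Id2 C (arr_map F f)"
| "compositors C F (f # g # fs) =
     (arr_map F f \<rhd>\<^bsub>C\<^esub> compositors C F (g # fs)) \<Zsemi>\<^bsub>C\<^esub> compositor F f (comps1 C (g # fs))"

definition map_cell ::
  "('o, 'a, 'c) two_cat \<Rightarrow> ('o, 'a, 'c) pfun \<Rightarrow> 'a list \<Rightarrow> 'c \<Rightarrow> 'a list \<Rightarrow> 'c" where
  "map_cell C F fs \<alpha> gs =
     compositors C F fs \<Zsemi>\<^bsub>C\<^esub> cell_map F \<alpha> \<Zsemi>\<^bsub>C\<^esub> inv2 C (compositors C F gs)"


section \<open>Pseudonatural transformations and modifications\<close>

text \<open>
  For \<open>\<alpha> : F \<rightarrow> G\<close> and \<open>f : X \<rightarrow> Y\<close>, the constraint is the 2-cell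
  \<open>pcell \<alpha> f : G f \<cdot> pcomp \<alpha> X \<Rightarrow> pcomp \<alpha> Y \<cdot> F f\<close>.
\<close>

record ('o, 'a, 'c) pnat =
  pcomp :: "'o \<Rightarrow> 'a"
  pcell :: "'a \<Rightarrow> 'c"

locale pseudonat =
  fixes C :: "('o, 'a, 'c) two_cat" (structure)
    and F G :: "('o, 'a, 'c) pfun" and \<alpha> :: "('o, 'a, 'c) pnat"
  assumes pcomp: "X \<in> Ob C \<Longrightarrow> pcomp \<alpha> X \<in> hom1 C (ob_map F X) (ob_map G X)"
    and pcell: "f \<in> hom1 C X Y \<Longrightarrow>
          pcell \<alpha> f \<in> iso2 C (arr_map G f \<cdot> pcomp \<alpha> X) (pcomp \<alpha> Y \<cdot> arr_map F f)"
    and pcell_natural: "\<lbrakk>f \<in> hom1 C X Y; \<phi> \<in> hom2 C f g\<rbrakk> \<Longrightarrow>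
          (cell_map G \<phi> \<lhd> pcomp \<alpha> X) \<Zsemi> pcell \<alpha> g = pcell \<alpha> f \<Zsemi> (pcomp \<alpha> Y \<rhd> cell_map F \<phi>)"
    and pcell_comp: "\<lbrakk>f \<in> hom1 C X Y; g \<in> hom1 C Y Z\<rbrakk> \<Longrightarrow>
          (compositor G g f \<lhd> pcomp \<alpha> X) \<Zsemi> pcell \<alpha> (g \<cdot> f) =
          (arr_map G g \<rhd> pcell \<alpha> f) \<Zsemi> (pcell \<alpha> g \<lhd> arr_map F f) \<Zsemi> (pcomp \<alpha> Z \<rhd> compositor F g f)"
    and pcell_Id1: "X \<in> Ob C \<Longrightarrow>
          (unitor G X \<lhd> pcomp \<alpha> X) \<Zsemi> pcell \<alpha> (Id1 C X) = pcomp \<alpha> X \<rhd> unitor F X"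

definition pn_id :: "('o, 'a, 'c) two_cat \<Rightarrow> ('o, 'a, 'c) pfun \<Rightarrow> ('o, 'a, 'c) pnat" where
  "pn_id C F = \<lparr>pcomp = (\<lambda>X. Id1 C (ob_map F X)), pcell = (\<lambda>f. Id2 C (arr_map F f))\<rparr>"

definition pn_comp ::
  "('o, 'a, 'c) two_cat \<Rightarrow> ('o, 'a, 'c) pnat \<Rightarrow> ('o, 'a, 'c) pnat \<Rightarrow> ('o, 'a, 'c) pnat" where
  "pn_comp C \<beta> \<alpha> = \<lparr>pcomp = (\<lambda>X. pcomp \<beta> X \<cdot>\<^bsub>C\<^esub> pcomp \<alpha> X),
     pcell = (\<lambda>f. (pcell \<beta> f \<lhd>\<^bsub>C\<^esub> pcomp \<alpha> (Src C f)) \<Zsemi>\<^bsub>C\<^esub> (pcomp \<beta> (Trg C f) \<rhd>\<^bsub>C\<^esub> pcell \<alpha> f))\<rparr>"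

text \<open>
  For \<open>\<alpha> : G \<rightarrow> H\<close>, \<open>pn_lwhisk C F G H \<alpha>\<close> is \<open>F\<alpha> : FG \<rightarrow> FH\<close> and \<open>pn_rwhisk \<alpha> F\<close> is
  \<open>\<alpha>F : GF \<rightarrow> HF\<close>.
\<close>

definition pn_lwhisk :: "('o, 'a, 'c) two_cat \<Rightarrow> ('o, 'a, 'c) pfun \<Rightarrow> ('o, 'a, 'c) pfun \<Rightarrow>
    ('o, 'a, 'c) pfun \<Rightarrow> ('o, 'a, 'c) pnat \<Rightarrow> ('o, 'a, 'c) pnat" where
  "pn_lwhisk C F G H \<alpha> = \<lparr>pcomp = (\<lambda>X. arr_map F (pcomp \<alpha> X)),
     pcell = (\<lambda>f. map_cell C F [arr_map H f, pcomp \<alpha> (Src C f)] (pcell \<alpha> f)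
                               [pcomp \<alpha> (Trg C f), arr_map G f])\<rparr>"

definition pn_rwhisk :: "('o, 'a, 'c) pnat \<Rightarrow> ('o, 'a, 'c) pfun \<Rightarrow> ('o, 'a, 'c) pnat" where
  "pn_rwhisk \<alpha> F = \<lparr>pcomp = (\<lambda>X. pcomp \<alpha> (ob_map F X)), pcell = (\<lambda>f. pcell \<alpha> (arr_map F f))\<rparr>"

text \<open>Modifications \<open>\<Gamma> : \<alpha> \<Rightarrow> \<beta>\<close> between pseudonatural transformations \<open>\<alpha>, \<beta> : F \<rightarrow> G\<close>.\<close>

locale modification =
  fixes C :: "('o, 'a, 'c) two_cat" (structure)
    and F G :: "('o, 'a, 'c) pfun" and \<alpha> \<beta> :: "('o, 'a, 'c) pnat" and \<Gamma> :: "'o \<Rightarrow> 'c"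
  assumes component: "X \<in> Ob C \<Longrightarrow> \<Gamma> X \<in> hom2 C (pcomp \<alpha> X) (pcomp \<beta> X)"
    and natural: "f \<in> hom1 C X Y \<Longrightarrow>
          pcell \<alpha> f \<Zsemi> (\<Gamma> Y \<lhd> arr_map F f) = (arr_map G f \<rhd> \<Gamma> X) \<Zsemi> pcell \<beta> f"

locale inv_modification = modification +
  assumes component_iso: "X \<in> Ob C \<Longrightarrow> \<Gamma> X \<in> iso2 C (pcomp \<alpha> X) (pcomp \<beta> X)"


section \<open>Pseudomonads\<close>

text \<open>
  Structure modifications: \<open>left_unit : m \<cdot> uT \<Rightarrow> 1\<close>, \<open>right_unit : m \<cdot> Tu \<Rightarrow> 1\<close>,
  \<open>assoc : m \<cdot> Tm \<Rightarrow> m \<cdot> mT\<close>.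
\<close>

record ('o, 'a, 'c) pmonad =
  fnc :: "('o, 'a, 'c) pfun"
  un :: "('o, 'a, 'c) pnat"
  mul :: "('o, 'a, 'c) pnat"
  left_unit :: "'o \<Rightarrow> 'c"
  right_unit :: "'o \<Rightarrow> 'c"
  assoc :: "'o \<Rightarrow> 'c"

locale pseudomonad =
  fixes C :: "('o, 'a, 'c) two_cat" (structure) and M :: "('o, 'a, 'c) pmonad"
    and T u m
  defines "T \<equiv> fnc M" and "u \<equiv> un M" and "m \<equiv> mul M"
  assumes pseudofunctor: "pseudofunctor C T"
    and un_pseudonat: "pseudonat C (pf_id C) T u"
    and mul_pseudonat: "pseudonat C (pf_comp C T T) T m"
    and left_unit: "inv_modification C T T (pn_comp C m (pn_rwhisk u T)) (pn_id C T) (left_unit M)"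
    and right_unit: "inv_modification C T T (pn_comp C m (pn_lwhisk C T (pf_id C) T u)) (pn_id C T)
          (right_unit M)"
    and assoc: "inv_modification C (pf_comp C T (pf_comp C T T)) T
          (pn_comp C m (pn_lwhisk C T (pf_comp C T T) T m)) (pn_comp C m (pn_rwhisk m T)) (assoc M)"
    and triangle: "X \<in> Ob C \<Longrightarrow>
          (assoc M X \<lhd> arr_map T (pcomp u (ob_map T X))) \<Zsemi>
          (pcomp m X \<rhd> right_unit M (ob_map T X)) =
          pcomp m X \<rhd>
            (map_cell C T [pcomp m X, pcomp u (ob_map T X)] (left_unit M X) [Id1 C (ob_map T X)] \<Zsemi>
             inv2 C (unitor T (ob_map T X)))"
    and pentagon: "X \<in> Ob C \<Longrightarrow>
          (pcomp m X \<rhd> map_cell C T [pcomp m X, arr_map T (pcomp m X)] (assoc M X)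
                                    [pcomp m X, pcomp m (ob_map T X)]) \<Zsemi>
          (assoc M X \<lhd> arr_map T (pcomp m (ob_map T X))) \<Zsemi>
          (pcomp m X \<rhd> assoc M (ob_map T X)) =
          (assoc M X \<lhd> arr_map T (arr_map T (pcomp m X))) \<Zsemi>
          (pcomp m X \<rhd> inv2 C (pcell m (pcomp m X))) \<Zsemi>
          (assoc M X \<lhd> pcomp m (ob_map T (ob_map T X)))"


section \<open>Pseudodistributive laws\<close>

record ('o, 'a, 'c) pdl =
  lam :: "('o, 'a, 'c) pnat"
  om1 :: "'o \<Rightarrow> 'c"
  om2 :: "'o \<Rightarrow> 'c"
  om3 :: "'o \<Rightarrow> 'c"
  om4 :: "'o \<Rightarrow> 'c"

context
  fixes C :: "('o, 'a, 'c) two_cat" (structure)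
    and MT MP :: "('o, 'a, 'c) pmonad"
begin

private abbreviation (input) "T \<equiv> fnc MT"
private abbreviation (input) "P \<equiv> fnc MP"

private abbreviation (input) "TO \<equiv> ob_map T"
private abbreviation (input) "PO \<equiv> ob_map P"
private abbreviation (input) "T1 \<equiv> arr_map T"
private abbreviation (input) "P1 \<equiv> arr_map P"
private abbreviation (input) "T2 \<equiv> map_cell C T"
private abbreviation (input) "P2 \<equiv> map_cell C P"

private abbreviation (input) "u \<equiv> pcomp (un MT)"
private abbreviation (input) "m \<equiv> pcomp (mul MT)"
private abbreviation (input) "\<eta> \<equiv> pcomp (un MP)"
private abbreviation (input) "\<mu> \<equiv> pcomp (mul MP)"
private abbreviation (input) "uc \<equiv> pcell (un MT)"
private abbreviation (input) "mc \<equiv> pcell (mul MT)"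
private abbreviation (input) "\<eta>c \<equiv> pcell (un MP)"
private abbreviation (input) "\<mu>c \<equiv> pcell (mul MP)"

definition pdl_data :: "('o, 'a, 'c) pdl \<Rightarrow> bool" where
  "pdl_data D \<longleftrightarrow>
    (let I = pf_id C; TT = pf_comp C T T; PP = pf_comp C P P;
         TP = pf_comp C T P; PT = pf_comp C P T;
         u = un MT; m = mul MT; \<eta> = un MP; \<mu> = mul MP; l = lam D
     in
       pseudonat C TP PT l \<and>
       inv_modification C P PT
         (pn_lwhisk C P I T u)
         (pn_comp C l (pn_rwhisk u P)) (om1 D) \<and>
       inv_modification C T PT
         (pn_comp C l (pn_lwhisk C T I P \<eta>))
         (pn_rwhisk \<eta> T) (om2 D) \<and>
       inv_modification C (pf_comp C TT P) PT
         (pn_comp C (pn_lwhisk C P TT T m) (pn_comp C (pn_rwhisk l T) (pn_lwhisk C T TP PT l)))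
         (pn_comp C l (pn_rwhisk m P)) (om3 D) \<and>
       inv_modification C (pf_comp C T PP) PT
         (pn_comp C l (pn_lwhisk C T PP P \<mu>))
         (pn_comp C (pn_rwhisk \<mu> T) (pn_comp C (pn_lwhisk C P TP PT l) (pn_rwhisk l P))) (om4 D))"

text \<open>
  The axioms are equations between modifications, stated at each object \<open>X\<close>. As
  \<open>pcell \<alpha> f : G f \<cdot> \<alpha> X \<Rightarrow> \<alpha> Y \<cdot> F f\<close>, a canonical isomorphism moving \<open>\<alpha>\<close> to the right past \<open>f\<close>
  is an inverse of \<open>pcell \<alpha> f\<close>. In \<open>W1\<close> and \<open>W2\<close> the first factor is the image under \<open>P\<close> (resp. \<open>T\<close>)
  of the inverse of a unit modification, together with the constraints of that pseudofunctor.
\<close>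

definition W1 :: "('o, 'a, 'c) pdl \<Rightarrow> bool" where
  "W1 D \<longleftrightarrow> (let l = pcomp (lam D); lc = pcell (lam D); \<omega>\<^sub>1 = om1 D; \<omega>\<^sub>3 = om3 D in
    \<forall>X \<in> Ob C.
      (inv2 C (P2 [m X, T1 (u X)] (right_unit MT X) [Id1 C (TO X)] \<Zsemi> inv2 C (unitor P (TO X))) \<lhd> l X) \<Zsemi>
      (P1 (m X) \<rhd> lc (u X)) \<Zsemi>
      (P1 (m X) \<cdot> l (TO X) \<rhd> T2 [P1 (u X)] (\<omega>\<^sub>1 X) [l X, u (PO X)]) \<Zsemi>
      (\<omega>\<^sub>3 X \<lhd> T1 (u (PO X))) \<Zsemi>
      (l X \<rhd> right_unit MT (PO X))
      = Id2 C (l X))"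

definition W2 :: "('o, 'a, 'c) pdl \<Rightarrow> bool" where
  "W2 D \<longleftrightarrow> (let l = pcomp (lam D); lc = pcell (lam D); \<omega>\<^sub>2 = om2 D; \<omega>\<^sub>4 = om4 D in
    \<forall>X \<in> Ob C.
      (l X \<rhd> inv2 C (T2 [\<mu> X, \<eta> (PO X)] (left_unit MP X) [Id1 C (PO X)] \<Zsemi> inv2 C (unitor T (PO X)))) \<Zsemi>
      (\<omega>\<^sub>4 X \<lhd> T1 (\<eta> (PO X))) \<Zsemi>
      (\<mu> (TO X) \<cdot> P1 (l X) \<rhd> \<omega>\<^sub>2 (PO X)) \<Zsemi>
      (\<mu> (TO X) \<rhd> \<eta>c (l X)) \<Zsemi>
      (left_unit MP (TO X) \<lhd> l X)
      = Id2 C (l X))"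

definition W3 :: "('o, 'a, 'c) pdl \<Rightarrow> bool" where
  "W3 D \<longleftrightarrow> (let l = pcomp (lam D); lc = pcell (lam D); \<omega>\<^sub>3 = om3 D in
    \<forall>X \<in> Ob C.
      (P1 (m X) \<rhd> lc (m X) \<lhd> T1 (l (TO X)) \<cdot> T1 (T1 (l X))) \<Zsemi>
      (P1 (m X) \<cdot> l (TO X) \<rhd> T2 [P1 (m X), l (TO X), T1 (l X)] (\<omega>\<^sub>3 X) [l X, m (PO X)]) \<Zsemi>
      (\<omega>\<^sub>3 X \<lhd> T1 (m (PO X))) \<Zsemi>
      (l X \<rhd> assoc MT (PO X))
      =
      (P2 [m X, T1 (m X)] (assoc MT X) [m X, m (TO X)]
         \<lhd> l (TO (TO X)) \<cdot> T1 (l (TO X)) \<cdot> T1 (T1 (l X))) \<Zsemi>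
      (P1 (m X) \<rhd> \<omega>\<^sub>3 (TO X) \<lhd> T1 (T1 (l X))) \<Zsemi>
      (P1 (m X) \<cdot> l (TO X) \<rhd> inv2 C (mc (l X))) \<Zsemi>
      (\<omega>\<^sub>3 X \<lhd> m (TO (PO X))))"

definition W4 :: "('o, 'a, 'c) pdl \<Rightarrow> bool" where
  "W4 D \<longleftrightarrow> (let l = pcomp (lam D); lc = pcell (lam D); \<omega>\<^sub>4 = om4 D in
    \<forall>X \<in> Ob C.
      (l X \<rhd> T2 [\<mu> X, P1 (\<mu> X)] (assoc MP X) [\<mu> X, \<mu> (PO X)]) \<Zsemi>
      (\<omega>\<^sub>4 X \<lhd> T1 (\<mu> (PO X))) \<Zsemi>
      (\<mu> (TO X) \<cdot> P1 (l X) \<rhd> \<omega>\<^sub>4 (PO X)) \<Zsemi>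
      (\<mu> (TO X) \<rhd> \<mu>c (l X) \<lhd> P1 (l (PO X)) \<cdot> l (PO (PO X)))
      =
      (\<omega>\<^sub>4 X \<lhd> T1 (P1 (\<mu> X))) \<Zsemi>
      (\<mu> (TO X) \<cdot> P1 (l X) \<rhd> inv2 C (lc (\<mu> X))) \<Zsemi>
      (\<mu> (TO X) \<rhd> P2 [l X, T1 (\<mu> X)] (\<omega>\<^sub>4 X) [\<mu> (TO X), P1 (l X), l (PO X)] \<lhd> l (PO (PO X))) \<Zsemi>
      (assoc MP (TO X) \<lhd> P1 (P1 (l X)) \<cdot> P1 (l (PO X)) \<cdot> l (PO (PO X))))"

definition W5 :: "('o, 'a, 'c) pdl \<Rightarrow> bool" where
  "W5 D \<longleftrightarrow> (let l = pcomp (lam D); lc = pcell (lam D); \<omega>\<^sub>3 = om3 D; \<omega>\<^sub>4 = om4 D in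
    \<forall>X \<in> Ob C.
      (P1 (m X) \<cdot> l (TO X) \<rhd> T2 [l X, T1 (\<mu> X)] (\<omega>\<^sub>4 X) [\<mu> (TO X), P1 (l X), l (PO X)]) \<Zsemi>
      (P1 (m X) \<rhd> \<omega>\<^sub>4 (TO X) \<lhd> T1 (P1 (l X)) \<cdot> T1 (l (PO X))) \<Zsemi>
      (\<mu>c (m X) \<lhd> P1 (l (TO X)) \<cdot> l (PO (TO X)) \<cdot> T1 (P1 (l X)) \<cdot> T1 (l (PO X))) \<Zsemi>
      (\<mu> (TO X) \<cdot> P1 (P1 (m X)) \<cdot> P1 (l (TO X)) \<rhd> inv2 C (lc (l X)) \<lhd> T1 (l (PO X))) \<Zsemi>
      (\<mu> (TO X) \<rhd> P2 [P1 (m X), l (TO X), T1 (l X)] (\<omega>\<^sub>3 X) [l X, m (PO X)]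
         \<lhd> l (TO (PO X)) \<cdot> T1 (l (PO X))) \<Zsemi>
      (\<mu> (TO X) \<cdot> P1 (l X) \<rhd> \<omega>\<^sub>3 (PO X))
      =
      (\<omega>\<^sub>3 X \<lhd> T1 (T1 (\<mu> X))) \<Zsemi>
      (l X \<rhd> inv2 C (mc (\<mu> X))) \<Zsemi>
      (\<omega>\<^sub>4 X \<lhd> m (PO (PO X))))"

definition W8 :: "('o, 'a, 'c) pdl \<Rightarrow> bool" where
  "W8 D \<longleftrightarrow> (let l = pcomp (lam D); \<omega>\<^sub>2 = om2 D; \<omega>\<^sub>3 = om3 D in
    \<forall>X \<in> Ob C.
      (\<omega>\<^sub>3 X \<lhd> T1 (T1 (\<eta> X))) \<Zsemi>
      (l X \<rhd> inv2 C (mc (\<eta> X))) \<Zsemi>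
      (\<omega>\<^sub>2 X \<lhd> m X)
      =
      (P1 (m X) \<cdot> l (TO X) \<rhd> T2 [l X, T1 (\<eta> X)] (\<omega>\<^sub>2 X) [\<eta> (TO X)]) \<Zsemi>
      (P1 (m X) \<rhd> \<omega>\<^sub>2 (TO X)) \<Zsemi>
      \<eta>c (m X))"

definition W9 :: "('o, 'a, 'c) pdl \<Rightarrow> bool" where
  "W9 D \<longleftrightarrow> (let l = pcomp (lam D); \<omega>\<^sub>1 = om1 D; \<omega>\<^sub>4 = om4 D in
    \<forall>X \<in> Ob C.
      (\<omega>\<^sub>1 X \<lhd> \<mu> X) \<Zsemi>
      (l X \<rhd> inv2 C (uc (\<mu> X))) \<Zsemi>
      (\<omega>\<^sub>4 X \<lhd> u (PO (PO X)))
      =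
      \<mu>c (u X) \<Zsemi>
      (\<mu> (TO X) \<rhd> P2 [P1 (u X)] (\<omega>\<^sub>1 X) [l X, u (PO X)]) \<Zsemi>
      (\<mu> (TO X) \<cdot> P1 (l X) \<rhd> \<omega>\<^sub>1 (PO X)))"

definition W10 :: "('o, 'a, 'c) pdl \<Rightarrow> bool" where
  "W10 D \<longleftrightarrow> (let l = pcomp (lam D); \<omega>\<^sub>1 = om1 D; \<omega>\<^sub>2 = om2 D in
    \<forall>X \<in> Ob C.
      (\<omega>\<^sub>1 X \<lhd> \<eta> X) \<Zsemi>
      (l X \<rhd> inv2 C (uc (\<eta> X))) \<Zsemi>
      (\<omega>\<^sub>2 X \<lhd> u X)
      = \<eta>c (u X))"

definition pdl_morphism :: "('o, 'a, 'c) pdl \<Rightarrow> ('o, 'a, 'c) pdl \<Rightarrow> ('o \<Rightarrow> 'c) \<Rightarrow> bool" where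
  "pdl_morphism D D' \<Gamma> \<longleftrightarrow>
    modification C (pf_comp C T P) (pf_comp C P T) (lam D) (lam D') \<Gamma> \<and>
    (\<forall>X \<in> Ob C.
      om1 D X \<Zsemi> (\<Gamma> X \<lhd> u (PO X)) = om1 D' X \<and>
      (\<Gamma> X \<lhd> T1 (\<eta> X)) \<Zsemi> om2 D' X = om2 D X \<and>
      (P1 (m X) \<rhd> (\<Gamma> (TO X) \<star> cell_map T (\<Gamma> X))) \<Zsemi> om3 D' X = om3 D X \<Zsemi> (\<Gamma> X \<lhd> m (PO X)) \<and>
      (\<Gamma> X \<lhd> T1 (\<mu> X)) \<Zsemi> om4 D' X = om4 D X \<Zsemi> (\<mu> (TO X) \<rhd> (cell_map P (\<Gamma> X) \<star> \<Gamma> (PO X))))"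

end


section \<open>The categories of pseudodistributive laws\<close>

record ('x, 'y) cat =
  Obj :: "'x set"
  Mor :: "'x \<Rightarrow> 'x \<Rightarrow> 'y set"
  Ident :: "'x \<Rightarrow> 'y"
  Comp :: "'y \<Rightarrow> 'y \<Rightarrow> 'y"

locale category =
  fixes A :: "('x, 'y) cat"
  assumes Ident: "a \<in> Obj A \<Longrightarrow> Ident A a \<in> Mor A a a"
    and Comp: "\<lbrakk>a \<in> Obj A; b \<in> Obj A; c \<in> Obj A; f \<in> Mor A a b; g \<in> Mor A b c\<rbrakk> \<Longrightarrow>
          Comp A g f \<in> Mor A a c"
    and Comp_assoc: "\<lbrakk>a \<in> Obj A; b \<in> Obj A; c \<in> Obj A; d \<in> Obj A;
          f \<in> Mor A a b; g \<in> Mor A b c; h \<in> Mor A c d\<rbrakk> \<Longrightarrow>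
          Comp A (Comp A h g) f = Comp A h (Comp A g f)"
    and Comp_Ident_right: "\<lbrakk>a \<in> Obj A; b \<in> Obj A; f \<in> Mor A a b\<rbrakk> \<Longrightarrow> Comp A f (Ident A a) = f"
    and Comp_Ident_left: "\<lbrakk>a \<in> Obj A; b \<in> Obj A; f \<in> Mor A a b\<rbrakk> \<Longrightarrow> Comp A (Ident A b) f = f"

locale cat_functor = A: category A + B: category B
  for A :: "('x, 'y) cat" and B :: "('v, 'w) cat"
    and F0 :: "'x \<Rightarrow> 'v" and F1 :: "'x \<Rightarrow> 'x \<Rightarrow> 'y \<Rightarrow> 'w" +
  assumes F0: "a \<in> Obj A \<Longrightarrow> F0 a \<in> Obj B"
    and F1: "\<lbrakk>a \<in> Obj A; b \<in> Obj A; f \<in> Mor A a b\<rbrakk> \<Longrightarrow> F1 a b f \<in> Mor B (F0 a) (F0 b)"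
    and F1_Ident: "a \<in> Obj A \<Longrightarrow> F1 a a (Ident A a) = Ident B (F0 a)"
    and F1_Comp: "\<lbrakk>a \<in> Obj A; b \<in> Obj A; c \<in> Obj A; f \<in> Mor A a b; g \<in> Mor A b c\<rbrakk> \<Longrightarrow>
          F1 a c (Comp A g f) = Comp B (F1 b c g) (F1 a b f)"

definition cat_isomorphism ::
  "('x, 'y) cat \<Rightarrow> ('v, 'w) cat \<Rightarrow> ('x \<Rightarrow> 'v) \<Rightarrow> ('x \<Rightarrow> 'x \<Rightarrow> 'y \<Rightarrow> 'w) \<Rightarrow> bool" where
  "cat_isomorphism A B F0 F1 \<longleftrightarrow> cat_functor A B F0 F1 \<and>
    (\<exists>G0 G1. cat_functor B A G0 G1 \<and>
      (\<forall>a \<in> Obj A. G0 (F0 a) = a) \<and>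
      (\<forall>a \<in> Obj A. \<forall>b \<in> Obj A. \<forall>f \<in> Mor A a b. G1 (F0 a) (F0 b) (F1 a b f) = f) \<and>
      (\<forall>a \<in> Obj B. F0 (G0 a) = a) \<and>
      (\<forall>a \<in> Obj B. \<forall>b \<in> Obj B. \<forall>f \<in> Mor B a b. F1 (G0 a) (G0 b) (G1 a b f) = f))"

text \<open>
  Families indexed by 0-cells or 1-cells are HOL functions; requiring the value \<open>undefined\<close> outside
  the index set makes equality of objects and of morphisms coincide with equality of families.
\<close>

definition pdl_extensional :: "('o, 'a, 'c) two_cat \<Rightarrow> ('o, 'a, 'c) pdl \<Rightarrow> bool" where
  "pdl_extensional C D \<longleftrightarrow>
    pcomp (lam D) \<in> extensional (Ob C) \<and> pcell (lam D) \<in> extensional (Arr C) \<and>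
    om1 D \<in> extensional (Ob C) \<and> om2 D \<in> extensional (Ob C) \<and>
    om3 D \<in> extensional (Ob C) \<and> om4 D \<in> extensional (Ob C)"

definition pdl_category :: "('o, 'a, 'c) two_cat \<Rightarrow> ('o, 'a, 'c) pmonad \<Rightarrow> ('o, 'a, 'c) pmonad \<Rightarrow>
    (('o, 'a, 'c) pdl \<Rightarrow> bool) \<Rightarrow> (('o, 'a, 'c) pdl, 'o \<Rightarrow> 'c) cat" where
  "pdl_category C T P axs = \<lparr>
     Obj = {D. pdl_data C T P D \<and> pdl_extensional C D \<and> axs D},
     Mor = (\<lambda>D D'. {\<Gamma>. pdl_morphism C T P D D' \<Gamma> \<and> \<Gamma> \<in> extensional (Ob C)}),
     Ident = (\<lambda>D. \<lambda>X \<in> Ob C. Id2 C (pcomp (lam D) X)),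
     Comp = (\<lambda>\<Delta> \<Gamma>. \<lambda>X \<in> Ob C. \<Gamma> X \<Zsemi>\<^bsub>C\<^esub> \<Delta> X)\<rparr>"

definition five_axioms :: "('o, 'a, 'c) two_cat \<Rightarrow> ('o, 'a, 'c) pmonad \<Rightarrow> ('o, 'a, 'c) pmonad \<Rightarrow>
    ('o, 'a, 'c) pdl \<Rightarrow> bool" where
  "five_axioms C T P D \<longleftrightarrow> W1 C T P D \<and> W2 C T P D \<and> W3 C T P D \<and> W4 C T P D \<and> W5 C T P D"

definition eight_axioms :: "('o, 'a, 'c) two_cat \<Rightarrow> ('o, 'a, 'c) pmonad \<Rightarrow> ('o, 'a, 'c) pmonad \<Rightarrow>
    ('o, 'a, 'c) pdl \<Rightarrow> bool" where
  "eight_axioms C T P D \<longleftrightarrow> five_axioms C T P D \<and> W8 C T P D \<and> W9 C T P D \<and> W10 C T P D"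

end

theory Submission
  imports Defs
begin

text \<open>
  Whiskering (W5) with \<open>T\<^sup>2\<eta>P\<close> and removing \<open>\<mu>\<close> against \<open>\<eta>\<close> by (W2), once under \<open>T\<close> and twice outside,
  turns both sides of (W5) into (W8) at \<open>PX\<close> whiskered by \<open>\<mu>T \<cdot> P\<lambda>\<close>. As both sides of (W8) are modifications,
  naturality at \<open>\<eta>\<close> moves (W8) from \<open>PX\<close> to \<open>X\<close> at the cost of a further whiskering by \<open>PT\<eta>\<close>, and
  \<open>\<mu>T \<cdot> P\<lambda> \<cdot> PT\<eta> \<cong> \<mu>T \<cdot> P\<eta>T \<cong> 1\<close> via \<open>P\<omega>\<^sub>2\<close>, so the whiskering can be cancelled. Dually, whiskering (W5) with
  \<open>TuP\<^sup>2\<close> and using (W1) gives \<open>T\<close> of (W9), whiskered by \<open>Pm \<cdot> \<lambda>T\<close>; naturality of \<open>u\<close> and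
  \<open>Pm \<cdot> \<lambda>T \<cdot> uPT \<cong> Pm \<cdot> PuT \<cong> 1\<close> then give (W9). Finally (W9) whiskered with \<open>\<eta>P\<close>, together with (W2), gives
  (W10) at \<open>PX\<close> whiskered by \<open>\<mu>T \<cdot> P\<lambda>\<close>, which is cancelled in the same way as for (W8).
\<close>

subsection \<open>Strict 2-categories\<close>

text \<open>The obstacle is coherence: every canonical isomorphism in the axioms hides constraints
  of \<open>T\<close>, of \<open>P\<close> and of the transformations, and the argument needs
  naturality of \<open>u\<close>, \<open>m\<close>, \<eta>, \<mu>, \<lambda> at 2-cells between long
  composites. Words remove it: on words \<open>fm\<close> preserves composition and whiskering on
  the nose, so each step of a calculation is either interchange, settled by rewriting, or one named
  square. (W8) and (W10) are first reached only at PX because (W2) removes \<mu> at X against \<eta>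
  at PX, so the surviving cells carry the index PX. Whiskers are never cancelled by inverting a
  1-cell: an equation is transported along invertible 2-cells from one whisker to an isomorphic one
  until the whisker is empty. For (W9) the equation arises under \<open>T\<close>, which need not be
  faithful on 2-cells; this is why naturality of \<open>u\<close> has to enter. The statement about
  categories is then formal: morphisms and composition do not refer to the axioms, so the two
  categories are equal.\<close>

context two_category
begin

lemma hom1_iff: "f \<in> hom1 C X Y \<longleftrightarrow> f \<in> Arr C \<and> Src C f = X \<and> Trg C f = Y"
  by (simp add: hom1_def)

lemma hom2_iff: "\<alpha> \<in> hom2 C f g \<longleftrightarrow> \<alpha> \<in> Cell C \<and> Dom C \<alpha> = f \<and> Cod C \<alpha> = g"
  by (simp add: hom2_def)

lemma hom2_parallel:
  assumes "\<alpha> \<in> hom2 C f g" "f \<in> hom1 C X Y"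
  shows "g \<in> hom1 C X Y"
  using assms Cod_Arr parallel_Src parallel_Trg by (auto simp: hom1_def hom2_def)

lemma hom2_dom: "\<alpha> \<in> hom2 C f g \<Longrightarrow> f \<in> Arr C"
  using Dom_Arr by (auto simp: hom2_def)

lemma hom2_cod: "\<alpha> \<in> hom2 C f g \<Longrightarrow> g \<in> Arr C"
  using Cod_Arr by (auto simp: hom2_def)

lemma hom1_Ob: "f \<in> hom1 C X Y \<Longrightarrow> X \<in> Ob C \<and> Y \<in> Ob C"
  using Src_Ob Trg_Ob by (auto simp: hom1_def)

text \<open>From here on typing is expressed by equations between \<open>Src\<close>,
  \<open>Trg\<close>, \<open>Dom\<close> and \<open>Cod\<close> instead of membership in
  \<open>hom1\<close> and \<open>hom2\<close>. The boundaries quantified in the locale axioms then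
  need not be guessed, and the simplifier discharges side conditions by computing
  boundaries.\<close>

lemma Id1_arr [simp]:
  assumes "X \<in> Ob C"
  shows "Id1 C X \<in> Arr C" "Src C (Id1 C X) = X" "Trg C (Id1 C X) = X"
  using Id1_hom[OF assms] by (auto simp: hom1_def)

lemma comp1_arr [simp]:
  assumes "f \<in> Arr C" "g \<in> Arr C" "Src C g = Trg C f"
  shows "g \<cdot> f \<in> Arr C" "Src C (g \<cdot> f) = Src C f" "Trg C (g \<cdot> f) = Trg C g"
  using comp1_hom[of f "Src C f" "Trg C f" g "Trg C g"] assms by (auto simp: hom1_def)

lemma comp1_assoc' [simp]:
  "\<lbrakk>f \<in> Arr C; g \<in> Arr C; h \<in> Arr C; Src C g = Trg C f; Src C h = Trg C g\<rbrakk> \<Longrightarrow>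
    (h \<cdot> g) \<cdot> f = h \<cdot> (g \<cdot> f)"
  using comp1_assoc[of f "Src C f" "Trg C f" g "Trg C g" h "Trg C h"] by (auto simp: hom1_def)

lemma comp1_Id1 [simp]:
  "f \<in> Arr C \<Longrightarrow> Src C f = X \<Longrightarrow> f \<cdot> Id1 C X = f"
  "f \<in> Arr C \<Longrightarrow> Trg C f = X \<Longrightarrow> Id1 C X \<cdot> f = f"
  using comp1_Id1_right[of f X "Trg C f"] comp1_Id1_left[of f "Src C f" X] by (auto simp: hom1_def)

lemma Id2_cell [simp]:
  assumes "f \<in> Arr C"
  shows "Id2 C f \<in> Cell C" "Dom C (Id2 C f) = f" "Cod C (Id2 C f) = f"
  using Id2_hom[OF assms] by (auto simp: hom2_def)

lemma Dom_Cod_arr [simp]: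
  assumes "\<alpha> \<in> Cell C"
  shows "Dom C \<alpha> \<in> Arr C" "Cod C \<alpha> \<in> Arr C"
    "Src C (Cod C \<alpha>) = Src C (Dom C \<alpha>)" "Trg C (Cod C \<alpha>) = Trg C (Dom C \<alpha>)"
  using assms Dom_Arr Cod_Arr parallel_Src parallel_Trg by auto

lemma vcomp_cell [simp]:
  assumes "\<alpha> \<in> Cell C" "\<beta> \<in> Cell C" "Cod C \<alpha> = Dom C \<beta>"
  shows "\<alpha> \<Zsemi> \<beta> \<in> Cell C" "Dom C (\<alpha> \<Zsemi> \<beta>) = Dom C \<alpha>" "Cod C (\<alpha> \<Zsemi> \<beta>) = Cod C \<beta>"
  using vcomp_hom[of \<alpha> "Dom C \<alpha>" "Cod C \<alpha>" \<beta> "Cod C \<beta>"] assms by (auto simp: hom2_def)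

lemma vcomp_assoc' [simp]:
  "\<lbrakk>\<alpha> \<in> Cell C; \<beta> \<in> Cell C; \<gamma> \<in> Cell C; Cod C \<alpha> = Dom C \<beta>; Cod C \<beta> = Dom C \<gamma>\<rbrakk> \<Longrightarrow>
    (\<alpha> \<Zsemi> \<beta>) \<Zsemi> \<gamma> = \<alpha> \<Zsemi> (\<beta> \<Zsemi> \<gamma>)"
  using vcomp_assoc[of \<alpha> "Dom C \<alpha>" "Cod C \<alpha>" \<beta> "Cod C \<beta>" \<gamma> "Cod C \<gamma>"] by (auto simp: hom2_def)

lemma vcomp_Id2 [simp]:
  "\<alpha> \<in> Cell C \<Longrightarrow> Dom C \<alpha> = f \<Longrightarrow> Id2 C f \<Zsemi> \<alpha> = \<alpha>"
  "\<alpha> \<in> Cell C \<Longrightarrow> Cod C \<alpha> = f \<Longrightarrow> \<alpha> \<Zsemi> Id2 C f = \<alpha>"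
  using vcomp_Id2_left[of \<alpha> f "Cod C \<alpha>"] vcomp_Id2_right[of \<alpha> "Dom C \<alpha>" f]
  by (auto simp: hom2_def)

lemma hcomp_cell [simp]:
  assumes "\<alpha> \<in> Cell C" "\<beta> \<in> Cell C" "Src C (Dom C \<beta>) = Trg C (Dom C \<alpha>)"
  shows "\<beta> \<star> \<alpha> \<in> Cell C" "Dom C (\<beta> \<star> \<alpha>) = Dom C \<beta> \<cdot> Dom C \<alpha>"
    "Cod C (\<beta> \<star> \<alpha>) = Cod C \<beta> \<cdot> Cod C \<alpha>"
  using hcomp_hom[of "Dom C \<alpha>" "Src C (Dom C \<alpha>)" "Trg C (Dom C \<alpha>)" "Dom C \<beta>" "Trg C (Dom C \<beta>)"
      \<alpha> "Cod C \<alpha>" \<beta> "Cod C \<beta>"] assms by (auto simp: hom1_def hom2_def)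

lemma hcomp_assoc' [simp]:
  "\<lbrakk>\<alpha> \<in> Cell C; \<beta> \<in> Cell C; \<gamma> \<in> Cell C; Src C (Dom C \<beta>) = Trg C (Dom C \<alpha>);
     Src C (Dom C \<gamma>) = Trg C (Dom C \<beta>)\<rbrakk> \<Longrightarrow> (\<gamma> \<star> \<beta>) \<star> \<alpha> = \<gamma> \<star> (\<beta> \<star> \<alpha>)"
  using hcomp_assoc[of "Dom C \<alpha>" "Src C (Dom C \<alpha>)" "Trg C (Dom C \<alpha>)" "Dom C \<beta>" "Trg C (Dom C \<beta>)"
      "Dom C \<gamma>" "Trg C (Dom C \<gamma>)" \<alpha> "Cod C \<alpha>" \<beta> "Cod C \<beta>" \<gamma> "Cod C \<gamma>"]
  by (auto simp: hom1_def hom2_def)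

lemma interchange':
  "\<lbrakk>\<alpha> \<in> Cell C; \<beta> \<in> Cell C; \<alpha>' \<in> Cell C; \<beta>' \<in> Cell C; Src C (Dom C \<beta>) = Trg C (Dom C \<alpha>);
     Cod C \<alpha> = Dom C \<alpha>'; Cod C \<beta> = Dom C \<beta>'\<rbrakk> \<Longrightarrow>
    (\<beta> \<Zsemi> \<beta>') \<star> (\<alpha> \<Zsemi> \<alpha>') = (\<beta> \<star> \<alpha>) \<Zsemi> (\<beta>' \<star> \<alpha>')"
  using interchange[of "Dom C \<alpha>" "Src C (Dom C \<alpha>)" "Trg C (Dom C \<alpha>)" "Dom C \<beta>" "Trg C (Dom C \<beta>)"
      \<alpha> "Cod C \<alpha>" \<alpha>' "Cod C \<alpha>'" \<beta> "Cod C \<beta>" \<beta>' "Cod C \<beta>'"]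
  by (auto simp: hom1_def hom2_def)

lemma hcomp_Id2' [simp]:
  "\<lbrakk>f \<in> Arr C; g \<in> Arr C; Src C g = Trg C f\<rbrakk> \<Longrightarrow> Id2 C g \<star> Id2 C f = Id2 C (g \<cdot> f)"
  using hcomp_Id2[of f "Src C f" "Trg C f" g "Trg C g"] by (auto simp: hom1_def)

lemma hcomp_Id1 [simp]:
  "\<alpha> \<in> Cell C \<Longrightarrow> Src C (Dom C \<alpha>) = X \<Longrightarrow> \<alpha> \<star> Id2 C (Id1 C X) = \<alpha>"
  "\<alpha> \<in> Cell C \<Longrightarrow> Trg C (Dom C \<alpha>) = X \<Longrightarrow> Id2 C (Id1 C X) \<star> \<alpha> = \<alpha>"
  using hcomp_Id_right[of "Dom C \<alpha>" X "Trg C (Dom C \<alpha>)" \<alpha> "Cod C \<alpha>"]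
    hcomp_Id_left[of "Dom C \<alpha>" "Src C (Dom C \<alpha>)" X \<alpha> "Cod C \<alpha>"]
  by (auto simp: hom1_def hom2_def)

lemma lwhisk_cell [simp]:
  assumes "\<alpha> \<in> Cell C" "f \<in> Arr C" "Src C f = Trg C (Dom C \<alpha>)"
  shows "f \<rhd> \<alpha> \<in> Cell C" "Dom C (f \<rhd> \<alpha>) = f \<cdot> Dom C \<alpha>" "Cod C (f \<rhd> \<alpha>) = f \<cdot> Cod C \<alpha>"
  using assms by (simp_all add: lwhisk_def)

lemma rwhisk_cell [simp]:
  assumes "\<alpha> \<in> Cell C" "f \<in> Arr C" "Trg C f = Src C (Dom C \<alpha>)"
  shows "\<alpha> \<lhd> f \<in> Cell C" "Dom C (\<alpha> \<lhd> f) = Dom C \<alpha> \<cdot> f" "Cod C (\<alpha> \<lhd> f) = Cod C \<alpha> \<cdot> f"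
  using assms by (simp_all add: rwhisk_def)

lemma lwhisk_vcomp:
  "\<lbrakk>\<alpha> \<in> Cell C; \<beta> \<in> Cell C; f \<in> Arr C; Src C f = Trg C (Dom C \<alpha>); Cod C \<alpha> = Dom C \<beta>\<rbrakk> \<Longrightarrow>
    f \<rhd> (\<alpha> \<Zsemi> \<beta>) = (f \<rhd> \<alpha>) \<Zsemi> (f \<rhd> \<beta>)"
  using interchange'[of \<alpha> "Id2 C f" \<beta> "Id2 C f"] by (simp add: lwhisk_def)

lemma rwhisk_vcomp:
  "\<lbrakk>\<alpha> \<in> Cell C; \<beta> \<in> Cell C; f \<in> Arr C; Trg C f = Src C (Dom C \<alpha>); Cod C \<alpha> = Dom C \<beta>\<rbrakk> \<Longrightarrow>
    (\<alpha> \<Zsemi> \<beta>) \<lhd> f = (\<alpha> \<lhd> f) \<Zsemi> (\<beta> \<lhd> f)"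
  using interchange'[of "Id2 C f" \<alpha> "Id2 C f" \<beta>] by (simp add: rwhisk_def)

lemma lwhisk_lwhisk:
  "\<lbrakk>\<alpha> \<in> Cell C; f \<in> Arr C; g \<in> Arr C; Src C f = Trg C (Dom C \<alpha>); Src C g = Trg C f\<rbrakk> \<Longrightarrow>
    g \<rhd> (f \<rhd> \<alpha>) = (g \<cdot> f) \<rhd> \<alpha>"
  using hcomp_assoc'[of \<alpha> "Id2 C f" "Id2 C g"] by (simp add: lwhisk_def)

lemma rwhisk_rwhisk:
  "\<lbrakk>\<alpha> \<in> Cell C; f \<in> Arr C; g \<in> Arr C; Trg C f = Src C (Dom C \<alpha>); Trg C g = Src C f\<rbrakk> \<Longrightarrow>
    (\<alpha> \<lhd> f) \<lhd> g = \<alpha> \<lhd> (f \<cdot> g)"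
  using hcomp_assoc'[of "Id2 C g" "Id2 C f" \<alpha>] by (simp add: rwhisk_def)

text \<open>As \<lhd> binds more tightly than \<rhd>, the right-hand side is
  \<open>g \<rhd> (\<alpha> \<lhd> f)\<close>. Oriented this way, the rule gives whiskered cells a
  normal form with the left whisker outside.\<close>

lemma whisk_commute:
  "\<lbrakk>\<alpha> \<in> Cell C; f \<in> Arr C; g \<in> Arr C; Src C g = Trg C (Dom C \<alpha>); Trg C f = Src C (Dom C \<alpha>)\<rbrakk> \<Longrightarrow>
    (g \<rhd> \<alpha>) \<lhd> f = g \<rhd> \<alpha> \<lhd> f"
  using hcomp_assoc'[of "Id2 C f" \<alpha> "Id2 C g"] by (simp add: rwhisk_def lwhisk_def)

lemma whisk_Id [simp]:
  "\<lbrakk>f \<in> Arr C; g \<in> Arr C; Src C g = Trg C f\<rbrakk> \<Longrightarrow> g \<rhd> Id2 C f = Id2 C (g \<cdot> f)"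
  "\<lbrakk>f \<in> Arr C; g \<in> Arr C; Src C g = Trg C f\<rbrakk> \<Longrightarrow> Id2 C g \<lhd> f = Id2 C (g \<cdot> f)"
  "\<lbrakk>\<alpha> \<in> Cell C; Src C (Dom C \<alpha>) = X\<rbrakk> \<Longrightarrow> \<alpha> \<lhd> Id1 C X = \<alpha>"
  "\<lbrakk>\<alpha> \<in> Cell C; Trg C (Dom C \<alpha>) = X\<rbrakk> \<Longrightarrow> Id1 C X \<rhd> \<alpha> = \<alpha>"
  by (simp_all add: lwhisk_def rwhisk_def)

text \<open>Both composites equal \<open>\<beta> \<star> \<alpha>\<close>: interchange is applied
  twice, each time pairing \<alpha> and \<beta> with identities.\<close>

lemma whisk_exchange:
  "\<lbrakk>\<alpha> \<in> Cell C; \<beta> \<in> Cell C; Src C (Dom C \<beta>) = Trg C (Dom C \<alpha>)\<rbrakk> \<Longrightarrow>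
    (\<beta> \<lhd> Dom C \<alpha>) \<Zsemi> (Cod C \<beta> \<rhd> \<alpha>) = (Dom C \<beta> \<rhd> \<alpha>) \<Zsemi> (\<beta> \<lhd> Cod C \<alpha>)"
  using interchange'[of "Id2 C (Dom C \<alpha>)" \<beta> \<alpha> "Id2 C (Cod C \<beta>)"]
    interchange'[of \<alpha> "Id2 C (Dom C \<beta>)" "Id2 C (Cod C \<alpha>)" \<beta>]
  by (simp add: lwhisk_def rwhisk_def)

text \<open>Two-sided inverses are unique, which validates the definite description in
  \<open>inv2\<close>.\<close>

lemma inv2_unique:
  assumes "\<alpha> \<in> hom2 C f g" "\<beta> \<in> hom2 C g f" "\<alpha> \<Zsemi> \<beta> = Id2 C f" "\<beta> \<Zsemi> \<alpha> = Id2 C g"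
  shows "inv2 C \<alpha> = \<beta>"
  unfolding inv2_def
proof (rule the_equality)
  show "\<beta> \<in> hom2 C (Cod C \<alpha>) (Dom C \<alpha>) \<and> \<alpha> \<Zsemi> \<beta> = Id2 C (Dom C \<alpha>) \<and> \<beta> \<Zsemi> \<alpha> = Id2 C (Cod C \<alpha>)"
    using assms by (auto simp: hom2_def)
next
  fix \<gamma>
  assume \<gamma>: "\<gamma> \<in> hom2 C (Cod C \<alpha>) (Dom C \<alpha>) \<and> \<alpha> \<Zsemi> \<gamma> = Id2 C (Dom C \<alpha>) \<and> \<gamma> \<Zsemi> \<alpha> = Id2 C (Cod C \<alpha>)"
  have "\<gamma> = (\<beta> \<Zsemi> \<alpha>) \<Zsemi> \<gamma>" using assms \<gamma> by (auto simp: hom2_def)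
  also have "\<dots> = \<beta> \<Zsemi> (\<alpha> \<Zsemi> \<gamma>)" using assms \<gamma> by (subst vcomp_assoc') (auto simp: hom2_def)
  also have "\<dots> = \<beta>" using assms \<gamma> by (auto simp: hom2_def)
  finally show "\<gamma> = \<beta>" .
qed

lemma iso2I:
  assumes "\<alpha> \<in> hom2 C f g" "\<beta> \<in> hom2 C g f" "\<alpha> \<Zsemi> \<beta> = Id2 C f" "\<beta> \<Zsemi> \<alpha> = Id2 C g"
  shows "\<alpha> \<in> iso2 C f g"
  using assms by (auto simp: iso2_def)

lemma iso2D:
  assumes "\<alpha> \<in> iso2 C f g"
  shows "\<alpha> \<in> hom2 C f g" "inv2 C \<alpha> \<in> hom2 C g f" "\<alpha> \<Zsemi> inv2 C \<alpha> = Id2 C f"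
    "inv2 C \<alpha> \<Zsemi> \<alpha> = Id2 C g"
proof -
  obtain \<beta> where \<alpha>: "\<alpha> \<in> hom2 C f g"
    and \<beta>: "\<beta> \<in> hom2 C g f" "\<alpha> \<Zsemi> \<beta> = Id2 C f" "\<beta> \<Zsemi> \<alpha> = Id2 C g"
    using assms by (auto simp: iso2_def)
  moreover have "inv2 C \<alpha> = \<beta>" by (rule inv2_unique[OF \<alpha> \<beta>])
  ultimately show "\<alpha> \<in> hom2 C f g" "inv2 C \<alpha> \<in> hom2 C g f" "\<alpha> \<Zsemi> inv2 C \<alpha> = Id2 C f"
    "inv2 C \<alpha> \<Zsemi> \<alpha> = Id2 C g" by simp_all
qed

lemma iso2_cell:
  assumes "\<alpha> \<in> iso2 C f g"
  shows "\<alpha> \<in> Cell C" "Dom C \<alpha> = f" "Cod C \<alpha> = g"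
    "inv2 C \<alpha> \<in> Cell C" "Dom C (inv2 C \<alpha>) = g" "Cod C (inv2 C \<alpha>) = f"
  using iso2D[OF assms] by (auto simp: hom2_def)

lemma iso2_inv2: "\<alpha> \<in> iso2 C f g \<Longrightarrow> inv2 C \<alpha> \<in> iso2 C g f"
  using iso2D iso2I by blast

lemma iso2_Id2 [simp]: "f \<in> Arr C \<Longrightarrow> Id2 C f \<in> iso2 C f f"
  by (rule iso2I[of _ _ _ "Id2 C f"]) (auto simp: hom2_def)

lemma inv2_Id2 [simp]: "f \<in> Arr C \<Longrightarrow> inv2 C (Id2 C f) = Id2 C f"
  by (rule inv2_unique) (auto simp: hom2_def)

lemma iso2_vcomp:
  assumes "\<alpha> \<in> iso2 C f g" "\<beta> \<in> iso2 C g h"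
  shows "\<alpha> \<Zsemi> \<beta> \<in> iso2 C f h" "inv2 C (\<alpha> \<Zsemi> \<beta>) = inv2 C \<beta> \<Zsemi> inv2 C \<alpha>"
proof -
  note a = iso2_cell[OF assms(1)] and b = iso2_cell[OF assms(2)]
    and A = iso2D[OF assms(1)] and B = iso2D[OF assms(2)]
  have 1: "(\<alpha> \<Zsemi> \<beta>) \<Zsemi> (inv2 C \<beta> \<Zsemi> inv2 C \<alpha>) = \<alpha> \<Zsemi> (\<beta> \<Zsemi> inv2 C \<beta>) \<Zsemi> inv2 C \<alpha>"
    using a b by (simp add: del: B)
  have 2: "(inv2 C \<beta> \<Zsemi> inv2 C \<alpha>) \<Zsemi> (\<alpha> \<Zsemi> \<beta>) = inv2 C \<beta> \<Zsemi> (inv2 C \<alpha> \<Zsemi> \<alpha>) \<Zsemi> \<beta>"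
    using a b by simp
  have 3: "\<alpha> \<Zsemi> \<beta> \<in> hom2 C f h" "inv2 C \<beta> \<Zsemi> inv2 C \<alpha> \<in> hom2 C h f"
    using a b by (auto simp: hom2_def)
  have 4: "(\<alpha> \<Zsemi> \<beta>) \<Zsemi> (inv2 C \<beta> \<Zsemi> inv2 C \<alpha>) = Id2 C f" "(inv2 C \<beta> \<Zsemi> inv2 C \<alpha>) \<Zsemi> (\<alpha> \<Zsemi> \<beta>) = Id2 C h"
    unfolding 1 2 using A B a b by simp_all
  show "\<alpha> \<Zsemi> \<beta> \<in> iso2 C f h" "inv2 C (\<alpha> \<Zsemi> \<beta>) = inv2 C \<beta> \<Zsemi> inv2 C \<alpha>"
    using iso2I[OF 3 4] inv2_unique[OF 3 4] by auto
qed

lemma iso2_lwhisk: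
  assumes "\<alpha> \<in> iso2 C f g" "h \<in> Arr C" "Src C h = Trg C f"
  shows "h \<rhd> \<alpha> \<in> iso2 C (h \<cdot> f) (h \<cdot> g)" "inv2 C (h \<rhd> \<alpha>) = h \<rhd> inv2 C \<alpha>"
proof -
  note a = iso2_cell[OF assms(1)] and A = iso2D[OF assms(1)]
  have [simp]: "f \<in> Arr C" "g \<in> Arr C" "Trg C g = Trg C f"
    using a Dom_Cod_arr[of \<alpha>] by auto
  have 3: "h \<rhd> \<alpha> \<in> hom2 C (h \<cdot> f) (h \<cdot> g)" "h \<rhd> inv2 C \<alpha> \<in> hom2 C (h \<cdot> g) (h \<cdot> f)"
    using a assms by (auto simp: hom2_def)
  have 4: "(h \<rhd> \<alpha>) \<Zsemi> (h \<rhd> inv2 C \<alpha>) = Id2 C (h \<cdot> f)" "(h \<rhd> inv2 C \<alpha>) \<Zsemi> (h \<rhd> \<alpha>) = Id2 C (h \<cdot> g)"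
    using a A assms by (simp_all add: lwhisk_vcomp[symmetric])
  show "h \<rhd> \<alpha> \<in> iso2 C (h \<cdot> f) (h \<cdot> g)" "inv2 C (h \<rhd> \<alpha>) = h \<rhd> inv2 C \<alpha>"
    using iso2I[OF 3 4] inv2_unique[OF 3 4] by auto
qed

lemma iso2_cancel_right:
  assumes "\<alpha> \<in> hom2 C e f" "\<alpha>' \<in> hom2 C e f" "\<beta> \<in> iso2 C f g" "\<alpha> \<Zsemi> \<beta> = \<alpha>' \<Zsemi> \<beta>"
  shows "\<alpha> = \<alpha>'"
proof -
  note b = iso2D(3)[OF assms(3)] iso2_cell[OF assms(3)] assms(1,2)[unfolded hom2_iff]
  have "\<alpha> = \<alpha> \<Zsemi> (\<beta> \<Zsemi> inv2 C \<beta>)" using b by simp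
  also have "\<dots> = (\<alpha> \<Zsemi> \<beta>) \<Zsemi> inv2 C \<beta>" using b by (simp del: b(1))
  also have "\<dots> = (\<alpha>' \<Zsemi> \<beta>) \<Zsemi> inv2 C \<beta>" using assms(4) by simp
  also have "\<dots> = \<alpha>' \<Zsemi> (\<beta> \<Zsemi> inv2 C \<beta>)" using b by (simp del: b(1))
  also have "\<dots> = \<alpha>'" using b by simp
  finally show ?thesis .
qed

end

subsection \<open>Pasting cells on words of 1-cells\<close>

text \<open>
  The 1-cells are strictified to words: \<open>Paste X p \<alpha> q Y\<close> is a 2-cell \<open>\<alpha>\<close> between the composites of the words
  \<open>p\<close> and \<open>q\<close>, both from \<open>X\<close> to \<open>Y\<close> and written, like composition, from right to left. Ill-typed
  composites are \<open>Bad\<close>; since words can be cancelled, associativity, functoriality of whiskering and interchange then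
  hold without typing hypotheses.
\<close>

datatype ('o, 'a, 'c) pasting =
  Bad | Paste (psrc: 'o) (dm: "'a list") (cel: 'c) (cd: "'a list") (ptrg: 'o)

context two_category
begin

primrec is_path :: "'o \<Rightarrow> 'a list \<Rightarrow> 'o \<Rightarrow> bool" where
  "is_path X [] Y \<longleftrightarrow> X \<in> Ob C \<and> X = Y"
| "is_path X (f # p) Y \<longleftrightarrow> f \<in> Arr C \<and> Trg C f = Y \<and> is_path X p (Src C f)"

primrec composite :: "'o \<Rightarrow> 'a list \<Rightarrow> 'a" where
  "composite X [] = Id1 C X"
| "composite X (f # p) = f \<cdot> composite X p"

text \<open>With \<open>path_src\<close>, this lets \<open>wh\<close> recover the outer endpoints of
  whiskers that are given as bare words. The second argument is the answer for the empty word, which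
  determines no object.\<close>

primrec path_trg :: "'a list \<Rightarrow> 'o \<Rightarrow> 'o" where
  "path_trg [] X = X"
| "path_trg (f # p) X = Trg C f"

primrec path_src :: "'a list \<Rightarrow> 'o \<Rightarrow> 'o" where
  "path_src [] X = X"
| "path_src (f # p) X = path_src p (Src C f)"

lemma is_path_append: "is_path X (p @ q) Y \<longleftrightarrow> (\<exists>Z. is_path X q Z \<and> is_path Z p Y)"
proof (induction p arbitrary: Y)
  case Nil
  have "is_path X q Y \<Longrightarrow> Y \<in> Ob C" by (induction q arbitrary: Y) (auto simp: Trg_Ob)
  then show ?case by auto
qed auto

lemma is_path_Ob: "is_path X p Y \<Longrightarrow> X \<in> Ob C \<and> Y \<in> Ob C"
  by (induction p arbitrary: Y) (auto simp: Trg_Ob)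

lemma is_path_path_trg: "is_path X p Y \<Longrightarrow> path_trg p X = Y"
  by (cases p) auto

lemma is_path_path_src: "is_path X p Y \<Longrightarrow> path_src p Y = X"
  by (induction p arbitrary: Y) auto

lemma is_path_unique: "is_path X p Y \<Longrightarrow> is_path X p Y' \<Longrightarrow> Y = Y'"
  using is_path_path_trg by blast

lemma composite_arr:
  "is_path X p Y \<Longrightarrow> composite X p \<in> Arr C \<and> Src C (composite X p) = X \<and> Trg C (composite X p) = Y"
  by (induction p arbitrary: Y) auto

lemma composite_append: "is_path X q Z \<Longrightarrow> is_path Z p Y \<Longrightarrow> composite X (p @ q) = composite Z p \<cdot> composite X q"
  by (induction p arbitrary: Y) (use composite_arr in auto)

text \<open>\<open>Bad\<close> is excluded explicitly because the selectors of \<open>Paste\<close>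
  are unspecified on it.\<close>

definition good :: "('o, 'a, 'c) pasting \<Rightarrow> bool" where
  "good x \<longleftrightarrow> x \<noteq> Bad \<and> is_path (psrc x) (dm x) (ptrg x) \<and> is_path (psrc x) (cd x) (ptrg x) \<and>
    cel x \<in> hom2 C (composite (psrc x) (dm x)) (composite (psrc x) (cd x))"

text \<open>Composability compares boundary words, which is stricter than composability of the
  2-cells, since several words may have the same composite. It is the words that can be cancelled in
  the ill-typed cases below.\<close>

definition vc :: "('o, 'a, 'c) pasting \<Rightarrow> ('o, 'a, 'c) pasting \<Rightarrow> ('o, 'a, 'c) pasting"
    (infixr ";;" 62) where
  "x ;; y = (if good x \<and> good y \<and> psrc x = psrc y \<and> ptrg x = ptrg y \<and> cd x = dm y
    then Paste (psrc x) (dm x) (cel x \<Zsemi> cel y) (cd y) (ptrg x) else Bad)"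

definition wh :: "'a list \<Rightarrow> ('o, 'a, 'c) pasting \<Rightarrow> 'a list \<Rightarrow> ('o, 'a, 'c) pasting"
    ("'(_ |>/ _ <|/ _')") where
  "(a |> x <| b) = (if good x \<and> is_path (ptrg x) a (path_trg a (ptrg x)) \<and> is_path (path_src b (psrc x)) b (psrc x)
    then Paste (path_src b (psrc x)) (a @ dm x @ b) (composite (ptrg x) a \<rhd> cel x \<lhd> composite (path_src b (psrc x)) b)
      (a @ cd x @ b) (path_trg a (ptrg x)) else Bad)"

lemma pasting_eqI:
  "\<lbrakk>good x; good y; psrc x = psrc y; ptrg x = ptrg y; dm x = dm y; cd x = cd y; cel x = cel y\<rbrakk> \<Longrightarrow> x = y"
  by (cases x; cases y) (auto simp: good_def)

lemma good_Bad [simp]: "\<not> good Bad"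
  by (simp add: good_def)

lemma good_is_path: "good x \<Longrightarrow> is_path (psrc x) (dm x) (ptrg x)" "good x \<Longrightarrow> is_path (psrc x) (cd x) (ptrg x)"
  by (auto simp: good_def)

lemma good_Ob: "good x \<Longrightarrow> psrc x \<in> Ob C" "good x \<Longrightarrow> ptrg x \<in> Ob C"
  using good_is_path is_path_Ob by blast+

lemma good_cel:
  assumes "good x"
  shows "cel x \<in> Cell C" "Dom C (cel x) = composite (psrc x) (dm x)" "Cod C (cel x) = composite (psrc x) (cd x)"
  using assms by (auto simp: good_def hom2_iff)

lemma good_composite:
  assumes "good x"
  shows "composite (psrc x) (dm x) \<in> Arr C" "Src C (composite (psrc x) (dm x)) = psrc x"
    "Trg C (composite (psrc x) (dm x)) = ptrg x" "composite (psrc x) (cd x) \<in> Arr C"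
    "Src C (composite (psrc x) (cd x)) = psrc x" "Trg C (composite (psrc x) (cd x)) = ptrg x"
  using good_is_path[OF assms] composite_arr by auto

lemmas good_simps = good_cel good_composite

lemma good_vc: "good (x ;; y) \<longleftrightarrow> good x \<and> good y \<and> psrc x = psrc y \<and> ptrg x = ptrg y \<and> cd x = dm y"
proof (cases "good x \<and> good y \<and> psrc x = psrc y \<and> ptrg x = ptrg y \<and> cd x = dm y")
  case True
  then have "cel x \<Zsemi> cel y \<in> hom2 C (composite (psrc x) (dm x)) (composite (psrc x) (cd y))"
    by (auto simp: hom2_iff good_simps)
  with True show ?thesis by (auto simp: vc_def) (auto simp: good_def)
next
  case False
  then have "x ;; y = Bad" by (auto simp: vc_def)
  with False show ?thesis by auto
qed

lemma vc_sel:
  assumes "good (x ;; y)"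
  shows "psrc (x ;; y) = psrc x" "ptrg (x ;; y) = ptrg x" "dm (x ;; y) = dm x" "cd (x ;; y) = cd y"
    "cel (x ;; y) = cel x \<Zsemi> cel y"
  using assms by (auto simp: good_vc) (auto simp: vc_def)

lemma vc_Bad: "\<not> good (x ;; y) \<Longrightarrow> x ;; y = Bad"
  by (auto simp: good_vc) (auto simp: vc_def)

lemma good_wh: "good (a |> x <| b) \<longleftrightarrow>
    good x \<and> is_path (ptrg x) a (path_trg a (ptrg x)) \<and> is_path (path_src b (psrc x)) b (psrc x)"
proof (cases "good x \<and> is_path (ptrg x) a (path_trg a (ptrg x)) \<and> is_path (path_src b (psrc x)) b (psrc x)")
  case True
  then have *: "good x" "is_path (ptrg x) a (path_trg a (ptrg x))" "is_path (path_src b (psrc x)) b (psrc x)" by auto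
  note c = composite_arr[OF *(2)] composite_arr[OF *(3)]
  have w: "is_path (path_src b (psrc x)) (dm x @ b) (ptrg x)" "is_path (path_src b (psrc x)) (cd x @ b) (ptrg x)"
    using * good_is_path by (auto simp: is_path_append)
  then have w': "is_path (path_src b (psrc x)) (a @ dm x @ b) (path_trg a (ptrg x))"
     "is_path (path_src b (psrc x)) (a @ cd x @ b) (path_trg a (ptrg x))"
    using * by (metis is_path_append)+
  have e: "composite (path_src b (psrc x)) (a @ dm x @ b) = composite (ptrg x) a \<cdot> composite (psrc x) (dm x) \<cdot> composite (path_src b (psrc x)) b"
    "composite (path_src b (psrc x)) (a @ cd x @ b) = composite (ptrg x) a \<cdot> composite (psrc x) (cd x) \<cdot> composite (path_src b (psrc x)) b"
    using composite_append[OF w(1) *(2)] composite_append[OF w(2) *(2)]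
      composite_append[OF *(3) good_is_path(1)[OF *(1)]] composite_append[OF *(3) good_is_path(2)[OF *(1)]] by simp_all
  have "composite (ptrg x) a \<rhd> cel x \<lhd> composite (path_src b (psrc x)) b
      \<in> hom2 C (composite (path_src b (psrc x)) (a @ dm x @ b)) (composite (path_src b (psrc x)) (a @ cd x @ b))"
    unfolding e using * c by (auto simp: hom2_iff good_simps)
  with * w' show ?thesis by (auto simp: wh_def) (auto simp: good_def)
next
  case False
  then have "(a |> x <| b) = Bad" by (auto simp: wh_def)
  with False show ?thesis by auto
qed

lemma good_wh_iff: "good (a |> x <| b) \<longleftrightarrow> good x \<and> (\<exists>Y. is_path (ptrg x) a Y) \<and> (\<exists>X. is_path X b (psrc x))"
  unfolding good_wh by (metis is_path_path_trg is_path_path_src)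

lemma wh_sel:
  assumes "good (a |> x <| b)"
  shows "psrc (a |> x <| b) = path_src b (psrc x)" "ptrg (a |> x <| b) = path_trg a (ptrg x)"
    "dm (a |> x <| b) = a @ dm x @ b" "cd (a |> x <| b) = a @ cd x @ b"
    "cel (a |> x <| b) = composite (ptrg x) a \<rhd> cel x \<lhd> composite (path_src b (psrc x)) b"
  using assms by (auto simp: good_wh) (auto simp: wh_def)

lemma wh_Bad: "\<not> good (a |> x <| b) \<Longrightarrow> (a |> x <| b) = Bad"
  by (auto simp: good_wh) (auto simp: wh_def)

lemma vc_assoc: "(x ;; y) ;; z = x ;; y ;; z"
proof (cases "good (x ;; y) \<and> good (y ;; z)")
  case True
  then have g: "good ((x ;; y) ;; z)" "good (x ;; y ;; z)"
    by (auto simp: good_vc vc_sel[OF conjunct1[OF True]] vc_sel[OF conjunct2[OF True]])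
  show ?thesis
  proof (rule pasting_eqI[OF g])
    have "cel ((x ;; y) ;; z) = (cel x \<Zsemi> cel y) \<Zsemi> cel z"
      using g True by (simp add: vc_sel)
    also have "\<dots> = cel x \<Zsemi> cel y \<Zsemi> cel z"
      using True by (intro vcomp_assoc') (auto simp: good_vc good_simps)
    finally show "cel ((x ;; y) ;; z) = cel (x ;; y ;; z)"
      using g True by (simp add: vc_sel)
  qed (use g True in \<open>auto simp: vc_sel\<close>)
next
  case False
  have "\<not> good ((x ;; y) ;; z)"
  proof
    assume g: "good ((x ;; y) ;; z)"
    then have "good (x ;; y)" by (simp add: good_vc)
    with g False show False by (auto simp: good_vc vc_sel)
  qed
  moreover have "\<not> good (x ;; y ;; z)"
  proof
    assume g: "good (x ;; y ;; z)"
    then have "good (y ;; z)" by (simp add: good_vc)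
    with g False show False by (auto simp: good_vc vc_sel)
  qed
  ultimately show ?thesis by (simp add: vc_Bad)
qed

lemma wh_vc: "(a |> x ;; y <| b) = (a |> x <| b) ;; (a |> y <| b)"
proof (cases "good (a |> x ;; y <| b)")
  case True
  then have g: "good (x ;; y)" by (simp add: good_wh)
  then have ga: "good (a |> x <| b)" "good (a |> y <| b)"
    using True by (auto simp: good_wh vc_sel good_vc)
  then have g2: "good ((a |> x <| b) ;; (a |> y <| b))"
    using g by (auto simp: good_vc wh_sel)
  have w: "is_path (ptrg x) a (path_trg a (ptrg x))" "is_path (path_src b (psrc x)) b (psrc x)"
    using ga by (auto simp: good_wh)
  have c: "composite (ptrg x) a \<rhd> (cel x \<Zsemi> cel y) \<lhd> composite (path_src b (psrc x)) b =
     (composite (ptrg x) a \<rhd> cel x \<lhd> composite (path_src b (psrc x)) b) \<Zsemi> (composite (ptrg x) a \<rhd> cel y \<lhd> composite (path_src b (psrc x)) b)"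
  proof -
    have "cel x \<in> Cell C" "cel y \<in> Cell C" "Cod C (cel x) = Dom C (cel y)"
      "Src C (Dom C (cel x)) = psrc x" "Trg C (Dom C (cel x)) = ptrg x"
      "Src C (Dom C (cel y)) = psrc x" "Trg C (Dom C (cel y)) = ptrg x"
      using g good_simps[of x] good_simps[of y] by (auto simp: good_vc)
    with composite_arr[OF w(1)] composite_arr[OF w(2)] show ?thesis
      by (simp add: rwhisk_vcomp lwhisk_vcomp)
  qed
  show ?thesis
    by (rule pasting_eqI[OF True g2]) (use c g ga g2 True in \<open>auto simp: wh_sel vc_sel good_vc\<close>)
next
  case False
  \<comment> \<open>If the right side were typed, the word \<open>b\<close> would determine a common
    source by \<open>is_path_unique\<close>, and then the common middle word a common target; so the
    left side would be typed too.\<close>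
  have "\<not> good ((a |> x <| b) ;; (a |> y <| b))"
  proof
    assume "good ((a |> x <| b) ;; (a |> y <| b))"
    then have g: "good (a |> x <| b)" "good (a |> y <| b)"
      and e: "path_src b (psrc x) = path_src b (psrc y)" "path_trg a (ptrg x) = path_trg a (ptrg y)" "cd x = dm y"
      by (auto simp: good_vc wh_sel)
    have "psrc x = psrc y" "good x" "good y" using g e is_path_unique by (auto simp: good_wh)
    moreover have "ptrg x = ptrg y"
      using g e good_is_path(2)[of x] good_is_path(1)[of y] calculation is_path_unique by metis
    ultimately have "good (x ;; y)" using e by (simp add: good_vc)
    then show False using False g by (simp add: good_wh vc_sel)
  qed
  with False show ?thesis by (simp add: wh_Bad vc_Bad)
qed

lemma wh_wh: "(a |> (b |> x <| c) <| d) = (a @ b |> x <| c @ d)"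
proof (cases "good (a |> (b |> x <| c) <| d)")
  case True
  then have g: "good (b |> x <| c)" by (simp add: good_wh)
  obtain Y Y' Z Z' where w: "good x" "is_path (ptrg x) b Y" "is_path Z c (psrc x)" "is_path Y a Y'" "is_path Z' d Z"
    using True g by (auto simp: good_wh wh_sel)
  have w': "is_path (ptrg x) (a @ b) Y'" "is_path Z' (c @ d) (psrc x)" using w by (auto simp: is_path_append)
  have s: "psrc (b |> x <| c) = Z" "ptrg (b |> x <| c) = Y" "path_src c (psrc x) = Z" "path_trg b (ptrg x) = Y"
     "path_src d Z = Z'" "path_trg a Y = Y'" "path_src (c @ d) (psrc x) = Z'" "path_trg (a @ b) (ptrg x) = Y'"
    using w w' g is_path_path_src is_path_path_trg by (auto simp: wh_sel)
  have g2: "good (a @ b |> x <| c @ d)" using w w' by (auto simp: good_wh_iff)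
  have c: "composite Y a \<rhd> (composite (ptrg x) b \<rhd> cel x \<lhd> composite Z c) \<lhd> composite Z' d =
      composite (ptrg x) (a @ b) \<rhd> cel x \<lhd> composite Z' (c @ d)"
    using w composite_arr[OF w(2)] composite_arr[OF w(3)] composite_arr[OF w(4)] composite_arr[OF w(5)]
    by (simp add: composite_append good_simps lwhisk_lwhisk[symmetric] rwhisk_rwhisk[symmetric] whisk_commute)
  show ?thesis
    by (rule pasting_eqI[OF True g2]) (use c s g g2 True in \<open>auto simp: wh_sel\<close>)
next
  case False
  have "\<not> good (a @ b |> x <| c @ d)"
  proof
    assume g: "good (a @ b |> x <| c @ d)"
    then obtain Y Z Y' Z' where w: "good x" "is_path (ptrg x) b Y" "is_path Z c (psrc x)" "is_path Y a Y'" "is_path Z' d Z"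
      by (auto simp: good_wh_iff is_path_append)
    then have "good (b |> x <| c)" by (auto simp: good_wh_iff)
    moreover from this have "psrc (b |> x <| c) = Z" "ptrg (b |> x <| c) = Y"
      using w is_path_path_src is_path_path_trg by (auto simp: wh_sel)
    ultimately show False using False w by (auto simp: good_wh_iff)
  qed
  with False show ?thesis by (simp add: wh_Bad)
qed

lemma wh_Nil [simp]: "good x \<Longrightarrow> ([] |> x <| []) = x"
  by (rule pasting_eqI) (auto simp: wh_sel good_wh good_simps good_Ob)

text \<open>The two cells act on disjoint parts of a word, separated by \<open>b\<close>, so this is
  interchange with \<open>b\<close> absorbed into one factor. Typing of either side forces the
  condition \<open>?t\<close>, under which both sides are typed; otherwise both are
  \<open>Bad\<close>.\<close>

lemma swap:
  "(a |> x <| b @ dm y @ c) ;; (a @ cd x @ b |> y <| c) =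
   (a @ dm x @ b |> y <| c) ;; (a |> x <| b @ cd y @ c)" (is "?l1 ;; ?l2 = ?r1 ;; ?r2")
proof -
  let ?t = "good x \<and> good y \<and> (\<exists>A. is_path (ptrg x) a A) \<and> is_path (ptrg y) b (psrc x) \<and> (\<exists>Z. is_path Z c (psrc y))"
  have l: "?t" if g: "good (?l1 ;; ?l2)"
  proof -
    from g have g': "good ?l1" "good ?l2" "psrc ?l1 = psrc ?l2" by (auto simp: good_vc)
    then obtain Z Z1 where w: "good x" "good y" "\<exists>A. is_path (ptrg x) a A" "is_path Z (dm y @ c) Z1"
      "is_path Z1 b (psrc x)" "\<exists>Z. is_path Z c (psrc y)"
      by (auto simp: good_wh_iff is_path_append)
    have "is_path Z (b @ dm y @ c) (psrc x)" using w by (auto simp: is_path_append)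
    then have "psrc ?l1 = Z" using g' is_path_path_src by (simp add: wh_sel)
    moreover obtain Z' where z: "is_path Z' c (psrc y)" using w by auto
    moreover have "psrc ?l2 = Z'" using g' is_path_path_src z by (simp add: wh_sel)
    ultimately have "Z = Z'" using g' by simp
    then have "is_path Z (dm y @ c) (ptrg y)" using w z good_is_path by (auto simp: is_path_append)
    then show ?t using w is_path_unique by blast
  qed
  have r: "?t" if g: "good (?r1 ;; ?r2)"
  proof -
    from g have g': "good ?r1" "good ?r2" "psrc ?r1 = psrc ?r2" by (auto simp: good_vc)
    then obtain Z Z1 where w: "good x" "good y" "\<exists>A. is_path (ptrg x) a A" "is_path Z (cd y @ c) Z1"
      "is_path Z1 b (psrc x)" "\<exists>Z. is_path Z c (psrc y)"
      by (auto simp: good_wh_iff is_path_append)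
    have "is_path Z (b @ cd y @ c) (psrc x)" using w by (auto simp: is_path_append)
    then have "psrc ?r2 = Z" using g' is_path_path_src by (simp add: wh_sel)
    moreover obtain Z' where z: "is_path Z' c (psrc y)" using w by auto
    moreover have "psrc ?r1 = Z'" using g' is_path_path_src z by (simp add: wh_sel)
    ultimately have "Z = Z'" using g' by simp
    then have "is_path Z (cd y @ c) (ptrg y)" using w z good_is_path by (auto simp: is_path_append)
    then show ?t using w is_path_unique by blast
  qed
  show ?thesis
  proof (cases ?t)
    case False
    with l r show ?thesis using vc_Bad by metis
  next
    case True
    then obtain A Z where t: "good x" "good y" "is_path (ptrg x) a A" "is_path (ptrg y) b (psrc x)" "is_path Z c (psrc y)"
      by auto
    note d = good_is_path[OF t(1)] good_is_path[OF t(2)]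
    have w: "is_path Z (dm y @ c) (ptrg y)" "is_path Z (cd y @ c) (ptrg y)"
      using t d by (auto simp: is_path_append)
    then have w2: "is_path Z (b @ dm y @ c) (psrc x)" "is_path Z (b @ cd y @ c) (psrc x)"
      using t by (metis is_path_append)+
    have w3: "is_path (ptrg y) (dm x @ b) (ptrg x)" "is_path (ptrg y) (cd x @ b) (ptrg x)"
      using t d by (auto simp: is_path_append)
    then have w4: "is_path (ptrg y) (a @ dm x @ b) A" "is_path (ptrg y) (a @ cd x @ b) A"
      using t by (metis is_path_append)+
    have s: "path_src c (psrc y) = Z" "path_src (b @ dm y @ c) (psrc x) = Z" "path_src (b @ cd y @ c) (psrc x) = Z"
      "path_trg a (ptrg x) = A" "path_trg (a @ dm x @ b) (ptrg y) = A" "path_trg (a @ cd x @ b) (ptrg y) = A"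
      using t w2 w4 is_path_path_src is_path_path_trg by metis+
    have g: "good ?l1" "good ?l2" "good ?r1" "good ?r2"
      using t w2 w4 by (auto simp: good_wh_iff)
    have gg: "good (?l1 ;; ?l2)" "good (?r1 ;; ?r2)"
      using g by (auto simp: good_vc wh_sel s)
    note e = composite_arr[OF t(3)] composite_arr[OF t(4)] composite_arr[OF t(5)]
    let ?a = "composite (ptrg x) a" and ?b = "composite (ptrg y) b" and ?c = "composite Z c"
    have c: "composite Z (b @ dm y @ c) = ?b \<cdot> Dom C (cel y) \<cdot> ?c" "composite Z (b @ cd y @ c) = ?b \<cdot> Cod C (cel y) \<cdot> ?c"
      "composite (ptrg y) (a @ dm x @ b) = ?a \<cdot> Dom C (cel x) \<cdot> ?b"
      "composite (ptrg y) (a @ cd x @ b) = ?a \<cdot> Cod C (cel x) \<cdot> ?b"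
      using t d w w2 w3 by (simp_all add: composite_append good_simps)
    have x: "(cel x \<lhd> ?b \<cdot> Dom C (cel y)) \<Zsemi> (Cod C (cel x) \<cdot> ?b \<rhd> cel y) =
       (Dom C (cel x) \<cdot> ?b \<rhd> cel y) \<Zsemi> (cel x \<lhd> ?b \<cdot> Cod C (cel y))"
      using whisk_exchange[of "?b \<rhd> cel y" "cel x"] t e
      by (simp add: good_simps lwhisk_lwhisk)
    have "(?a \<rhd> cel x \<lhd> (?b \<cdot> Dom C (cel y) \<cdot> ?c)) \<Zsemi> ((?a \<cdot> Cod C (cel x) \<cdot> ?b) \<rhd> cel y \<lhd> ?c) =
    ?a \<rhd> ((cel x \<lhd> ?b \<cdot> Dom C (cel y)) \<Zsemi> (Cod C (cel x) \<cdot> ?b \<rhd> cel y)) \<lhd> ?c"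
      using t e by (simp add: good_simps lwhisk_vcomp rwhisk_vcomp rwhisk_rwhisk lwhisk_lwhisk whisk_commute)
    also have "\<dots> = ?a \<rhd> ((Dom C (cel x) \<cdot> ?b \<rhd> cel y) \<Zsemi> (cel x \<lhd> ?b \<cdot> Cod C (cel y))) \<lhd> ?c"
      unfolding x ..
    also have "\<dots> = ((?a \<cdot> Dom C (cel x) \<cdot> ?b) \<rhd> cel y \<lhd> ?c) \<Zsemi> (?a \<rhd> cel x \<lhd> (?b \<cdot> Cod C (cel y) \<cdot> ?c))"
      using t e by (simp add: good_simps lwhisk_vcomp rwhisk_vcomp rwhisk_rwhisk lwhisk_lwhisk whisk_commute)
    finally show ?thesis
      by (intro pasting_eqI[OF gg]) (use g gg s in \<open>auto simp: vc_sel wh_sel s c\<close>)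
  qed
qed

end

section \<open>Identities, inverses and cancellation of pasting cells\<close>

context two_category
begin

definition idp :: "'o \<Rightarrow> 'a list \<Rightarrow> 'o \<Rightarrow> ('o, 'a, 'c) pasting" where
  "idp X p Y = Paste X p (Id2 C (composite X p)) p Y"

definition piso :: "('o, 'a, 'c) pasting \<Rightarrow> bool" where
  "piso x \<longleftrightarrow> good x \<and> cel x \<in> iso2 C (composite (psrc x) (dm x)) (composite (psrc x) (cd x))"

definition pinv :: "('o, 'a, 'c) pasting \<Rightarrow> ('o, 'a, 'c) pasting" where
  "pinv x = (if piso x then Paste (psrc x) (cd x) (inv2 C (cel x)) (dm x) (ptrg x) else Bad)"

lemma idp_sel [simp]:
  "psrc (idp X p Y) = X" "ptrg (idp X p Y) = Y" "dm (idp X p Y) = p" "cd (idp X p Y) = p"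
  "cel (idp X p Y) = Id2 C (composite X p)"
  by (auto simp: idp_def)

lemma good_idp [simp]: "good (idp X p Y) \<longleftrightarrow> is_path X p Y"
  using composite_arr[of X p Y] by (auto simp: good_def hom2_iff) (auto simp: idp_def)

lemma idp_vc [simp]: "\<lbrakk>good x; psrc x = X; ptrg x = Y; dm x = p\<rbrakk> \<Longrightarrow> idp X p Y ;; x = x"
  using good_is_path[of x] by (intro pasting_eqI) (auto simp: good_vc vc_sel good_simps)

lemma vc_idp [simp]: "\<lbrakk>good x; psrc x = X; ptrg x = Y; cd x = p\<rbrakk> \<Longrightarrow> x ;; idp X p Y = x"
  using good_is_path[of x] by (intro pasting_eqI) (auto simp: good_vc vc_sel good_simps)

lemma wh_idp [simp]:
  assumes "is_path X p Y" "is_path Y a Z" "is_path W b X"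
  shows "(a |> idp X p Y <| b) = idp W (a @ p @ b) Z"
proof (rule pasting_eqI)
  show g: "good (a |> idp X p Y <| b)" "good (idp W (a @ p @ b) Z)"
    using assms by (auto simp: good_wh_iff is_path_append)
  have "is_path W (p @ b) Y" using assms by (auto simp: is_path_append)
  then show "cel (a |> idp X p Y <| b) = cel (idp W (a @ p @ b) Z)"
    using g assms is_path_path_trg is_path_path_src[of W b X] composite_arr by (simp add: wh_sel composite_append)
next
  have "good (a |> idp X p Y <| b)" using assms by (auto simp: good_wh_iff)
  then show "psrc (a |> idp X p Y <| b) = psrc (idp W (a @ p @ b) Z)"
    "ptrg (a |> idp X p Y <| b) = ptrg (idp W (a @ p @ b) Z)"
    "dm (a |> idp X p Y <| b) = dm (idp W (a @ p @ b) Z)"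
    "cd (a |> idp X p Y <| b) = cd (idp W (a @ p @ b) Z)"
    using assms is_path_path_trg[OF assms(2)] is_path_path_src[OF assms(3)] by (simp_all add: wh_sel)
qed

lemma piso_good: "piso x \<Longrightarrow> good x"
  by (simp add: piso_def)

lemma pinv_sel [simp]:
  assumes "piso x"
  shows "psrc (pinv x) = psrc x" "ptrg (pinv x) = ptrg x" "dm (pinv x) = cd x" "cd (pinv x) = dm x"
  using assms by (auto simp: pinv_def)

lemma cel_pinv: "piso x \<Longrightarrow> cel (pinv x) = inv2 C (cel x)"
  by (simp add: pinv_def)

lemma piso_pinv [simp]:
  assumes "piso x"
  shows "piso (pinv x)"
proof -
  have i: "inv2 C (cel x) \<in> iso2 C (composite (psrc x) (cd x)) (composite (psrc x) (dm x))"
    using assms by (simp add: piso_def iso2_inv2)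
  have "pinv x \<noteq> Bad" using assms by (simp add: pinv_def)
  with i iso2D(1)[OF i] show ?thesis
    using assms good_is_path[OF piso_good[OF assms]] by (simp add: piso_def[of "pinv x"] good_def cel_pinv)
qed

lemma good_pinv [simp]: "good (pinv x) \<longleftrightarrow> piso x"
  using piso_pinv piso_good by (metis good_Bad pinv_def)

lemma vc_pinv:
  assumes "piso x"
  shows "x ;; pinv x = idp (psrc x) (dm x) (ptrg x)" "pinv x ;; x = idp (psrc x) (cd x) (ptrg x)"
proof -
  have g: "good x" "good (x ;; pinv x)" "good (pinv x ;; x)"
    using assms by (auto simp: good_vc piso_good)
  have c: "cel x \<Zsemi> inv2 C (cel x) = Id2 C (composite (psrc x) (dm x))"
    "inv2 C (cel x) \<Zsemi> cel x = Id2 C (composite (psrc x) (cd x))"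
    using assms iso2D by (auto simp: piso_def)
  show "x ;; pinv x = idp (psrc x) (dm x) (ptrg x)"
    by (rule pasting_eqI) (use g c assms good_is_path in \<open>auto simp: vc_sel cel_pinv\<close>)
  show "pinv x ;; x = idp (psrc x) (cd x) (ptrg x)"
    by (rule pasting_eqI) (use g c assms good_is_path in \<open>auto simp: vc_sel cel_pinv\<close>)
qed

lemma pinv_unique:
  assumes "good (x ;; y)" "x ;; y = idp (psrc x) (dm x) (ptrg x)" "y ;; x = idp (psrc x) (cd x) (ptrg x)"
  shows "piso x" "pinv x = y"
proof -
  have g: "good x" "good y" "psrc x = psrc y" "ptrg x = ptrg y" "cd x = dm y"
    using assms(1) by (auto simp: good_vc)
  have d: "cd y = dm x" using vc_sel(4)[OF assms(1)] assms(2) by simp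
  then have g2: "good (y ;; x)" using g by (simp add: good_vc)
  have c: "cel x \<Zsemi> cel y = Id2 C (composite (psrc x) (dm x))" "cel y \<Zsemi> cel x = Id2 C (composite (psrc x) (cd x))"
    using vc_sel(5)[OF assms(1)] vc_sel(5)[OF g2] assms(2,3) by auto
  have h: "cel x \<in> hom2 C (composite (psrc x) (dm x)) (composite (psrc x) (cd x))"
    "cel y \<in> hom2 C (composite (psrc x) (cd x)) (composite (psrc x) (dm x))"
    using g d by (auto simp: good_def)
  show 1: "piso x" using iso2I[OF h c] g by (simp add: piso_def)
  show "pinv x = y"
    by (rule pasting_eqI) (use 1 g d inv2_unique[OF h c] in \<open>auto simp: cel_pinv\<close>)
qed

lemma vc_left_cancel:
  assumes "piso x" "good (x ;; y)" "x ;; y = x ;; z"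
  shows "y = z"
proof -
  have g: "good (x ;; z)" using assms by simp
  have "y = (pinv x ;; x) ;; y" "z = (pinv x ;; x) ;; z"
    using assms(1,2) g by (simp_all add: vc_pinv good_vc good_is_path)
  then show ?thesis using assms(3) by (simp add: vc_assoc)
qed

lemma vc_right_cancel:
  assumes "piso x" "good (y ;; x)" "y ;; x = z ;; x"
  shows "y = z"
proof -
  have g: "good (z ;; x)" using assms by simp
  have "y = y ;; (x ;; pinv x)" "z = z ;; (x ;; pinv x)"
    using assms(1,2) g by (simp_all add: vc_pinv good_vc good_is_path)
  then show ?thesis using assms(3) by (simp add: vc_assoc[symmetric])
qed

lemma piso_vc:
  assumes "piso x" "piso y" "good (x ;; y)"
  shows "piso (x ;; y)"
  using assms iso2_vcomp(1)[of "cel x" _ _ "cel y"] by (auto simp: piso_def vc_sel good_vc)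

lemma piso_wh:
  assumes "piso x" "good (a |> x <| b)"
  shows "piso (a |> x <| b)" "pinv (a |> x <| b) = (a |> pinv x <| b)"
proof -
  have g: "good (a |> pinv x <| b)" using assms by (simp add: good_wh)
  obtain Y Z where w: "is_path (ptrg x) a Y" "is_path Z b (psrc x)" using assms by (auto simp: good_wh_iff)
  have gx: "good x" using assms piso_good by blast
  have e: "(a |> x <| b) ;; (a |> pinv x <| b) = idp Z (a @ dm x @ b) Y"
    "(a |> pinv x <| b) ;; (a |> x <| b) = idp Z (a @ cd x @ b) Y"
    using w assms good_is_path[OF gx] by (simp_all add: wh_vc[symmetric] vc_pinv)
  have s: "psrc (a |> x <| b) = Z" "ptrg (a |> x <| b) = Y"
    using w assms is_path_path_src is_path_path_trg by (auto simp: wh_sel)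
  have gg: "good ((a |> x <| b) ;; (a |> pinv x <| b))"
    using g assms by (auto simp: good_vc wh_sel)
  show "piso (a |> x <| b)" "pinv (a |> x <| b) = (a |> pinv x <| b)"
    using pinv_unique[OF gg] e s assms by (auto simp: wh_sel)
qed

lemma pinv_wh_cancel:
  assumes "piso x" "good ((a |> x <| b) ;; z)"
  shows "(a |> pinv x <| b) ;; (a |> x <| b) ;; z = z"
proof -
  have g: "good (a |> x <| b)" using assms(2) by (simp add: good_vc)
  note p = piso_wh[OF assms(1) g]
  have "(pinv (a |> x <| b) ;; (a |> x <| b)) ;; z = z"
    using assms(2) p(1) by (simp add: vc_pinv good_vc good_is_path)
  then show ?thesis by (simp add: p vc_assoc)
qed

lemma wh_pinv_cancel:
  assumes "piso x" "good ((a |> pinv x <| b) ;; z)"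
  shows "(a |> x <| b) ;; (a |> pinv x <| b) ;; z = z"
proof -
  have g: "good (a |> x <| b)" using assms by (simp add: good_vc good_wh piso_good)
  note p = piso_wh[OF assms(1) g]
  have gz: "good (pinv (a |> x <| b) ;; z)" using assms(2) p by simp
  have "((a |> x <| b) ;; pinv (a |> x <| b)) ;; z = z"
    using gz p(1) piso_good[OF p(1)] by (subst vc_pinv(1)[OF p(1)]) (simp add: good_vc good_is_path)
  then show ?thesis by (simp add: p vc_assoc)
qed

lemma shift_l:
  assumes "(a |> x <| b) ;; y = z" "piso x" "good z"
  shows "y = (a |> pinv x <| b) ;; z"
  using pinv_wh_cancel[of x a b y] assms by simp

lemma shift_r:
  assumes "y ;; (a |> x <| b) = z" "piso x" "good z"
  shows "y = z ;; (a |> pinv x <| b)"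
proof -
  have g: "good (y ;; (a |> x <| b))" using assms by simp
  then have gx: "good (a |> x <| b)" by (simp add: good_vc)
  note p = piso_wh[OF assms(2) gx]
  have "y ;; ((a |> x <| b) ;; pinv (a |> x <| b)) = y"
    unfolding vc_pinv(1)[OF p(1)] using g by (simp add: good_vc)
  then show ?thesis using assms(1) by (simp add: p vc_assoc[symmetric])
qed

lemma shift_l_inv:
  assumes "(a |> pinv x <| b) ;; y = z" "piso x" "good z"
  shows "y = (a |> x <| b) ;; z"
  using wh_pinv_cancel[of x a b y] assms by simp

lemma slice_cancel_l:
  assumes "(a |> x <| b) ;; y = (a |> x <| b) ;; z" "piso x" "good ((a |> x <| b) ;; y)"
  shows "y = z"
  using vc_left_cancel[OF piso_wh(1)[OF assms(2)] assms(3,1)] assms(3) by (simp add: good_vc)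

lemma slice_cancel_r:
  assumes "y ;; (a |> x <| b) = z ;; (a |> x <| b)" "piso x" "good (y ;; (a |> x <| b))"
  shows "y = z"
  using vc_right_cancel[OF piso_wh(1)[OF assms(2)] assms(3,1)] assms(3) by (simp add: good_vc)

lemma whisker_transport:
  assumes w: "piso w" and e: "(a @ dm w |> x <| []) = (a @ dm w |> y <| [])"
    and d: "dm x = dm y" "cd x = cd y" and g: "good ((a |> w <| dm x) ;; (a @ cd w |> x <| []))"
  shows "(a @ cd w |> x <| []) = (a @ cd w |> y <| [])"
proof -
  have "(a |> w <| dm x) ;; (a @ cd w |> x <| []) = (a |> w <| dm x) ;; (a @ cd w |> y <| [])"
    using swap[of a w "[]" x "[]"] swap[of a w "[]" y "[]"] e d by simp
  then show ?thesis by (rule slice_cancel_l) (use w g in auto)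
qed

text \<open>
  Resolution with the introduction rules for \<open>typed\<close> below computes the boundary and the 2-cell of a composite
  pasting cell.
\<close>

definition typed :: "('o, 'a, 'c) pasting \<Rightarrow> 'o \<Rightarrow> 'a list \<Rightarrow> 'a list \<Rightarrow> 'o \<Rightarrow> 'c \<Rightarrow> bool" where
  "typed x X p q Y \<alpha> \<longleftrightarrow> good x \<and> psrc x = X \<and> dm x = p \<and> cd x = q \<and> ptrg x = Y \<and> cel x = \<alpha>"

lemma typed_vc: "\<lbrakk>typed x X p q Y \<alpha>; typed y X' q' r Y' \<beta>; X' = X; q' = q; Y' = Y\<rbrakk> \<Longrightarrow> typed (x ;; y) X p r Y (\<alpha> \<Zsemi> \<beta>)"
  by (auto simp: typed_def good_vc vc_sel)

lemma typed_wh: "\<lbrakk>typed x X p q Y \<alpha>; is_path Y a (path_trg a Y); is_path (path_src b X) b X\<rbrakk> \<Longrightarrow>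
    typed (a |> x <| b) (path_src b X) (a @ p @ b) (a @ q @ b) (path_trg a Y) (composite Y a \<rhd> \<alpha> \<lhd> composite (path_src b X) b)"
  by (auto simp: typed_def good_wh wh_sel)

lemma typed_good: "good x \<Longrightarrow> typed x (psrc x) (dm x) (cd x) (ptrg x) (cel x)"
  by (simp add: typed_def)

lemma typed_eqI: "\<lbrakk>typed x X p q Y \<alpha>; typed y X' p' q' Y' \<beta>; X' = X; p' = p; q' = q; Y' = Y; \<alpha> = \<beta>\<rbrakk> \<Longrightarrow> x = y"
  by (auto simp: typed_def intro: pasting_eqI)

lemma good_typed: "typed x X p q Y \<alpha> \<Longrightarrow> good x"
  by (simp add: typed_def)

lemma typed_sel: "\<lbrakk>typed x X p q Y \<alpha>; X = X'; p = p'; q = q'; Y = Y'\<rbrakk> \<Longrightarrow>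
    good x \<and> psrc x = X' \<and> dm x = p' \<and> cd x = q' \<and> ptrg x = Y'"
  by (simp add: typed_def)

lemma typed_cel_eq: "\<lbrakk>x = y; typed x X p q Y \<alpha>; typed y X' p' q' Y' \<beta>; \<alpha> = a; \<beta> = b\<rbrakk> \<Longrightarrow> a = b"
  by (auto simp: typed_def)

lemma whisk_cong_vc: "x = y \<Longrightarrow> (p |> x <| q) ;; k = (p |> y <| q) ;; k"
  by simp

lemma whisk_cong: "x = y \<Longrightarrow> (p |> x <| q) = (p |> y <| q)"
  by simp

lemmas wh_simps = wh_vc wh_wh vc_assoc append.simps append_Nil2

text \<open>
  Interchange, oriented so that slices further to the right come first: as rewrite rules, \<open>slide\<close> and
  \<open>slide_vc\<close> bring two pastings that differ by interchange to the same normal form.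
\<close>

lemma slide:
  assumes "l = a @ cd x @ drop (length (a @ cd x)) l" "r = drop (length (a @ cd x)) l @ dm y @ c"
  shows "(a |> x <| r) ;; (l |> y <| c) =
    (a @ dm x @ drop (length (a @ cd x)) l |> y <| c) ;; (a |> x <| drop (length (a @ cd x)) l @ cd y @ c)"
  using swap[of a x "drop (length (a @ cd x)) l" y c] assms by metis

lemma slide_vc:
  assumes "l = a @ cd x @ drop (length (a @ cd x)) l" "r = drop (length (a @ cd x)) l @ dm y @ c"
  shows "(a |> x <| r) ;; (l |> y <| c) ;; k =
    (a @ dm x @ drop (length (a @ cd x)) l |> y <| c) ;; (a |> x <| drop (length (a @ cd x)) l @ cd y @ c) ;; k"
  using slide[OF assms] by (metis vc_assoc)

end

subsection \<open>Pseudofunctors and pseudonatural transformations on pasting cells\<close>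

context two_category
begin

text \<open>
  \<open>fm F\<close> conjugates the image of a 2-cell by the constraints of \<open>F\<close>, so that \<open>F\<close> becomes a strict 2-functor
  acting letterwise on words.
\<close>

primrec constraint :: "('o, 'a, 'c) pfun \<Rightarrow> 'o \<Rightarrow> 'a list \<Rightarrow> 'c" where
  "constraint F X [] = unitor F X"
| "constraint F X (f # p) = (arr_map F f \<rhd> constraint F X p) \<Zsemi> compositor F f (composite X p)"

definition fm :: "('o, 'a, 'c) pfun \<Rightarrow> ('o, 'a, 'c) pasting \<Rightarrow> ('o, 'a, 'c) pasting" where
  "fm F x = (if good x then Paste (ob_map F (psrc x)) (map (arr_map F) (dm x))
      (constraint F (psrc x) (dm x) \<Zsemi> cell_map F (cel x) \<Zsemi> inv2 C (constraint F (psrc x) (cd x)))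
      (map (arr_map F) (cd x)) (ob_map F (ptrg x)) else Bad)"

lemma pf_arr:
  assumes "pseudofunctor C F" "f \<in> Arr C"
  shows "arr_map F f \<in> Arr C" "Src C (arr_map F f) = ob_map F (Src C f)"
    "Trg C (arr_map F f) = ob_map F (Trg C f)"
  using pseudofunctor.arr_map[OF assms(1), of f "Src C f" "Trg C f"] assms(2) by (auto simp: hom1_iff)

lemma pf_cell:
  assumes "pseudofunctor C F" "\<alpha> \<in> Cell C"
  shows "cell_map F \<alpha> \<in> Cell C" "Dom C (cell_map F \<alpha>) = arr_map F (Dom C \<alpha>)"
    "Cod C (cell_map F \<alpha>) = arr_map F (Cod C \<alpha>)"
  using pseudofunctor.cell_map[OF assms(1), of \<alpha> "Dom C \<alpha>" "Cod C \<alpha>"] assms(2) by (auto simp: hom2_iff)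

lemma pf_compositor:
  assumes "pseudofunctor C F" "f \<in> Arr C" "g \<in> Arr C" "Src C g = Trg C f"
  shows "compositor F g f \<in> iso2 C (arr_map F g \<cdot> arr_map F f) (arr_map F (g \<cdot> f))"
    "compositor F g f \<in> Cell C" "Dom C (compositor F g f) = arr_map F g \<cdot> arr_map F f"
    "Cod C (compositor F g f) = arr_map F (g \<cdot> f)"
proof -
  show "compositor F g f \<in> iso2 C (arr_map F g \<cdot> arr_map F f) (arr_map F (g \<cdot> f))"
    using pseudofunctor.compositor_iso[OF assms(1), of f "Src C f" "Trg C f" g "Trg C g"] assms(2-)
    by (auto simp: hom1_iff)
  then show "compositor F g f \<in> Cell C" "Dom C (compositor F g f) = arr_map F g \<cdot> arr_map F f"
    "Cod C (compositor F g f) = arr_map F (g \<cdot> f)" using iso2_cell by blast+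
qed

lemma pf_unitor:
  assumes "pseudofunctor C F" "X \<in> Ob C"
  shows "unitor F X \<in> iso2 C (Id1 C (ob_map F X)) (arr_map F (Id1 C X))"
    "unitor F X \<in> Cell C" "Dom C (unitor F X) = Id1 C (ob_map F X)"
    "Cod C (unitor F X) = arr_map F (Id1 C X)"
  using pseudofunctor.unitor_iso[OF assms] iso2_cell by blast+

lemma is_path_map: "pseudofunctor C F \<Longrightarrow> is_path X p Y \<Longrightarrow> is_path (ob_map F X) (map (arr_map F) p) (ob_map F Y)"
  by (induction p arbitrary: Y) (auto simp: pf_arr pseudofunctor.ob_map)

lemma constraint_iso:
  assumes F: "pseudofunctor C F"
  shows "is_path X p Y \<Longrightarrow> constraint F X p \<in> iso2 C (composite (ob_map F X) (map (arr_map F) p)) (arr_map F (composite X p))"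
proof (induction p arbitrary: Y)
  case Nil
  then have "X \<in> Ob C" by auto
  then show ?case using pf_unitor[OF F] by simp
next
  case (Cons f p)
  then have w: "is_path X p (Src C f)" "f \<in> Arr C" by auto
  note c = composite_arr[OF w(1)] composite_arr[OF is_path_map[OF F w(1)]]
  show ?case
    using iso2_vcomp(1)[OF iso2_lwhisk(1)[OF Cons.IH[OF w(1)]] pf_compositor(1)[OF F]] c w pf_arr[OF F]
    by simp
qed

lemmas constraint_cell = iso2_cell(1-3)[OF constraint_iso]

lemma good_fm: "pseudofunctor C F \<Longrightarrow> good x \<Longrightarrow> good (fm F x)"
  using constraint_iso[of F "psrc x" "dm x" "ptrg x"] constraint_iso[of F "psrc x" "cd x" "ptrg x"]
    iso2_cell[of "constraint F (psrc x) (dm x)"] iso2_cell[of "constraint F (psrc x) (cd x)"]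
    good_is_path[of x] is_path_map good_cel[of x] pf_cell[of F "cel x"]
  by (subst good_def) (auto simp: fm_def hom2_iff)

lemma fm_Bad [simp]: "\<not> good x \<Longrightarrow> fm F x = Bad"
  by (simp add: fm_def)

lemma good_fm_iff [simp]: "pseudofunctor C F \<Longrightarrow> good (fm F x) \<longleftrightarrow> good x"
  using good_fm fm_Bad good_Bad by metis

lemma fm_sel:
  assumes "good x"
  shows "psrc (fm F x) = ob_map F (psrc x)" "ptrg (fm F x) = ob_map F (ptrg x)"
    "dm (fm F x) = map (arr_map F) (dm x)" "cd (fm F x) = map (arr_map F) (cd x)"
    "cel (fm F x) = constraint F (psrc x) (dm x) \<Zsemi> cell_map F (cel x) \<Zsemi> inv2 C (constraint F (psrc x) (cd x))"
  using assms by (auto simp: fm_def)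

lemma fm_constraint:
  assumes "pseudofunctor C F" "good x"
  shows "cel (fm F x) \<Zsemi> constraint F (psrc x) (cd x) = constraint F (psrc x) (dm x) \<Zsemi> cell_map F (cel x)"
proof -
  note i = constraint_iso[OF assms(1) good_is_path(1)[OF assms(2)]] constraint_iso[OF assms(1) good_is_path(2)[OF assms(2)]]
  note c = iso2_cell[OF i(1)] iso2_cell[OF i(2)] pf_cell[OF assms(1), of "cel x"] good_cel[OF assms(2)]
  have "cel (fm F x) \<Zsemi> constraint F (psrc x) (cd x) =
     constraint F (psrc x) (dm x) \<Zsemi> cell_map F (cel x) \<Zsemi> (inv2 C (constraint F (psrc x) (cd x)) \<Zsemi> constraint F (psrc x) (cd x))"
    using c by (simp add: fm_sel[OF assms(2)])
  also have "\<dots> = constraint F (psrc x) (dm x) \<Zsemi> cell_map F (cel x)"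
    using c by (simp add: iso2D(4)[OF i(2)])
  finally show ?thesis .
qed

text \<open>The constraint of the codomain word is invertible, so compatibility with the constraints
  determines the cell. This characterises \<open>fm F x\<close> without \<open>inv2\<close>, and the
  laws of composition and whiskering are checked in this form.\<close>

lemma fm_eqI:
  assumes F: "pseudofunctor C F" and x: "good x" and y: "good y"
    and s: "psrc y = ob_map F (psrc x)" "ptrg y = ob_map F (ptrg x)"
      "dm y = map (arr_map F) (dm x)" "cd y = map (arr_map F) (cd x)"
    and e: "cel y \<Zsemi> constraint F (psrc x) (cd x) = constraint F (psrc x) (dm x) \<Zsemi> cell_map F (cel x)"
  shows "fm F x = y"
proof (rule pasting_eqI[OF good_fm[OF F x] y])
  show "cel (fm F x) = cel y"
  proof (rule iso2_cancel_right)
    show "constraint F (psrc x) (cd x) \<in> iso2 C (composite (ob_map F (psrc x)) (map (arr_map F) (cd x)))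
        (arr_map F (composite (psrc x) (cd x)))"
      using constraint_iso[OF F good_is_path(2)[OF x]] .
    show "cel (fm F x) \<Zsemi> constraint F (psrc x) (cd x) = cel y \<Zsemi> constraint F (psrc x) (cd x)"
      using fm_constraint[OF F x] e by simp
  qed (use good_fm[OF F x] y s in \<open>auto simp: good_def[of y] good_def[of "fm F x"] fm_sel[OF x]\<close>)
qed (use s in \<open>auto simp: fm_sel[OF x]\<close>)

lemma fm_vc:
  assumes F: "pseudofunctor C F" and g: "good (x ;; y)"
  shows "fm F (x ;; y) = fm F x ;; fm F y"
proof (rule fm_eqI[OF F g])
  have v: "good x" "good y" "psrc y = psrc x" "ptrg y = ptrg x" "dm y = cd x"
    using g by (auto simp: good_vc)
  show gg: "good (fm F x ;; fm F y)" using F v by (simp add: good_vc fm_sel)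
  note c = constraint_cell[OF F good_is_path(1)[OF v(1)]] constraint_cell[OF F good_is_path(2)[OF v(1)]]
    constraint_cell[OF F good_is_path(2)[OF v(2)]] good_cel[OF v(1)] good_cel[OF v(2)]
    good_cel[OF good_fm[OF F v(1)]] good_cel[OF good_fm[OF F v(2)]]
    pf_cell[OF F, of "cel x"] pf_cell[OF F, of "cel y"]
  have "(cel (fm F x) \<Zsemi> cel (fm F y)) \<Zsemi> constraint F (psrc y) (cd y) =
      cel (fm F x) \<Zsemi> (cel (fm F y) \<Zsemi> constraint F (psrc y) (cd y))"
    using c v by (simp add: fm_sel)
  also have "\<dots> = (cel (fm F x) \<Zsemi> constraint F (psrc x) (cd x)) \<Zsemi> cell_map F (cel y)"
    unfolding fm_constraint[OF F v(2)] using c v by (simp add: fm_sel)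
  also have "\<dots> = constraint F (psrc x) (dm x) \<Zsemi> (cell_map F (cel x) \<Zsemi> cell_map F (cel y))"
    unfolding fm_constraint[OF F v(1)] using c v by simp
  also have "cell_map F (cel x) \<Zsemi> cell_map F (cel y) = cell_map F (cel x \<Zsemi> cel y)"
    using pseudofunctor.cell_map_vcomp[OF F, of "cel x" _ _ "cel y"] c v by (simp add: hom2_iff)
  finally show "cel (fm F x ;; fm F y) \<Zsemi> constraint F (psrc (x ;; y)) (cd (x ;; y)) =
      constraint F (psrc (x ;; y)) (dm (x ;; y)) \<Zsemi> cell_map F (cel (x ;; y))"
    using g gg v by (simp add: vc_sel)
qed (use g F in \<open>auto simp: good_vc vc_sel fm_sel\<close>)

lemma fm_idp:
  assumes F: "pseudofunctor C F" and w: "is_path X p Y"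
  shows "fm F (idp X p Y) = idp (ob_map F X) (map (arr_map F) p) (ob_map F Y)"
  using constraint_cell[OF F w] pseudofunctor.cell_map_Id2[OF F, of "composite X p"] composite_arr[OF w]
  by (intro fm_eqI[OF F]) (auto simp: w is_path_map[OF F])

text \<open>Induction on \<open>p\<close>: the empty word is the left unit law of \<open>F\<close>,
  and the step is associativity of the compositors.\<close>

lemma constraint_append:
  assumes F: "pseudofunctor C F" and q: "is_path X q Z"
  shows "is_path Z p Y \<Longrightarrow> constraint F X (p @ q) =
    (composite (ob_map F Z) (map (arr_map F) p) \<rhd> constraint F X q) \<Zsemi> (constraint F Z p \<lhd> arr_map F (composite X q)) \<Zsemi>
    compositor F (composite Z p) (composite X q)"
proof (induction p arbitrary: Y)
  case Nil
  note c = constraint_cell[OF F q] composite_arr[OF q] composite_arr[OF is_path_map[OF F q]] pf_arr[OF F] pf_unitor[OF F]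
    pseudofunctor.ob_map[OF F]
  have Z: "Z \<in> Ob C" using Nil by auto
  have "(unitor F Z \<lhd> arr_map F (composite X q)) \<Zsemi> compositor F (Id1 C Z) (composite X q) = Id2 C (arr_map F (composite X q))"
    using pseudofunctor.unitor_left[OF F] c by (auto simp: hom1_iff)
  then show ?case using c Z by simp
next
  case (Cons f p)
  then have w: "is_path Z p (Src C f)" "f \<in> Arr C" by auto
  note c = constraint_cell[OF F q] constraint_cell[OF F w(1)] composite_arr[OF q] composite_arr[OF is_path_map[OF F q]] pf_arr[OF F]
    composite_arr[OF w(1)] composite_arr[OF is_path_map[OF F w(1)]] pf_compositor[OF F]
  let ?f = "arr_map F f" and ?p = "composite (ob_map F Z) (map (arr_map F) p)" and ?q = "arr_map F (composite X q)"
  have a: "(?f \<rhd> compositor F (composite Z p) (composite X q)) \<Zsemi> compositor F f (composite Z p \<cdot> composite X q) =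
      (compositor F f (composite Z p) \<lhd> ?q) \<Zsemi> compositor F (f \<cdot> composite Z p) (composite X q)"
    using pseudofunctor.compositor_assoc[OF F, of "composite X q" X Z "composite Z p" "Src C f" f "Trg C f"] c w
    by (simp add: hom1_iff)
  have "constraint F X ((f # p) @ q) = (?f \<cdot> ?p \<rhd> constraint F X q) \<Zsemi> (?f \<rhd> constraint F Z p \<lhd> ?q) \<Zsemi>
     ((?f \<rhd> compositor F (composite Z p) (composite X q)) \<Zsemi> compositor F f (composite Z p \<cdot> composite X q))"
    using c w composite_append[OF q w(1)] by (simp add: Cons.IH[OF w(1)] lwhisk_vcomp lwhisk_lwhisk)
  also have "\<dots> = (?f \<cdot> ?p \<rhd> constraint F X q) \<Zsemi> (constraint F Z (f # p) \<lhd> ?q) \<Zsemi> compositor F (composite Z (f # p)) (composite X q)"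
    unfolding a using c w by (simp add: rwhisk_vcomp whisk_commute)
  finally show ?case by simp
qed

text \<open>After \<open>constraint_append\<close>, the image of the cell passes the constraint of
  \<open>a\<close> by interchange and the compositor by its naturality. With the mirror image below,
  this makes \<open>fm F\<close> strict with respect to whiskering.\<close>

lemma fm_wh_left:
  assumes F: "pseudofunctor C F" and g: "good x" and a: "is_path (ptrg x) a Y"
  shows "fm F (a |> x <| []) = (map (arr_map F) a |> fm F x <| [])"
proof -
  let ?X = "psrc x" and ?Z = "ptrg x"
  have gl: "good (a |> x <| [])" using g a good_Ob[OF g] by (auto simp: good_wh_iff)
  have gr: "good (map (arr_map F) a |> fm F x <| [])"
    using g good_Ob[OF good_fm[OF F g]] is_path_map[OF F a] F by (auto simp: good_wh_iff fm_sel)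
  have t: "path_trg a ?Z = Y" "path_trg (map (arr_map F) a) (ob_map F ?Z) = ob_map F Y"
    using is_path_path_trg a is_path_map[OF F a] by auto
  note c = good_cel[OF g] good_cel[OF good_fm[OF F g]] fm_sel(1-4)[OF g, of F] good_composite[OF g]
    good_composite[OF good_fm[OF F g]]
    constraint_cell[OF F good_is_path(1)[OF g]] constraint_cell[OF F good_is_path(2)[OF g]] constraint_cell[OF F a]
    composite_arr[OF a] composite_arr[OF is_path_map[OF F a]] pf_arr[OF F] pf_compositor[OF F] pf_cell[OF F]
  let ?A = "composite ?Z a" and ?A' = "composite (ob_map F ?Z) (map (arr_map F) a)"
  let ?p = "composite ?X (dm x)" and ?q = "composite ?X (cd x)"
  have n: "compositor F ?A ?p \<Zsemi> cell_map F (?A \<rhd> cel x) =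
     (arr_map F ?A \<rhd> cell_map F (cel x)) \<Zsemi> compositor F ?A ?q"
    using pseudofunctor.compositor_natural[OF F, of ?p ?X ?Z ?A Y "cel x" ?q "Id2 C ?A" ?A]
      pseudofunctor.cell_map_Id2[OF F, of ?A] c
    by (simp add: hom1_iff hom2_iff lwhisk_def)
  have x: "(constraint F ?Z a \<lhd> arr_map F ?p) \<Zsemi> (arr_map F ?A \<rhd> cell_map F (cel x)) =
      (?A' \<rhd> cell_map F (cel x)) \<Zsemi> (constraint F ?Z a \<lhd> arr_map F ?q)"
    using whisk_exchange[of "cell_map F (cel x)" "constraint F ?Z a"] c by simp
  have "(?A' \<rhd> cel (fm F x)) \<Zsemi> (?A' \<rhd> constraint F ?X (cd x)) \<Zsemi> (constraint F ?Z a \<lhd> arr_map F ?q) \<Zsemi> compositor F ?A ?q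
     = (?A' \<rhd> (cel (fm F x) \<Zsemi> constraint F ?X (cd x))) \<Zsemi> (constraint F ?Z a \<lhd> arr_map F ?q) \<Zsemi> compositor F ?A ?q"
    using c by (simp add: lwhisk_vcomp)
  also have "\<dots> = (?A' \<rhd> constraint F ?X (dm x)) \<Zsemi> ((?A' \<rhd> cell_map F (cel x)) \<Zsemi> (constraint F ?Z a \<lhd> arr_map F ?q)) \<Zsemi>
      compositor F ?A ?q"
    unfolding fm_constraint[OF F g] using c by (simp add: lwhisk_vcomp)
  also have "\<dots> = (?A' \<rhd> constraint F ?X (dm x)) \<Zsemi> (constraint F ?Z a \<lhd> arr_map F ?p) \<Zsemi>
      ((arr_map F ?A \<rhd> cell_map F (cel x)) \<Zsemi> compositor F ?A ?q)"
    unfolding x[symmetric] using c by simp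
  also have "\<dots> = ((?A' \<rhd> constraint F ?X (dm x)) \<Zsemi> (constraint F ?Z a \<lhd> arr_map F ?p) \<Zsemi>
      compositor F ?A ?p) \<Zsemi> cell_map F (?A \<rhd> cel x)"
    unfolding n[symmetric] using c by simp
  finally have e: "(?A' \<rhd> cel (fm F x)) \<Zsemi> constraint F ?X (a @ cd x) = constraint F ?X (a @ dm x) \<Zsemi> cell_map F (?A \<rhd> cel x)"
    using constraint_append[OF F good_is_path(2)[OF g] a] constraint_append[OF F good_is_path(1)[OF g] a] by simp
  show ?thesis
    by (rule fm_eqI[OF F gl gr]) (use e t g gl gr good_Ob[OF g] c in \<open>simp_all add: wh_sel\<close>)
qed

lemma fm_wh_right:
  assumes F: "pseudofunctor C F" and g: "good x" and b: "is_path W b (psrc x)"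
  shows "fm F ([] |> x <| b) = ([] |> fm F x <| map (arr_map F) b)"
proof -
  let ?X = "psrc x" and ?Z = "ptrg x"
  have gl: "good ([] |> x <| b)" using g b good_Ob[OF g] by (auto simp: good_wh_iff)
  have gr: "good ([] |> fm F x <| map (arr_map F) b)"
    using g good_Ob[OF good_fm[OF F g]] is_path_map[OF F b] F by (auto simp: good_wh_iff fm_sel)
  have t: "path_src b ?X = W" "path_src (map (arr_map F) b) (ob_map F ?X) = ob_map F W"
    using is_path_path_src b is_path_map[OF F b] by auto
  note c = good_cel[OF g] good_cel[OF good_fm[OF F g]] fm_sel(1-4)[OF g, of F] good_composite[OF g]
    good_composite[OF good_fm[OF F g]]
    constraint_cell[OF F good_is_path(1)[OF g]] constraint_cell[OF F good_is_path(2)[OF g]] constraint_cell[OF F b]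
    composite_arr[OF b] composite_arr[OF is_path_map[OF F b]] pf_arr[OF F] pf_compositor[OF F] pf_cell[OF F]
  let ?B = "composite W b" and ?B' = "composite (ob_map F W) (map (arr_map F) b)"
  let ?p = "composite ?X (dm x)" and ?q = "composite ?X (cd x)"
  let ?p' = "composite (ob_map F ?X) (map (arr_map F) (dm x))" and ?q' = "composite (ob_map F ?X) (map (arr_map F) (cd x))"
  have n: "compositor F ?p ?B \<Zsemi> cell_map F (cel x \<lhd> ?B) =
     (cell_map F (cel x) \<lhd> arr_map F ?B) \<Zsemi> compositor F ?q ?B"
    using pseudofunctor.compositor_natural[OF F, of ?B W ?X ?p ?Z "Id2 C ?B" ?B "cel x" ?q]
      pseudofunctor.cell_map_Id2[OF F, of ?B] c
    by (simp add: hom1_iff hom2_iff rwhisk_def)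
  have x: "(cel (fm F x) \<lhd> ?B') \<Zsemi> (?q' \<rhd> constraint F W b) = (?p' \<rhd> constraint F W b) \<Zsemi> (cel (fm F x) \<lhd> arr_map F ?B)"
    using whisk_exchange[of "constraint F W b" "cel (fm F x)"] c by simp
  have "(cel (fm F x) \<lhd> ?B') \<Zsemi> (?q' \<rhd> constraint F W b) \<Zsemi> (constraint F ?X (cd x) \<lhd> arr_map F ?B) \<Zsemi> compositor F ?q ?B
     = ((cel (fm F x) \<lhd> ?B') \<Zsemi> (?q' \<rhd> constraint F W b)) \<Zsemi> (constraint F ?X (cd x) \<lhd> arr_map F ?B) \<Zsemi> compositor F ?q ?B"
    using c by simp
  also have "\<dots> = (?p' \<rhd> constraint F W b) \<Zsemi> ((cel (fm F x) \<Zsemi> constraint F ?X (cd x)) \<lhd> arr_map F ?B) \<Zsemi> compositor F ?q ?B"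
    unfolding x using c by (simp add: rwhisk_vcomp)
  also have "\<dots> = (?p' \<rhd> constraint F W b) \<Zsemi> (constraint F ?X (dm x) \<lhd> arr_map F ?B) \<Zsemi>
      ((cell_map F (cel x) \<lhd> arr_map F ?B) \<Zsemi> compositor F ?q ?B)"
    unfolding fm_constraint[OF F g] using c by (simp add: rwhisk_vcomp)
  also have "\<dots> = ((?p' \<rhd> constraint F W b) \<Zsemi> (constraint F ?X (dm x) \<lhd> arr_map F ?B) \<Zsemi>
      compositor F ?p ?B) \<Zsemi> cell_map F (cel x \<lhd> ?B)"
    unfolding n[symmetric] using c by simp
  finally have e: "(cel (fm F x) \<lhd> ?B') \<Zsemi> constraint F W (cd x @ b) = constraint F W (dm x @ b) \<Zsemi> cell_map F (cel x \<lhd> ?B)"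
    using constraint_append[OF F b good_is_path(2)[OF g]] constraint_append[OF F b good_is_path(1)[OF g]] by simp
  show ?thesis
    by (rule fm_eqI[OF F gl gr]) (use e t g gl gr good_Ob[OF g] c in \<open>simp_all add: wh_sel\<close>)
qed

lemma fm_wh:
  assumes F: "pseudofunctor C F" and g: "good (a |> x <| b)"
  shows "fm F (a |> x <| b) = (map (arr_map F) a |> fm F x <| map (arr_map F) b)"
proof -
  obtain Y Z where w: "good x" "is_path (ptrg x) a Y" "is_path Z b (psrc x)" using g by (auto simp: good_wh_iff)
  have gb: "good ([] |> x <| b)" using w good_Ob by (auto simp: good_wh_iff)
  have "fm F (a |> ([] |> x <| b) <| []) = (map (arr_map F) a |> fm F ([] |> x <| b) <| [])"
    by (rule fm_wh_left[OF F gb]) (use w gb in \<open>auto simp: wh_sel\<close>)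
  then show ?thesis by (simp add: fm_wh_right[OF F w(1,3)] wh_wh)
qed

lemma piso_fm:
  assumes F: "pseudofunctor C F" and p: "piso x"
  shows "piso (fm F x)" "pinv (fm F x) = fm F (pinv x)"
proof -
  have g: "good x" "good (x ;; pinv x)" "good (pinv x ;; x)" using p by (auto simp: good_vc piso_good)
  have e: "fm F x ;; fm F (pinv x) = idp (psrc (fm F x)) (dm (fm F x)) (ptrg (fm F x))"
    "fm F (pinv x) ;; fm F x = idp (psrc (fm F x)) (cd (fm F x)) (ptrg (fm F x))"
    using g good_is_path[OF g(1)] p F by (simp_all add: fm_vc[symmetric] vc_pinv fm_idp fm_sel)
  have gg: "good (fm F x ;; fm F (pinv x))"
    unfolding e using g F good_fm[OF F g(1)] good_is_path by simp
  show "piso (fm F x)" "pinv (fm F x) = fm F (pinv x)"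
    using pinv_unique[OF gg e] by auto
qed

section \<open>The identity pseudofunctor and composite pseudofunctors\<close>

lemma pf_id_pseudofunctor: "pseudofunctor C (pf_id C)"
  by unfold_locales
    (auto simp: pf_id_def hom1_iff hom2_iff Src_Ob Trg_Ob)

text \<open>Required because \<open>m\<close>, \<mu> and \<lambda> are transformations between
  composites of \<open>T\<close> and \<open>P\<close>. Each coherence law combines the law of
  \<open>G\<close> with the image under \<open>G\<close> of the law of \<open>F\<close>; naturality
  of the compositor of \<open>G\<close> brings the two next to each other.\<close>

lemma pf_comp_pseudofunctor:
  assumes G: "pseudofunctor C G" and F: "pseudofunctor C F"
  shows "pseudofunctor C (pf_comp C G F)"
proof -
  note FG = pf_arr[OF F] pf_arr[OF G] pf_cell[OF F] pf_cell[OF G] pf_compositor(2-4)[OF F]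
    pf_compositor(2-4)[OF G] pf_unitor(2-4)[OF F] pf_unitor(2-4)[OF G]
    pseudofunctor.ob_map[OF F] pseudofunctor.ob_map[OF G]
  have G_vcomp: "cell_map G (\<alpha> \<Zsemi> \<beta>) = cell_map G \<alpha> \<Zsemi> cell_map G \<beta>"
    if "\<alpha> \<in> Cell C" "\<beta> \<in> Cell C" "Cod C \<alpha> = Dom C \<beta>" for \<alpha> \<beta>
    using pseudofunctor.cell_map_vcomp[OF G, of \<alpha> _ _ \<beta>] that by (simp add: hom2_iff)
  have F_vcomp: "cell_map F (\<alpha> \<Zsemi> \<beta>) = cell_map F \<alpha> \<Zsemi> cell_map F \<beta>"
    if "\<alpha> \<in> Cell C" "\<beta> \<in> Cell C" "Cod C \<alpha> = Dom C \<beta>" for \<alpha> \<beta>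
    using pseudofunctor.cell_map_vcomp[OF F, of \<alpha> _ _ \<beta>] that by (simp add: hom2_iff)
  have G_iso: "cell_map G \<alpha> \<in> iso2 C (arr_map G f) (arr_map G g)" if a: "\<alpha> \<in> iso2 C f g" for \<alpha> f g
  proof (rule iso2I)
    note i = iso2D[OF a] iso2_cell[OF a]
    have "f \<in> Arr C" "g \<in> Arr C" using i hom2_dom hom2_cod by blast+
    then show "cell_map G \<alpha> \<in> hom2 C (arr_map G f) (arr_map G g)"
      "cell_map G (inv2 C \<alpha>) \<in> hom2 C (arr_map G g) (arr_map G f)"
      "cell_map G \<alpha> \<Zsemi> cell_map G (inv2 C \<alpha>) = Id2 C (arr_map G f)"
      "cell_map G (inv2 C \<alpha>) \<Zsemi> cell_map G \<alpha> = Id2 C (arr_map G g)"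
      using i by (simp_all add: G_vcomp[symmetric] pseudofunctor.cell_map_Id2[OF G] hom2_iff FG)
  qed
  have G_nat: "compositor G g f \<Zsemi> cell_map G (\<beta> \<star> \<alpha>) = (cell_map G \<beta> \<star> cell_map G \<alpha>) \<Zsemi> compositor G g' f'"
    if "f \<in> Arr C" "g \<in> Arr C" "Src C g = Trg C f" "\<alpha> \<in> Cell C" "Dom C \<alpha> = f" "Cod C \<alpha> = f'"
      "\<beta> \<in> Cell C" "Dom C \<beta> = g" "Cod C \<beta> = g'" for f g \<alpha> \<beta> f' g'
    using pseudofunctor.compositor_natural[OF G, of f "Src C f" "Trg C f" g "Trg C g" \<alpha> f' \<beta> g'] that
    by (simp add: hom1_iff hom2_iff)
  have G_nat_l: "compositor G g (Dom C \<alpha>) \<Zsemi> cell_map G (g \<rhd> \<alpha>) = (arr_map G g \<rhd> cell_map G \<alpha>) \<Zsemi> compositor G g (Cod C \<alpha>)"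
    if "g \<in> Arr C" "\<alpha> \<in> Cell C" "Src C g = Trg C (Dom C \<alpha>)" for g \<alpha>
    using that G_nat[of "Dom C \<alpha>" g \<alpha> _ "Id2 C g"] by (simp add: lwhisk_def pseudofunctor.cell_map_Id2[OF G])
  have G_nat_r: "compositor G (Dom C \<alpha>) g \<Zsemi> cell_map G (\<alpha> \<lhd> g) = (cell_map G \<alpha> \<lhd> arr_map G g) \<Zsemi> compositor G (Cod C \<alpha>) g"
    if "g \<in> Arr C" "\<alpha> \<in> Cell C" "Trg C g = Src C (Dom C \<alpha>)" for g \<alpha>
    using that G_nat[of g "Dom C \<alpha>" "Id2 C g" _ \<alpha>] by (simp add: rwhisk_def pseudofunctor.cell_map_Id2[OF G])
  show ?thesis
  proof (unfold_locales, goal_cases)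
    case 1 then show ?case by (simp add: pf_comp_def FG)
  next
    case 2 then show ?case by (simp add: pf_comp_def FG hom1_iff)
  next
    case 3 then show ?case by (simp add: pf_comp_def FG hom2_iff)
  next
    case 4 then show ?case
      by (simp add: pf_comp_def FG pseudofunctor.cell_map_Id2[OF G] pseudofunctor.cell_map_Id2[OF F])
  next
    case 5 then show ?case by (simp add: pf_comp_def FG G_vcomp F_vcomp hom2_iff)
  next
    case (6 f X Y g Z)
    then show ?case
      using iso2_vcomp(1)[OF pf_compositor(1)[OF G] G_iso[OF pf_compositor(1)[OF F]]]
      by (simp add: pf_comp_def FG hom1_iff)
  next
    case (7 X)
    then show ?case
      using iso2_vcomp(1)[OF pf_unitor(1)[OF G] G_iso[OF pf_unitor(1)[OF F]]]
      by (simp add: pf_comp_def FG)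
  next
    case (8 f X Y g Z \<alpha> f' \<beta> g')
    have a: "f' \<in> Arr C" "g' \<in> Arr C" "Src C g' = Trg C f'" "Src C f' = X"  "Trg C f' = Y"
      using 8 hom2_parallel hom1_iff by metis+
    have t: "compositor F g f \<Zsemi> cell_map F (\<beta> \<star> \<alpha>) = (cell_map F \<beta> \<star> cell_map F \<alpha>) \<Zsemi> compositor F g' f'"
      using pseudofunctor.compositor_natural[OF F 8] .
    let ?c = "compositor G (arr_map F g) (arr_map F f)"
    have "(?c \<Zsemi> cell_map G (compositor F g f)) \<Zsemi> cell_map G (cell_map F (\<beta> \<star> \<alpha>)) =
    ?c \<Zsemi> cell_map G (compositor F g f \<Zsemi> cell_map F (\<beta> \<star> \<alpha>))"
      using 8 by (simp add: FG hom1_iff hom2_iff G_vcomp)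
    also have "\<dots> = (?c \<Zsemi> cell_map G (cell_map F \<beta> \<star> cell_map F \<alpha>)) \<Zsemi> cell_map G (compositor F g' f')"
      unfolding t using 8 a by (simp add: FG hom1_iff hom2_iff G_vcomp)
    also have "?c \<Zsemi> cell_map G (cell_map F \<beta> \<star> cell_map F \<alpha>) =
      (cell_map G (cell_map F \<beta>) \<star> cell_map G (cell_map F \<alpha>)) \<Zsemi> compositor G (arr_map F g') (arr_map F f')"
      using 8 a by (intro G_nat) (simp_all add: FG hom1_iff hom2_iff)
    finally show ?case using 8 a by (simp add: pf_comp_def FG hom1_iff hom2_iff)
  next
    case (9 f W X g Y h Z)
    have t: "(arr_map F h \<rhd> compositor F g f) \<Zsemi> compositor F h (g \<cdot> f) =
          (compositor F h g \<lhd> arr_map F f) \<Zsemi> compositor F (h \<cdot> g) f"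
      using pseudofunctor.compositor_assoc[OF F 9] .
    let ?f = "arr_map F f" and ?g = "arr_map F g" and ?h = "arr_map F h"
    have h: "?f \<in> hom1 C (ob_map F W) (ob_map F X)" "?g \<in> hom1 C (ob_map F X) (ob_map F Y)"
      "?h \<in> hom1 C (ob_map F Y) (ob_map F Z)" using 9 by (auto simp: hom1_iff FG)
    have t': "(arr_map G ?h \<rhd> compositor G ?g ?f) \<Zsemi> compositor G ?h (?g \<cdot> ?f) =
          (compositor G ?h ?g \<lhd> arr_map G ?f) \<Zsemi> compositor G (?h \<cdot> ?g) ?f"
      using pseudofunctor.compositor_assoc[OF G h] .
    have n1: "compositor G ?h (?g \<cdot> ?f) \<Zsemi> cell_map G (?h \<rhd> compositor F g f) =
        (arr_map G ?h \<rhd> cell_map G (compositor F g f)) \<Zsemi> compositor G ?h (arr_map F (g \<cdot> f))"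
      using G_nat_l[of ?h "compositor F g f"] 9 by (simp add: FG hom1_iff)
    have n2: "compositor G (?h \<cdot> ?g) ?f \<Zsemi> cell_map G (compositor F h g \<lhd> ?f) =
        (cell_map G (compositor F h g) \<lhd> arr_map G ?f) \<Zsemi> compositor G (arr_map F (h \<cdot> g)) ?f"
      using G_nat_r[of ?f "compositor F h g"] 9 by (simp add: FG hom1_iff)
    have "(arr_map G ?h \<rhd> (compositor G ?g ?f \<Zsemi> cell_map G (compositor F g f))) \<Zsemi>
        compositor G ?h (arr_map F (g \<cdot> f)) \<Zsemi> cell_map G (compositor F h (g \<cdot> f)) =
      (arr_map G ?h \<rhd> compositor G ?g ?f) \<Zsemi> ((arr_map G ?h \<rhd> cell_map G (compositor F g f)) \<Zsemi>
        compositor G ?h (arr_map F (g \<cdot> f))) \<Zsemi> cell_map G (compositor F h (g \<cdot> f))"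
      using 9 by (simp add: FG hom1_iff lwhisk_vcomp)
    also have "\<dots> = ((arr_map G ?h \<rhd> compositor G ?g ?f) \<Zsemi> compositor G ?h (?g \<cdot> ?f)) \<Zsemi>
        cell_map G ((?h \<rhd> compositor F g f) \<Zsemi> compositor F h (g \<cdot> f))"
      unfolding n1[symmetric] using 9 by (simp add: FG hom1_iff G_vcomp)
    also have "\<dots> = (compositor G ?h ?g \<lhd> arr_map G ?f) \<Zsemi> (compositor G (?h \<cdot> ?g) ?f \<Zsemi>
        cell_map G (compositor F h g \<lhd> ?f)) \<Zsemi> cell_map G (compositor F (h \<cdot> g) f)"
      unfolding t t' using 9 by (simp add: FG hom1_iff G_vcomp)
    also have "\<dots> = ((compositor G ?h ?g \<Zsemi> cell_map G (compositor F h g)) \<lhd> arr_map G ?f) \<Zsemi>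
        compositor G (arr_map F (h \<cdot> g)) ?f \<Zsemi> cell_map G (compositor F (h \<cdot> g) f)"
      unfolding n2 using 9 by (simp add: FG hom1_iff rwhisk_vcomp)
    finally show ?case by (simp add: pf_comp_def)
  next
    case (10 f X Y)
    then have X: "X \<in> Ob C" using hom1_Ob by blast
    have t: "(arr_map F f \<rhd> unitor F X) \<Zsemi> compositor F f (Id1 C X) = Id2 C (arr_map F f)"
      using pseudofunctor.unitor_right[OF F 10] .
    have h: "arr_map F f \<in> hom1 C (ob_map F X) (ob_map F Y)" using 10 by (simp add: hom1_iff FG)
    let ?f = "arr_map F f"
    have t': "(arr_map G ?f \<rhd> unitor G (ob_map F X)) \<Zsemi> compositor G ?f (Id1 C (ob_map F X)) = Id2 C (arr_map G ?f)"
      using pseudofunctor.unitor_right[OF G h] .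
    have n: "compositor G ?f (Id1 C (ob_map F X)) \<Zsemi> cell_map G (?f \<rhd> unitor F X) =
        (arr_map G ?f \<rhd> cell_map G (unitor F X)) \<Zsemi> compositor G ?f (arr_map F (Id1 C X))"
      using G_nat_l[of ?f "unitor F X"] 10 X by (simp add: FG hom1_iff)
    have "(arr_map G ?f \<rhd> (unitor G (ob_map F X) \<Zsemi> cell_map G (unitor F X))) \<Zsemi>
        compositor G ?f (arr_map F (Id1 C X)) \<Zsemi> cell_map G (compositor F f (Id1 C X)) =
      (arr_map G ?f \<rhd> unitor G (ob_map F X)) \<Zsemi> ((arr_map G ?f \<rhd> cell_map G (unitor F X)) \<Zsemi>
        compositor G ?f (arr_map F (Id1 C X))) \<Zsemi> cell_map G (compositor F f (Id1 C X))"
      using 10 X by (simp add: FG hom1_iff lwhisk_vcomp)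
    also have "\<dots> = ((arr_map G ?f \<rhd> unitor G (ob_map F X)) \<Zsemi> compositor G ?f (Id1 C (ob_map F X))) \<Zsemi>
        cell_map G ((?f \<rhd> unitor F X) \<Zsemi> compositor F f (Id1 C X))"
      unfolding n[symmetric] using 10 X by (simp add: FG hom1_iff G_vcomp)
    also have "\<dots> = Id2 C (arr_map G ?f)"
      unfolding t t' using 10 by (simp add: FG hom1_iff pseudofunctor.cell_map_Id2[OF G])
    finally show ?case by (simp add: pf_comp_def)
  next
    case (11 f X Y)
    then have Y: "Y \<in> Ob C" using hom1_Ob by blast
    have t: "(unitor F Y \<lhd> arr_map F f) \<Zsemi> compositor F (Id1 C Y) f = Id2 C (arr_map F f)"
      using pseudofunctor.unitor_left[OF F 11] .
    have h: "arr_map F f \<in> hom1 C (ob_map F X) (ob_map F Y)" using 11 by (simp add: hom1_iff FG)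
    let ?f = "arr_map F f"
    have t': "(unitor G (ob_map F Y) \<lhd> arr_map G ?f) \<Zsemi> compositor G (Id1 C (ob_map F Y)) ?f = Id2 C (arr_map G ?f)"
      using pseudofunctor.unitor_left[OF G h] .
    have n: "compositor G (Id1 C (ob_map F Y)) ?f \<Zsemi> cell_map G (unitor F Y \<lhd> ?f) =
        (cell_map G (unitor F Y) \<lhd> arr_map G ?f) \<Zsemi> compositor G (arr_map F (Id1 C Y)) ?f"
      using G_nat_r[of ?f "unitor F Y"] 11 Y by (simp add: FG hom1_iff)
    have "((unitor G (ob_map F Y) \<Zsemi> cell_map G (unitor F Y)) \<lhd> arr_map G ?f) \<Zsemi>
        compositor G (arr_map F (Id1 C Y)) ?f \<Zsemi> cell_map G (compositor F (Id1 C Y) f) =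
      (unitor G (ob_map F Y) \<lhd> arr_map G ?f) \<Zsemi> ((cell_map G (unitor F Y) \<lhd> arr_map G ?f) \<Zsemi>
        compositor G (arr_map F (Id1 C Y)) ?f) \<Zsemi> cell_map G (compositor F (Id1 C Y) f)"
      using 11 Y by (simp add: FG hom1_iff rwhisk_vcomp)
    also have "\<dots> = ((unitor G (ob_map F Y) \<lhd> arr_map G ?f) \<Zsemi> compositor G (Id1 C (ob_map F Y)) ?f) \<Zsemi>
        cell_map G ((unitor F Y \<lhd> ?f) \<Zsemi> compositor F (Id1 C Y) f)"
      unfolding n[symmetric] using 11 Y by (simp add: FG hom1_iff G_vcomp)
    also have "\<dots> = Id2 C (arr_map G ?f)"
      unfolding t t' using 11 by (simp add: FG hom1_iff pseudofunctor.cell_map_Id2[OF G])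
    finally show ?case by (simp add: pf_comp_def)
  qed
qed

lemma fm_pf_id:
  assumes "good x"
  shows "fm (pf_id C) x = x"
proof -
  have c: "constraint (pf_id C) X p = Id2 C (composite X p)" if "is_path X p Y" for X p Y
    using that
  proof (induction p arbitrary: Y)
    case (Cons f p)
    then have w: "is_path X p (Src C f)" "f \<in> Arr C" by auto
    then show ?case using Cons.IH[OF w(1)] composite_arr[OF w(1)] by (simp add: pf_id_def)
  qed (auto simp: pf_id_def)
  show ?thesis
    by (rule fm_eqI[OF pf_id_pseudofunctor])
      (use c[OF good_is_path(1)] c[OF good_is_path(2)] assms good_simps in \<open>auto simp: pf_id_def\<close>)
qed

text \<open>The constraint of the composite along a word is the constraint of \<open>G\<close>
  followed by the image of that of \<open>F\<close>; naturality of the compositor of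
  \<open>G\<close> carries the induction. Hence conjugating in one go or in two steps gives the same
  cell.\<close>

lemma fm_pf_comp:
  assumes G: "pseudofunctor C G" and F: "pseudofunctor C F"
  shows "fm (pf_comp C G F) x = fm G (fm F x)"
proof (cases "good x")
  case True
  have c: "constraint (pf_comp C G F) X p = constraint G (ob_map F X) (map (arr_map F) p) \<Zsemi> cell_map G (constraint F X p)"
    if "is_path X p Y" for X p Y
    using that
  proof (induction p arbitrary: Y)
    case (Cons f p)
    then have w: "is_path X p (Src C f)" "f \<in> Arr C" by auto
    note c = constraint_cell[OF F w(1)] constraint_cell[OF G is_path_map[OF F w(1)]] composite_arr[OF w(1)]
      composite_arr[OF is_path_map[OF F w(1)]] composite_arr[OF is_path_map[OF G is_path_map[OF F w(1)]]] w
      pf_arr[OF F] pf_arr[OF G] pf_cell[OF G] pf_compositor[OF F] pf_compositor[OF G]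
    let ?f = "arr_map F f" and ?p = "composite (ob_map F X) (map (arr_map F) p)"
    have n: "compositor G ?f ?p \<Zsemi> cell_map G (?f \<rhd> constraint F X p) =
        (arr_map G ?f \<rhd> cell_map G (constraint F X p)) \<Zsemi> compositor G ?f (arr_map F (composite X p))"
      using pseudofunctor.compositor_natural[OF G, of ?p "ob_map F X" "Src C ?f" ?f "Trg C ?f"
          "constraint F X p" "arr_map F (composite X p)" "Id2 C ?f" ?f] c pseudofunctor.cell_map_Id2[OF G, of ?f]
      by (simp add: hom1_iff hom2_iff lwhisk_def)
    have v: "cell_map G ((?f \<rhd> constraint F X p) \<Zsemi> compositor F f (composite X p)) =
        cell_map G (?f \<rhd> constraint F X p) \<Zsemi> cell_map G (compositor F f (composite X p))"
      using pseudofunctor.cell_map_vcomp[OF G, of "?f \<rhd> constraint F X p" _ _ "compositor F f (composite X p)"] c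
      by (simp add: hom2_iff)
    have "constraint (pf_comp C G F) X (f # p) = (arr_map G ?f \<rhd> constraint G (ob_map F X) (map (arr_map F) p)) \<Zsemi>
        ((arr_map G ?f \<rhd> cell_map G (constraint F X p)) \<Zsemi> compositor G ?f (arr_map F (composite X p))) \<Zsemi>
        cell_map G (compositor F f (composite X p))"
      using c by (simp add: Cons.IH[OF w(1)] lwhisk_vcomp) (simp add: pf_comp_def lwhisk_vcomp)
    also have "\<dots> = constraint G (ob_map F X) (map (arr_map F) (f # p)) \<Zsemi> cell_map G (constraint F X (f # p))"
      unfolding n[symmetric] using c by (simp add: v)
    finally show ?case .
  qed (auto simp: pf_comp_def)
  have gF: "good (fm F x)" "good (fm G (fm F x))" using True F G by auto
  note s = fm_sel(1-4)[OF True, of F] fm_sel(1-4)[OF gF(1), of G]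
  note cc = good_cel[OF True] good_cel[OF gF(1)] good_cel[OF gF(2)] pf_cell[OF F] pf_cell[OF G]
    constraint_cell[OF F good_is_path(1)[OF True]] constraint_cell[OF F good_is_path(2)[OF True]]
    constraint_cell[OF G good_is_path(1)[OF gF(1)]] constraint_cell[OF G good_is_path(2)[OF gF(1)]]
    pf_arr[OF F] pf_arr[OF G] 
  let ?X = "psrc x"
  have v: "cell_map G (cel (fm F x)) \<Zsemi> cell_map G (constraint F ?X (cd x)) =
      cell_map G (constraint F ?X (dm x)) \<Zsemi> cell_map G (cell_map F (cel x))"
    using pseudofunctor.cell_map_vcomp[OF G, of "cel (fm F x)" _ _ "constraint F ?X (cd x)"]
      pseudofunctor.cell_map_vcomp[OF G, of "constraint F ?X (dm x)" _ _ "cell_map F (cel x)"] cc s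
      fm_constraint[OF F True] by (simp add: hom2_iff)
  have "cel (fm G (fm F x)) \<Zsemi> (constraint G (ob_map F ?X) (map (arr_map F) (cd x)) \<Zsemi> cell_map G (constraint F ?X (cd x)))
    = (cel (fm G (fm F x)) \<Zsemi> constraint G (psrc (fm F x)) (cd (fm F x))) \<Zsemi> cell_map G (constraint F ?X (cd x))"
    using cc s by simp
  also have "\<dots> = constraint G (psrc (fm F x)) (dm (fm F x)) \<Zsemi>
      (cell_map G (cel (fm F x)) \<Zsemi> cell_map G (constraint F ?X (cd x)))"
    unfolding fm_constraint[OF G gF(1)] using cc s by simp
  also have "\<dots> = (constraint G (ob_map F ?X) (map (arr_map F) (dm x)) \<Zsemi> cell_map G (constraint F ?X (dm x))) \<Zsemi>
      cell_map G (cell_map F (cel x))"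
    unfolding v using cc s by simp
  finally have e: "cel (fm G (fm F x)) \<Zsemi> constraint (pf_comp C G F) ?X (cd x) =
      constraint (pf_comp C G F) ?X (dm x) \<Zsemi> cell_map (pf_comp C G F) (cel x)"
    using c[OF good_is_path(1)[OF True]] c[OF good_is_path(2)[OF True]] by (simp add: pf_comp_def)
  show ?thesis
    by (rule fm_eqI[OF pf_comp_pseudofunctor[OF G F] True gF(2)]) (use e s in \<open>simp_all add: pf_comp_def\<close>)
qed simp

text \<open>The two recursions differ only at their end: \<open>compositors\<close> stops at one
  letter with an identity, \<open>constraint\<close> at the empty word with the unitor. The right
  unit law of \<open>F\<close> identifies them on a one-letter word.\<close>

lemma compositors_constraint:
  assumes F: "pseudofunctor C F"
  shows "r \<noteq> [] \<Longrightarrow> is_path X r Z \<Longrightarrow> comps1 C r = composite X r \<and> compositors C F r = constraint F X r"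
proof (induction r arbitrary: Z)
  case (Cons f r)
  then have w: "is_path X r (Src C f)" "f \<in> Arr C" by auto
  show ?case
  proof (cases r)
    case Nil
    then have "Src C f = X" using w by simp
    then show ?thesis
      using pseudofunctor.unitor_right[OF F, of f X "Trg C f"] w Nil by (simp add: hom1_iff)
  next
    case (Cons h r')
    then show ?thesis using Cons.IH[OF _ w(1)] by simp
  qed
qed simp

lemma map_cell_fm:
  assumes F: "pseudofunctor C F" and g: "good (Paste X p \<alpha> q Y)" and n: "p \<noteq> []" "q \<noteq> []"
  shows "map_cell C F p \<alpha> q = cel (fm F (Paste X p \<alpha> q Y))"
  using compositors_constraint[OF F n(1)] compositors_constraint[OF F n(2)] good_is_path[OF g]
  by (simp add: map_cell_def fm_sel[OF g])

text \<open>In (W1) and (W2) the codomain of a unit modification is the one-letter word of an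
  identity 1-cell, corrected by an inverse unitor. In the calculus of words it is the empty word,
  whose constraint is that unitor.\<close>

lemma map_cell_unit_fm:
  assumes F: "pseudofunctor C F" and g: "good (Paste X p \<alpha> [] X)" and n: "p \<noteq> []"
  shows "map_cell C F p \<alpha> [Id1 C X] \<Zsemi> inv2 C (unitor F X) = cel (fm F (Paste X p \<alpha> [] X))"
proof -
  have X: "X \<in> Ob C" using good_is_path(2)[OF g] by simp
  note c = constraint_cell[OF F good_is_path(1)[OF g, simplified]] iso2_cell[OF pseudofunctor.unitor_iso[OF F X]]
    pf_cell[OF F] good_cel[OF g] pf_arr[OF F, of "Id1 C X"] X
  show ?thesis
    using compositors_constraint[OF F n] good_is_path[OF g] c
    by (simp add: map_cell_def fm_sel[OF g])
qed

section \<open>Pseudonaturality along words of 1-cells\<close>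

definition nat_cell :: "('o, 'a, 'c) pfun \<Rightarrow> ('o, 'a, 'c) pfun \<Rightarrow> ('o, 'a, 'c) pnat \<Rightarrow> 'a \<Rightarrow> ('o, 'a, 'c) pasting" where
  "nat_cell F G \<alpha> f = Paste (ob_map F (Src C f)) [arr_map G f, pcomp \<alpha> (Src C f)] (pcell \<alpha> f)
     [pcomp \<alpha> (Trg C f), arr_map F f] (ob_map G (Trg C f))"

text \<open>The component of \<alpha> is carried through the word one letter at a time, starting
  with the rightmost letter.\<close>

primrec nat_path :: "('o, 'a, 'c) pfun \<Rightarrow> ('o, 'a, 'c) pfun \<Rightarrow> ('o, 'a, 'c) pnat \<Rightarrow> 'o \<Rightarrow> 'a list \<Rightarrow> ('o, 'a, 'c) pasting" where
  "nat_path F G \<alpha> X [] = idp (ob_map F X) [pcomp \<alpha> X] (ob_map G X)"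
| "nat_path F G \<alpha> X (f # p) = ([arr_map G f] |> nat_path F G \<alpha> X p <| []) ;; ([] |> nat_cell F G \<alpha> f <| map (arr_map F) p)"

lemma nat_cell_sel [simp]:
  "psrc (nat_cell F G \<alpha> f) = ob_map F (Src C f)" "ptrg (nat_cell F G \<alpha> f) = ob_map G (Trg C f)"
  "dm (nat_cell F G \<alpha> f) = [arr_map G f, pcomp \<alpha> (Src C f)]"
  "cd (nat_cell F G \<alpha> f) = [pcomp \<alpha> (Trg C f), arr_map F f]" "cel (nat_cell F G \<alpha> f) = pcell \<alpha> f"
  by (simp_all add: nat_cell_def)

lemma pcomp_arr:
  assumes "pseudonat C F G \<alpha>" "X \<in> Ob C"
  shows "pcomp \<alpha> X \<in> Arr C" "Src C (pcomp \<alpha> X) = ob_map F X" "Trg C (pcomp \<alpha> X) = ob_map G X"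
  using pseudonat.pcomp[OF assms] by (auto simp: hom1_iff)

lemma piso_nat_cell:
  assumes F: "pseudofunctor C F" and G: "pseudofunctor C G" and \<alpha>: "pseudonat C F G \<alpha>" and f: "f \<in> Arr C"
  shows "piso (nat_cell F G \<alpha> f)" "good (nat_cell F G \<alpha> f)"
proof -
  have i: "pcell \<alpha> f \<in> iso2 C (arr_map G f \<cdot> pcomp \<alpha> (Src C f)) (pcomp \<alpha> (Trg C f) \<cdot> arr_map F f)"
    using pseudonat.pcell[OF \<alpha>, of f "Src C f" "Trg C f"] f by (simp add: hom1_iff)
  have o: "Src C f \<in> Ob C" "Trg C f \<in> Ob C" using f Src_Ob Trg_Ob by auto
  note p = pcomp_arr[OF \<alpha>] pf_arr[OF F] pf_arr[OF G] o pseudofunctor.ob_map[OF F] pseudofunctor.ob_map[OF G]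
  show g: "good (nat_cell F G \<alpha> f)"
    using iso2D(1)[OF i] p f unfolding good_def nat_cell_def by simp
  then show "piso (nat_cell F G \<alpha> f)" using i p f by (simp add: piso_def)
qed

text \<open>The last conjunct says that the letterwise cell is the constraint of \<alpha> at the
  composite, up to the constraints of \<open>F\<close> and \<open>G\<close>. It follows by induction
  from the unit and composition laws \<open>pcell_Id1\<close> and \<open>pcell_comp\<close>.\<close>

lemma nat_path_props:
  assumes F: "pseudofunctor C F" and G: "pseudofunctor C G" and \<alpha>: "pseudonat C F G \<alpha>"
  shows "is_path X p Y \<Longrightarrow> good (nat_path F G \<alpha> X p) \<and> psrc (nat_path F G \<alpha> X p) = ob_map F X \<and>
    ptrg (nat_path F G \<alpha> X p) = ob_map G Y \<and> dm (nat_path F G \<alpha> X p) = map (arr_map G) p @ [pcomp \<alpha> X] \<and>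
    cd (nat_path F G \<alpha> X p) = pcomp \<alpha> Y # map (arr_map F) p \<and>
    (constraint G X p \<lhd> pcomp \<alpha> X) \<Zsemi> pcell \<alpha> (composite X p) = cel (nat_path F G \<alpha> X p) \<Zsemi> (pcomp \<alpha> Y \<rhd> constraint F X p)"
proof (induction p arbitrary: Y)
  case Nil
  then have X: "X \<in> Ob C" "X = Y" by auto
  note p = pcomp_arr[OF \<alpha> X(1)] pseudofunctor.ob_map[OF F X(1)] pseudofunctor.ob_map[OF G X(1)]
    pf_unitor[OF F X(1)]
  show ?case using p pseudonat.pcell_Id1[OF \<alpha> X(1)] X(2) by auto
next
  case (Cons f p)
  then have w: "is_path X p (Src C f)" and f: "f \<in> Arr C" "Trg C f = Y" by auto
  have o: "X \<in> Ob C" "Src C f \<in> Ob C" "Y \<in> Ob C" using f Src_Ob Trg_Ob is_path_Ob[OF w] by auto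
  note IH = Cons.IH[OF w]
  note wF = is_path_map[OF F w] and wG = is_path_map[OF G w]
  note g = piso_nat_cell(2)[OF F G \<alpha> f(1)]
  note a = pf_arr[OF F f(1)] pf_arr[OF G f(1)] pcomp_arr[OF \<alpha>] o pseudofunctor.ob_map[OF F] pseudofunctor.ob_map[OF G]
  have g1: "good ([arr_map G f] |> nat_path F G \<alpha> X p <| [])" using IH a by (simp add: good_wh)
  have g2: "good ([] |> nat_cell F G \<alpha> f <| map (arr_map F) p)"
    using g wF a f by (auto simp: good_wh_iff)
  have g3: "good (nat_path F G \<alpha> X (f # p))"
    using g1 g2 IH a f wF is_path_path_src by (auto simp: good_vc wh_sel)
  let ?P = "composite X p" and ?P' = "composite (ob_map F X) (map (arr_map F) p)" and ?P'' = "composite (ob_map G X) (map (arr_map G) p)"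
  let ?f = "arr_map F f" and ?g = "arr_map G f" and ?x = "pcomp \<alpha> X" and ?y = "pcomp \<alpha> (Src C f)" and ?z = "pcomp \<alpha> Y"
  have gc: "good (nat_path F G \<alpha> X p)" using IH by simp
  note c = composite_arr[OF w] composite_arr[OF wF] composite_arr[OF wG] constraint_cell[OF F w] constraint_cell[OF G w] pf_arr[OF F] pf_arr[OF G]
    pf_compositor(2-4)[OF F] pf_compositor(2-4)[OF G]
  have pc: "pcell \<alpha> f \<in> Cell C" "Dom C (pcell \<alpha> f) = ?g \<cdot> ?y" "Cod C (pcell \<alpha> f) = ?z \<cdot> ?f"
    using good_cel[OF g] a f by auto
  have pc2: "pcell \<alpha> ?P \<in> Cell C" "Dom C (pcell \<alpha> ?P) = arr_map G ?P \<cdot> ?x"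
    "Cod C (pcell \<alpha> ?P) = ?y \<cdot> arr_map F ?P"
    using good_cel[OF piso_nat_cell(2)[OF F G \<alpha>, of ?P]] c a by auto
  have pc3: "pcell \<alpha> (f \<cdot> ?P) \<in> Cell C" "Dom C (pcell \<alpha> (f \<cdot> ?P)) = arr_map G (f \<cdot> ?P) \<cdot> ?x"
    "Cod C (pcell \<alpha> (f \<cdot> ?P)) = ?z \<cdot> arr_map F (f \<cdot> ?P)"
    using good_cel[OF piso_nat_cell(2)[OF F G \<alpha>, of "f \<cdot> ?P"]] c a f by auto
  have pw: "cel (nat_path F G \<alpha> X p) \<in> Cell C" "Dom C (cel (nat_path F G \<alpha> X p)) = ?P'' \<cdot> ?x"
    "Cod C (cel (nat_path F G \<alpha> X p)) = ?y \<cdot> ?P'"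
    using good_cel[OF gc] IH composite_append[of "ob_map F X" "[?x]" "ob_map G X" "map (arr_map G) p"] wG a by auto
  have t: "(compositor G f ?P \<lhd> ?x) \<Zsemi> pcell \<alpha> (f \<cdot> ?P) =
      (?g \<rhd> pcell \<alpha> ?P) \<Zsemi> (pcell \<alpha> f \<lhd> arr_map F ?P) \<Zsemi> (?z \<rhd> compositor F f ?P)"
    using pseudonat.pcell_comp[OF \<alpha>, of ?P X "Src C f" f Y] c f by (simp add: hom1_iff)
  have x: "(?g \<cdot> ?y \<rhd> constraint F X p) \<Zsemi> (pcell \<alpha> f \<lhd> arr_map F ?P) = (pcell \<alpha> f \<lhd> ?P') \<Zsemi> (?z \<cdot> ?f \<rhd> constraint F X p)"
    using whisk_exchange[of "constraint F X p" "pcell \<alpha> f"] pc c a by simp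
  have "(constraint G X (f # p) \<lhd> ?x) \<Zsemi> pcell \<alpha> (f \<cdot> ?P) =
      (?g \<rhd> constraint G X p \<lhd> ?x) \<Zsemi> ((compositor G f ?P \<lhd> ?x) \<Zsemi> pcell \<alpha> (f \<cdot> ?P))"
    using c a f pc3 by (simp add: rwhisk_vcomp whisk_commute)
  also have "\<dots> = (?g \<rhd> ((constraint G X p \<lhd> ?x) \<Zsemi> pcell \<alpha> ?P)) \<Zsemi> (pcell \<alpha> f \<lhd> arr_map F ?P) \<Zsemi> (?z \<rhd> compositor F f ?P)"
    unfolding t using c a f pc pc2 by (simp add: lwhisk_vcomp)
  also have "(constraint G X p \<lhd> ?x) \<Zsemi> pcell \<alpha> ?P = cel (nat_path F G \<alpha> X p) \<Zsemi> (?y \<rhd> constraint F X p)"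
    using IH by simp
  also have "(?g \<rhd> (cel (nat_path F G \<alpha> X p) \<Zsemi> (?y \<rhd> constraint F X p))) \<Zsemi> (pcell \<alpha> f \<lhd> arr_map F ?P) \<Zsemi> (?z \<rhd> compositor F f ?P)
    = (?g \<rhd> cel (nat_path F G \<alpha> X p)) \<Zsemi> ((?g \<cdot> ?y \<rhd> constraint F X p) \<Zsemi> (pcell \<alpha> f \<lhd> arr_map F ?P)) \<Zsemi> (?z \<rhd> compositor F f ?P)"
    using c a f pc pw by (simp add: lwhisk_vcomp lwhisk_lwhisk)
  also have "\<dots> = ((?g \<rhd> cel (nat_path F G \<alpha> X p)) \<Zsemi> (pcell \<alpha> f \<lhd> ?P')) \<Zsemi> (?z \<rhd> constraint F X (f # p))"
    unfolding x using c a f pc pw by (simp add: lwhisk_vcomp lwhisk_lwhisk)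
  also have "(?g \<rhd> cel (nat_path F G \<alpha> X p)) \<Zsemi> (pcell \<alpha> f \<lhd> ?P') = cel (nat_path F G \<alpha> X (f # p))"
    using g1 g2 g3 IH a f pw pc c is_path_path_src[OF wF] by (simp add: vc_sel wh_sel)
  finally have e: "(constraint G X (f # p) \<lhd> ?x) \<Zsemi> pcell \<alpha> (composite X (f # p)) =
      cel (nat_path F G \<alpha> X (f # p)) \<Zsemi> (?z \<rhd> constraint F X (f # p))" by simp
  show ?case
    using e g1 g2 g3 IH a f is_path_path_src[OF wF] by (simp del: constraint.simps composite.simps add: vc_sel wh_sel)
qed

text \<open>Naturality of \<open>pcell\<close> at a 2-cell, conjugated by the constraints of
  \<open>F\<close> and \<open>G\<close>; a remaining constraint of \<open>F\<close> is invertible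
  and is cancelled. Taken at structure cells such as \<open>LuP X\<close> or \<open>O3 X\<close>, it
  supplies the squares that mix two of the given transformations or modifications.\<close>

lemma nat_path_natural:
  assumes F: "pseudofunctor C F" and G: "pseudofunctor C G" and \<alpha>: "pseudonat C F G \<alpha>" and g: "good x"
  shows "([] |> fm G x <| [pcomp \<alpha> (psrc x)]) ;; nat_path F G \<alpha> (psrc x) (cd x) =
    nat_path F G \<alpha> (psrc x) (dm x) ;; ([pcomp \<alpha> (ptrg x)] |> fm F x <| [])"
proof -
  let ?X = "psrc x" and ?Y = "ptrg x"
  note P = nat_path_props[OF F G \<alpha> good_is_path(1)[OF g]] and Q = nat_path_props[OF F G \<alpha> good_is_path(2)[OF g]]
  note a = pcomp_arr[OF \<alpha>] good_Ob[OF g] pseudofunctor.ob_map[OF F] pseudofunctor.ob_map[OF G]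
  have gF: "good (fm F x)" "good (fm G x)" using g F G by auto
  note s = fm_sel(1-4)[OF g]
  have g1: "good ([] |> fm G x <| [pcomp \<alpha> ?X])" "good ([pcomp \<alpha> ?Y] |> fm F x <| [])"
    using gF a s by (auto simp: good_wh)
  have gl: "good (([] |> fm G x <| [pcomp \<alpha> ?X]) ;; nat_path F G \<alpha> ?X (cd x))"
    and gr: "good (nat_path F G \<alpha> ?X (dm x) ;; ([pcomp \<alpha> ?Y] |> fm F x <| []))"
    using g1 P Q a s by (simp_all add: good_vc wh_sel)
  let ?p = "cel (nat_path F G \<alpha> ?X (dm x))" and ?q = "cel (nat_path F G \<alpha> ?X (cd x))"
  let ?x = "pcomp \<alpha> ?X" and ?y = "pcomp \<alpha> ?Y"
  let ?cp = "composite ?X (dm x)" and ?cq = "composite ?X (cd x)"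
  note w = good_is_path[OF g]
  note c = constraint_cell[OF F w(1)] constraint_cell[OF F w(2)] constraint_cell[OF G w(1)] constraint_cell[OF G w(2)]
    composite_arr[OF w(1)] composite_arr[OF w(2)] composite_arr[OF is_path_map[OF F w(1)]] composite_arr[OF is_path_map[OF F w(2)]]
    composite_arr[OF is_path_map[OF G w(1)]] composite_arr[OF is_path_map[OF G w(2)]]
    pf_arr[OF F] pf_arr[OF G] pf_cell[OF F] pf_cell[OF G] good_cel[OF g] good_cel[OF gF(1)] good_cel[OF gF(2)]
  have pw: "?p \<in> Cell C" "Dom C ?p = composite (ob_map G ?X) (map (arr_map G) (dm x)) \<cdot> ?x"
    "Cod C ?p = ?y \<cdot> composite (ob_map F ?X) (map (arr_map F) (dm x))"
    using good_cel[of "nat_path F G \<alpha> ?X (dm x)"] P a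
      composite_append[of "ob_map F ?X" "[?x]" "ob_map G ?X" "map (arr_map G) (dm x)"] is_path_map[OF G w(1)] by auto
  have qw: "?q \<in> Cell C" "Dom C ?q = composite (ob_map G ?X) (map (arr_map G) (cd x)) \<cdot> ?x"
    "Cod C ?q = ?y \<cdot> composite (ob_map F ?X) (map (arr_map F) (cd x))"
    using good_cel[of "nat_path F G \<alpha> ?X (cd x)"] Q a
      composite_append[of "ob_map F ?X" "[?x]" "ob_map G ?X" "map (arr_map G) (cd x)"] is_path_map[OF G w(2)] by auto
  have pc: "pcell \<alpha> f \<in> Cell C \<and> Dom C (pcell \<alpha> f) = arr_map G f \<cdot> ?x \<and> Cod C (pcell \<alpha> f) = ?y \<cdot> arr_map F f"
    if "f \<in> Arr C" "Src C f = ?X" "Trg C f = ?Y" for f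
    using good_cel[OF piso_nat_cell(2)[OF F G \<alpha>, of f]] that a pf_arr[OF F that(1)] pf_arr[OF G that(1)] by auto
  have n: "(cell_map G (cel x) \<lhd> ?x) \<Zsemi> pcell \<alpha> ?cq = pcell \<alpha> ?cp \<Zsemi> (?y \<rhd> cell_map F (cel x))"
    using pseudonat.pcell_natural[OF \<alpha>, of ?cp ?X ?Y "cel x" ?cq] c by (simp add: hom1_iff hom2_iff)
  have "((cel (fm G x) \<lhd> ?x) \<Zsemi> ?q) \<Zsemi> (?y \<rhd> constraint F ?X (cd x)) =
      (cel (fm G x) \<lhd> ?x) \<Zsemi> (?q \<Zsemi> (?y \<rhd> constraint F ?X (cd x)))"
    using c a s qw by simp
  also have "?q \<Zsemi> (?y \<rhd> constraint F ?X (cd x)) = (constraint G ?X (cd x) \<lhd> ?x) \<Zsemi> pcell \<alpha> ?cq" using Q by simp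
  also have "(cel (fm G x) \<lhd> ?x) \<Zsemi> \<dots> = ((cel (fm G x) \<Zsemi> constraint G ?X (cd x)) \<lhd> ?x) \<Zsemi> pcell \<alpha> ?cq"
    using c a s pc by (simp add: rwhisk_vcomp)
  also have "\<dots> = (constraint G ?X (dm x) \<lhd> ?x) \<Zsemi> ((cell_map G (cel x) \<lhd> ?x) \<Zsemi> pcell \<alpha> ?cq)"
    unfolding fm_constraint[OF G g] using c a s pc by (simp add: rwhisk_vcomp)
  also have "\<dots> = ((constraint G ?X (dm x) \<lhd> ?x) \<Zsemi> pcell \<alpha> ?cp) \<Zsemi> (?y \<rhd> cell_map F (cel x))"
    unfolding n using c a s pc by simp
  also have "(constraint G ?X (dm x) \<lhd> ?x) \<Zsemi> pcell \<alpha> ?cp = ?p \<Zsemi> (?y \<rhd> constraint F ?X (dm x))" using P by simp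
  also have "(?p \<Zsemi> (?y \<rhd> constraint F ?X (dm x))) \<Zsemi> (?y \<rhd> cell_map F (cel x)) =
    ?p \<Zsemi> (?y \<rhd> (cel (fm F x) \<Zsemi> constraint F ?X (cd x)))"
    unfolding fm_constraint[OF F g] using c a s pw by (simp add: lwhisk_vcomp)
  also have "\<dots> = (?p \<Zsemi> (?y \<rhd> cel (fm F x))) \<Zsemi> (?y \<rhd> constraint F ?X (cd x))"
    using c a s pw by (simp add: lwhisk_vcomp)
  finally have e: "((cel (fm G x) \<lhd> ?x) \<Zsemi> ?q) \<Zsemi> (?y \<rhd> constraint F ?X (cd x)) =
      (?p \<Zsemi> (?y \<rhd> cel (fm F x))) \<Zsemi> (?y \<rhd> constraint F ?X (cd x))" .
  have i: "(?y \<rhd> constraint F ?X (cd x)) \<in> iso2 C (?y \<cdot> composite (ob_map F ?X) (map (arr_map F) (cd x))) (?y \<cdot> arr_map F ?cq)"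
    using iso2_lwhisk(1)[OF constraint_iso[OF F w(2)], of ?y] c a by simp
  have "(cel (fm G x) \<lhd> ?x) \<Zsemi> ?q = ?p \<Zsemi> (?y \<rhd> cel (fm F x))"
    by (rule iso2_cancel_right[OF _ _ i e, of "composite (ob_map G ?X) (map (arr_map G) (dm x)) \<cdot> ?x"])
      (use c a s pw qw in \<open>simp_all add: hom2_iff\<close>)
  then show ?thesis
    by (intro pasting_eqI[OF gl gr])
      (use g1 gl gr P Q a s c in \<open>simp_all add: vc_sel wh_sel\<close>)
qed

lemma nat_path_single:
  assumes F: "pseudofunctor C F" and G: "pseudofunctor C G" and \<alpha>: "pseudonat C F G \<alpha>" and f: "f \<in> Arr C"
    and X: "X = Src C f"
  shows "nat_path F G \<alpha> X [f] = ([] |> nat_cell F G \<alpha> f <| [])"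
proof -
  have "is_path X [f] (Trg C f)" using f X Src_Ob by auto
  then have g: "good (nat_path F G \<alpha> X [f])" using nat_path_props[OF F G \<alpha>] by blast
  have "is_path (ob_map F X) [pcomp \<alpha> X] (ob_map G X)" "is_path (ob_map G X) [arr_map G f] (ob_map G (Trg C f))"
    "is_path (ob_map F X) [] (ob_map F X)"
    using f X Src_Ob pcomp_arr[OF \<alpha>] pf_arr[OF G] pseudofunctor.ob_map[OF F] pseudofunctor.ob_map[OF G] by auto
  from wh_idp[OF this] have "([arr_map G f] |> idp (ob_map F X) [pcomp \<alpha> X] (ob_map G X) <| []) =
    idp (ob_map F X) ([arr_map G f] @ [pcomp \<alpha> X] @ []) (ob_map G (Trg C f))" .
  then have e: "nat_path F G \<alpha> X [f] = idp (ob_map F X) [arr_map G f, pcomp \<alpha> X] (ob_map G (Trg C f)) ;;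
    ([] |> nat_cell F G \<alpha> f <| [])" by simp
  show ?thesis
    unfolding e by (rule idp_vc) (use g[unfolded e good_vc] in \<open>simp_all only: idp_sel\<close>)
qed

lemma pf_id_map: "map (arr_map (pf_id C)) p = p"
  by (simp add: pf_id_def)

lemma piso_nat_path:
  assumes F: "pseudofunctor C F" and G: "pseudofunctor C G" and \<alpha>: "pseudonat C F G \<alpha>"
  shows "is_path X p Y \<Longrightarrow> piso (nat_path F G \<alpha> X p)"
proof (induction p arbitrary: Y)
  case Nil
  then have "X \<in> Ob C" by auto
  then show ?case
    using pcomp_arr[OF \<alpha>] pseudofunctor.ob_map[OF F] pseudofunctor.ob_map[OF G] by (simp add: piso_def)
next
  case (Cons f p)
  have g: "good (nat_path F G \<alpha> X (f # p))"
    using nat_path_props[OF F G \<alpha> Cons.prems] by simp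
  have i: "piso (nat_path F G \<alpha> X p)" "piso (nat_cell F G \<alpha> f)"
    using Cons piso_nat_cell(1)[OF F G \<alpha>, of f] by auto
  from g have "good ([arr_map G f] |> nat_path F G \<alpha> X p <| [])"
    "good ([] |> nat_cell F G \<alpha> f <| map (arr_map F) p)"
    by (simp_all add: good_vc)
  from piso_vc[OF piso_wh(1)[OF i(1) this(1)] piso_wh(1)[OF i(2) this(2)]] g show ?case
    by simp
qed

end

subsection \<open>The data of a pseudodistributive law as pasting cells\<close>

text \<open>Only the data are assumed of \<open>D\<close>; each lemma lists the axioms from which it
  is derived.\<close>

locale pdl_setting = two_category C
  for C :: "('o, 'a, 'c) two_cat" (structure) +
  fixes MT MP :: "('o, 'a, 'c) pmonad" and D :: "('o, 'a, 'c) pdl"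
  assumes MT: "pseudomonad C MT" and MP: "pseudomonad C MP" and D: "pdl_data C MT MP D"
begin

abbreviation T where "T \<equiv> fnc MT"
abbreviation P where "P \<equiv> fnc MP"
abbreviation TO where "TO \<equiv> ob_map T"
abbreviation PO where "PO \<equiv> ob_map P"
abbreviation T1 where "T1 \<equiv> arr_map T"
abbreviation P1 where "P1 \<equiv> arr_map P"
abbreviation FT where "FT \<equiv> fm T"
abbreviation FP where "FP \<equiv> fm P"
abbreviation u where "u \<equiv> pcomp (un MT)"
abbreviation m where "m \<equiv> pcomp (mul MT)"
abbreviation \<eta> where "\<eta> \<equiv> pcomp (un MP)"
abbreviation \<mu> where "\<mu> \<equiv> pcomp (mul MP)"
abbreviation l where "l \<equiv> pcomp (lam D)"

lemma pf [simp]: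
  "pseudofunctor C T" "pseudofunctor C P" "pseudofunctor C (pf_id C)"
  "pseudofunctor C (pf_comp C T T)" "pseudofunctor C (pf_comp C P P)"
  "pseudofunctor C (pf_comp C T P)" "pseudofunctor C (pf_comp C P T)"
  using pseudomonad.pseudofunctor[OF MT] pseudomonad.pseudofunctor[OF MP]
    pf_comp_pseudofunctor pf_id_pseudofunctor by auto

lemma pn:
  "pseudonat C (pf_id C) T (un MT)" "pseudonat C (pf_comp C T T) T (mul MT)"
  "pseudonat C (pf_id C) P (un MP)" "pseudonat C (pf_comp C P P) P (mul MP)"
  "pseudonat C (pf_comp C T P) (pf_comp C P T) (lam D)"
  using pseudomonad.un_pseudonat[OF MT] pseudomonad.mul_pseudonat[OF MT]
    pseudomonad.un_pseudonat[OF MP] pseudomonad.mul_pseudonat[OF MP] D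
  by (auto simp: pdl_data_def Let_def)

lemma Ob_simps [simp]:
  "X \<in> Ob C \<Longrightarrow> TO X \<in> Ob C" "X \<in> Ob C \<Longrightarrow> PO X \<in> Ob C"
  using pseudofunctor.ob_map[OF pf(1)] pseudofunctor.ob_map[OF pf(2)] by auto

lemma Arr_simps [simp]:
  "f \<in> Arr C \<Longrightarrow> T1 f \<in> Arr C" "f \<in> Arr C \<Longrightarrow> Src C (T1 f) = TO (Src C f)"
  "f \<in> Arr C \<Longrightarrow> Trg C (T1 f) = TO (Trg C f)"
  "f \<in> Arr C \<Longrightarrow> P1 f \<in> Arr C" "f \<in> Arr C \<Longrightarrow> Src C (P1 f) = PO (Src C f)"
  "f \<in> Arr C \<Longrightarrow> Trg C (P1 f) = PO (Trg C f)"
  "f \<in> Arr C \<Longrightarrow> Src C f \<in> Ob C" "f \<in> Arr C \<Longrightarrow> Trg C f \<in> Ob C"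
  using pf_arr[OF pf(1)] pf_arr[OF pf(2)] Src_Ob Trg_Ob by auto

lemma pfs [simp]:
  "ob_map (pf_id C) X = X" "arr_map (pf_id C) f = f"
  "ob_map (pf_comp C F G) X = ob_map F (ob_map G X)" "arr_map (pf_comp C F G) f = arr_map F (arr_map G f)"
  by (simp_all add: pf_id_def pf_comp_def)

lemma comp_simps [simp]:
  assumes "X \<in> Ob C"
  shows "u X \<in> Arr C" "Src C (u X) = X" "Trg C (u X) = TO X"
    "m X \<in> Arr C" "Src C (m X) = TO (TO X)" "Trg C (m X) = TO X"
    "\<eta> X \<in> Arr C" "Src C (\<eta> X) = X" "Trg C (\<eta> X) = PO X"
    "\<mu> X \<in> Arr C" "Src C (\<mu> X) = PO (PO X)" "Trg C (\<mu> X) = PO X"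
    "l X \<in> Arr C" "Src C (l X) = TO (PO X)" "Trg C (l X) = PO (TO X)"
  using pcomp_arr[OF pn(1) assms] pcomp_arr[OF pn(2) assms] pcomp_arr[OF pn(3) assms]
    pcomp_arr[OF pn(4) assms] pcomp_arr[OF pn(5) assms] by auto

text \<open>
  \<open>Uc\<close>, \<open>Mc\<close>, \<open>Ec\<close>, \<open>Muc\<close>, \<open>Lc\<close> are the pseudonaturality constraints of \<open>u\<close>, \<open>m\<close>, \<open>\<eta>\<close>,
  \<open>\<mu>\<close>, \<open>\<lambda>\<close>; \<open>Lu\<close> and \<open>Ru\<close> stand for the left and right unit modifications, \<open>O1\<close> to \<open>O4\<close> for
  \<open>\<omega>\<^sub>1\<close> to \<open>\<omega>\<^sub>4\<close>.
\<close>

definition "Uc = nat_cell (pf_id C) T (un MT)"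
definition "Mc = nat_cell (pf_comp C T T) T (mul MT)"
definition "Ec = nat_cell (pf_id C) P (un MP)"
definition "Muc = nat_cell (pf_comp C P P) P (mul MP)"
definition "Lc = nat_cell (pf_comp C T P) (pf_comp C P T) (lam D)"
definition "LuP X = Paste (PO X) [\<mu> X, \<eta> (PO X)] (left_unit MP X) [] (PO X)"
definition "LuT X = Paste (TO X) [m X, u (TO X)] (left_unit MT X) [] (TO X)"
definition "RuP X = Paste (PO X) [\<mu> X, P1 (\<eta> X)] (right_unit MP X) [] (PO X)"
definition "RuT X = Paste (TO X) [m X, T1 (u X)] (right_unit MT X) [] (TO X)"
definition "O1 X = Paste (PO X) [P1 (u X)] (om1 D X) [l X, u (PO X)] (PO (TO X))"
definition "O2 X = Paste (TO X) [l X, T1 (\<eta> X)] (om2 D X) [\<eta> (TO X)] (PO (TO X))"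
definition "O3 X = Paste (TO (TO (PO X))) [P1 (m X), l (TO X), T1 (l X)] (om3 D X) [l X, m (PO X)] (PO (TO X))"
definition "O4 X = Paste (TO (PO (PO X))) [l X, T1 (\<mu> X)] (om4 D X) [\<mu> (TO X), P1 (l X), l (PO X)] (PO (TO X))"

lemmas atom_defs = Uc_def Mc_def Ec_def Muc_def Lc_def LuP_def LuT_def RuP_def RuT_def O1_def O2_def O3_def O4_def

lemma atom_sel [simp]:
  "dm (Uc f) = [T1 f, u (Src C f)]" "cd (Uc f) = [u (Trg C f), f]" "psrc (Uc f) = Src C f" "ptrg (Uc f) = TO (Trg C f)"
  "dm (Mc f) = [T1 f, m (Src C f)]" "cd (Mc f) = [m (Trg C f), T1 (T1 f)]" "psrc (Mc f) = TO (TO (Src C f))" "ptrg (Mc f) = TO (Trg C f)"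
  "dm (Ec f) = [P1 f, \<eta> (Src C f)]" "cd (Ec f) = [\<eta> (Trg C f), f]" "psrc (Ec f) = Src C f" "ptrg (Ec f) = PO (Trg C f)"
  "dm (Muc f) = [P1 f, \<mu> (Src C f)]" "cd (Muc f) = [\<mu> (Trg C f), P1 (P1 f)]" "psrc (Muc f) = PO (PO (Src C f))" "ptrg (Muc f) = PO (Trg C f)"
  "dm (Lc f) = [P1 (T1 f), l (Src C f)]" "cd (Lc f) = [l (Trg C f), T1 (P1 f)]" "psrc (Lc f) = TO (PO (Src C f))" "ptrg (Lc f) = PO (TO (Trg C f))"
  "dm (LuP X) = [\<mu> X, \<eta> (PO X)]" "cd (LuP X) = []" "psrc (LuP X) = PO X" "ptrg (LuP X) = PO X"
  "dm (LuT X) = [m X, u (TO X)]" "cd (LuT X) = []" "psrc (LuT X) = TO X" "ptrg (LuT X) = TO X"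
  "dm (RuP X) = [\<mu> X, P1 (\<eta> X)]" "cd (RuP X) = []" "psrc (RuP X) = PO X" "ptrg (RuP X) = PO X"
  "dm (RuT X) = [m X, T1 (u X)]" "cd (RuT X) = []" "psrc (RuT X) = TO X" "ptrg (RuT X) = TO X"
  "dm (O1 X) = [P1 (u X)]" "cd (O1 X) = [l X, u (PO X)]" "psrc (O1 X) = PO X" "ptrg (O1 X) = PO (TO X)"
  "dm (O2 X) = [l X, T1 (\<eta> X)]" "cd (O2 X) = [\<eta> (TO X)]" "psrc (O2 X) = TO X" "ptrg (O2 X) = PO (TO X)"
  "dm (O3 X) = [P1 (m X), l (TO X), T1 (l X)]" "cd (O3 X) = [l X, m (PO X)]" "psrc (O3 X) = TO (TO (PO X))" "ptrg (O3 X) = PO (TO X)"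
  "dm (O4 X) = [l X, T1 (\<mu> X)]" "cd (O4 X) = [\<mu> (TO X), P1 (l X), l (PO X)]" "psrc (O4 X) = TO (PO (PO X))" "ptrg (O4 X) = PO (TO X)"
  by (simp_all add: atom_defs)

lemma cel_atom:
  "cel (Uc f) = pcell (un MT) f" "cel (Mc f) = pcell (mul MT) f" "cel (Ec f) = pcell (un MP) f"
  "cel (Muc f) = pcell (mul MP) f" "cel (Lc f) = pcell (lam D) f"
  "cel (LuP X) = left_unit MP X" "cel (LuT X) = left_unit MT X" "cel (RuP X) = right_unit MP X"
  "cel (RuT X) = right_unit MT X" "cel (O1 X) = om1 D X" "cel (O2 X) = om2 D X" "cel (O3 X) = om3 D X" "cel (O4 X) = om4 D X"
  by (simp_all add: atom_defs)

lemma mods: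
  "inv_modification C T T (pn_comp C (mul MT) (pn_rwhisk (un MT) T)) (pn_id C T) (left_unit MT)"
  "inv_modification C T T (pn_comp C (mul MT) (pn_lwhisk C T (pf_id C) T (un MT))) (pn_id C T) (right_unit MT)"
  "inv_modification C P P (pn_comp C (mul MP) (pn_rwhisk (un MP) P)) (pn_id C P) (left_unit MP)"
  "inv_modification C P P (pn_comp C (mul MP) (pn_lwhisk C P (pf_id C) P (un MP))) (pn_id C P) (right_unit MP)"
  "inv_modification C P (pf_comp C P T) (pn_lwhisk C P (pf_id C) T (un MT))
     (pn_comp C (lam D) (pn_rwhisk (un MT) P)) (om1 D)"
  "inv_modification C T (pf_comp C P T) (pn_comp C (lam D) (pn_lwhisk C T (pf_id C) P (un MP)))
     (pn_rwhisk (un MP) T) (om2 D)"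
  "inv_modification C (pf_comp C (pf_comp C T T) P) (pf_comp C P T)
     (pn_comp C (pn_lwhisk C P (pf_comp C T T) T (mul MT)) (pn_comp C (pn_rwhisk (lam D) T)
       (pn_lwhisk C T (pf_comp C T P) (pf_comp C P T) (lam D))))
     (pn_comp C (lam D) (pn_rwhisk (mul MT) P)) (om3 D)"
  "inv_modification C (pf_comp C T (pf_comp C P P)) (pf_comp C P T)
     (pn_comp C (lam D) (pn_lwhisk C T (pf_comp C P P) P (mul MP)))
     (pn_comp C (pn_rwhisk (mul MP) T) (pn_comp C (pn_lwhisk C P (pf_comp C T P) (pf_comp C P T) (lam D))
       (pn_rwhisk (lam D) P))) (om4 D)"
  using pseudomonad.left_unit[OF MT] pseudomonad.right_unit[OF MT]
    pseudomonad.left_unit[OF MP] pseudomonad.right_unit[OF MP] D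
  by (auto simp: pdl_data_def Let_def)

lemmas pn_defs = pn_comp_def pn_lwhisk_def pn_rwhisk_def pn_id_def

lemma om_iso:
  assumes "X \<in> Ob C"
  shows
  "left_unit MT X \<in> iso2 C (m X \<cdot> u (TO X)) (Id1 C (TO X))"
  "right_unit MT X \<in> iso2 C (m X \<cdot> T1 (u X)) (Id1 C (TO X))"
  "left_unit MP X \<in> iso2 C (\<mu> X \<cdot> \<eta> (PO X)) (Id1 C (PO X))"
  "right_unit MP X \<in> iso2 C (\<mu> X \<cdot> P1 (\<eta> X)) (Id1 C (PO X))"
  "om1 D X \<in> iso2 C (P1 (u X)) (l X \<cdot> u (PO X))"
  "om2 D X \<in> iso2 C (l X \<cdot> T1 (\<eta> X)) (\<eta> (TO X))"
  "om3 D X \<in> iso2 C (P1 (m X) \<cdot> l (TO X) \<cdot> T1 (l X)) (l X \<cdot> m (PO X))"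
  "om4 D X \<in> iso2 C (l X \<cdot> T1 (\<mu> X)) (\<mu> (TO X) \<cdot> P1 (l X) \<cdot> l (PO X))"
  using mods[THEN inv_modification.component_iso, OF assms] by (auto simp: pn_defs)

lemma piso_atom [simp]:
  "f \<in> Arr C \<Longrightarrow> piso (Uc f)" "f \<in> Arr C \<Longrightarrow> piso (Mc f)" "f \<in> Arr C \<Longrightarrow> piso (Ec f)"
  "f \<in> Arr C \<Longrightarrow> piso (Muc f)" "f \<in> Arr C \<Longrightarrow> piso (Lc f)"
  "X \<in> Ob C \<Longrightarrow> piso (LuP X)" "X \<in> Ob C \<Longrightarrow> piso (LuT X)" "X \<in> Ob C \<Longrightarrow> piso (RuP X)" "X \<in> Ob C \<Longrightarrow> piso (RuT X)"
  "X \<in> Ob C \<Longrightarrow> piso (O1 X)" "X \<in> Ob C \<Longrightarrow> piso (O2 X)" "X \<in> Ob C \<Longrightarrow> piso (O3 X)" "X \<in> Ob C \<Longrightarrow> piso (O4 X)"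
proof -
  have a: "piso (Paste X p \<alpha> q Y)" if "is_path X p Y" "is_path X q Y" "\<alpha> \<in> iso2 C (composite X p) (composite X q)" for X p \<alpha> q Y
    using that iso2D(1)[OF that(3)] by (simp add: piso_def good_def)
  show "X \<in> Ob C \<Longrightarrow> piso (LuP X)" "X \<in> Ob C \<Longrightarrow> piso (LuT X)" "X \<in> Ob C \<Longrightarrow> piso (RuP X)" "X \<in> Ob C \<Longrightarrow> piso (RuT X)"
    "X \<in> Ob C \<Longrightarrow> piso (O1 X)" "X \<in> Ob C \<Longrightarrow> piso (O2 X)" "X \<in> Ob C \<Longrightarrow> piso (O3 X)" "X \<in> Ob C \<Longrightarrow> piso (O4 X)"
    unfolding atom_defs using om_iso by (auto intro!: a)
  show "f \<in> Arr C \<Longrightarrow> piso (Uc f)" "f \<in> Arr C \<Longrightarrow> piso (Mc f)" "f \<in> Arr C \<Longrightarrow> piso (Ec f)"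
    "f \<in> Arr C \<Longrightarrow> piso (Muc f)" "f \<in> Arr C \<Longrightarrow> piso (Lc f)"
    unfolding atom_defs using piso_nat_cell(1) pn by auto
qed

lemma good_atom [simp]:
  "f \<in> Arr C \<Longrightarrow> good (Uc f)" "f \<in> Arr C \<Longrightarrow> good (Mc f)" "f \<in> Arr C \<Longrightarrow> good (Ec f)"
  "f \<in> Arr C \<Longrightarrow> good (Muc f)" "f \<in> Arr C \<Longrightarrow> good (Lc f)"
  "X \<in> Ob C \<Longrightarrow> good (LuP X)" "X \<in> Ob C \<Longrightarrow> good (LuT X)" "X \<in> Ob C \<Longrightarrow> good (RuP X)" "X \<in> Ob C \<Longrightarrow> good (RuT X)"
  "X \<in> Ob C \<Longrightarrow> good (O1 X)" "X \<in> Ob C \<Longrightarrow> good (O2 X)" "X \<in> Ob C \<Longrightarrow> good (O3 X)" "X \<in> Ob C \<Longrightarrow> good (O4 X)"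
  using piso_atom piso_good by blast+

lemma fm_dm [simp]:
  assumes "good x"
  shows "psrc (FT x) = TO (psrc x)" "ptrg (FT x) = TO (ptrg x)" "dm (FT x) = map T1 (dm x)" "cd (FT x) = map T1 (cd x)"
    "psrc (FP x) = PO (psrc x)" "ptrg (FP x) = PO (ptrg x)" "dm (FP x) = map P1 (dm x)" "cd (FP x) = map P1 (cd x)"
  using assms by (simp_all add: fm_sel)

section \<open>Images of the structure cells under \<open>T\<close> and \<open>P\<close>\<close>

lemma map_cell_cel:
  "\<lbrakk>pseudofunctor C F; good x; dm x \<noteq> []; cd x \<noteq> []\<rbrakk> \<Longrightarrow> map_cell C F (dm x) (cel x) (cd x) = cel (fm F x)"
  using map_cell_fm[of F "psrc x" "dm x" "cel x" "cd x" "ptrg x"] by (cases x) auto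

lemma map_cell_arr:
  assumes "f \<in> Arr C"
  shows "map_cell C P [T1 f, u (Src C f)] (pcell (un MT) f) [u (Trg C f), f] = cel (FP (Uc f))"
    "map_cell C P [T1 f, m (Src C f)] (pcell (mul MT) f) [m (Trg C f), T1 (T1 f)] = cel (FP (Mc f))"
    "map_cell C T [T1 f, u (Src C f)] (pcell (un MT) f) [u (Trg C f), f] = cel (FT (Uc f))"
    "map_cell C T [P1 f, \<eta> (Src C f)] (pcell (un MP) f) [\<eta> (Trg C f), f] = cel (FT (Ec f))"
    "map_cell C T [P1 f, \<mu> (Src C f)] (pcell (mul MP) f) [\<mu> (Trg C f), P1 (P1 f)] = cel (FT (Muc f))"
    "map_cell C T [P1 (T1 f), l (Src C f)] (pcell (lam D) f) [l (Trg C f), T1 (P1 f)] = cel (FT (Lc f))"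
    "map_cell C P [P1 (T1 f), l (Src C f)] (pcell (lam D) f) [l (Trg C f), T1 (P1 f)] = cel (FP (Lc f))"
  using assms map_cell_cel[OF pf(2), of "Uc f"] map_cell_cel[OF pf(2), of "Mc f"] map_cell_cel[OF pf(1), of "Uc f"]
    map_cell_cel[OF pf(1), of "Ec f"] map_cell_cel[OF pf(1), of "Muc f"] map_cell_cel[OF pf(1), of "Lc f"]
    map_cell_cel[OF pf(2), of "Lc f"]
  by (simp_all add: cel_atom)

lemma map_cell_ob:
  assumes "X \<in> Ob C"
  shows "map_cell C T [P1 (u X)] (om1 D X) [l X, u (PO X)] = cel (FT (O1 X))"
    "map_cell C P [P1 (u X)] (om1 D X) [l X, u (PO X)] = cel (FP (O1 X))"
    "map_cell C T [l X, T1 (\<eta> X)] (om2 D X) [\<eta> (TO X)] = cel (FT (O2 X))"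
    "map_cell C P [P1 (m X), l (TO X), T1 (l X)] (om3 D X) [l X, m (PO X)] = cel (FP (O3 X))"
    "map_cell C T [l X, T1 (\<mu> X)] (om4 D X) [\<mu> (TO X), P1 (l X), l (PO X)] = cel (FT (O4 X))"
  using assms map_cell_cel[OF pf(1), of "O1 X"] map_cell_cel[OF pf(2), of "O1 X"] map_cell_cel[OF pf(1), of "O2 X"]
    map_cell_cel[OF pf(2), of "O3 X"] map_cell_cel[OF pf(1), of "O4 X"]
  by (simp_all add: cel_atom)

lemmas map_cell_atom = map_cell_arr map_cell_ob

lemma cel_types [simp]:
  assumes "good x"
  shows "cel x \<in> Cell C" "Dom C (cel x) = composite (psrc x) (dm x)" "Cod C (cel x) = composite (psrc x) (cd x)"
  using assms by (rule good_cel)+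

lemmas typed_intros = typed_vc typed_wh typed_good[of "Uc a" for a] typed_good[of "Mc a" for a] typed_good[of "Ec a" for a] typed_good[of "Muc a" for a] typed_good[of "Lc a" for a] typed_good[of "LuP a" for a] typed_good[of "LuT a" for a] typed_good[of "RuP a" for a] typed_good[of "RuT a" for a] typed_good[of "O1 a" for a] typed_good[of "O2 a" for a] typed_good[of "O3 a" for a] typed_good[of "O4 a" for a] typed_good[of "FT a" for a] typed_good[of "FP a" for a] typed_good[of "pinv a" for a] typed_good[of "idp a b c" for a b c]

section \<open>The modification squares as equations of pasting cells\<close>

lemmas nat_raw = mods[THEN inv_modification.axioms(1), THEN modification.natural]

lemmas whisk_norm = lwhisk_vcomp rwhisk_vcomp lwhisk_lwhisk rwhisk_rwhisk whisk_commute

lemma LuP_nat: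
  assumes f: "f \<in> Arr C"
  shows "([] |> Muc f <| [\<eta> (PO (Src C f))]) ;;
    ([\<mu> (Trg C f)] |> Ec (P1 f) <| []) ;;
    ([] |> LuP (Trg C f) <| [P1 f]) =
    ([P1 f] |> LuP (Src C f) <| [])"
proof -
  have h: "f \<in> hom1 C (Src C f) (Trg C f)" using f by (simp add: hom1_iff)
  \<comment> \<open>The modification law is unfolded and its \<open>map_cell\<close> terms are
    folded into images under \<open>fm\<close>. Then \<open>typed_eqI\<close> splits the equation of
    pastings into equal boundaries and an equation of 2-cells, which is this law up to the normal
    form of whiskers. The other squares are obtained in the same way.\<close>
  note r = nat_raw(3)[OF h, unfolded pn_defs, simplified pfs pnat.simps map_cell_atom f simp_thms, folded cel_atom]
  show ?thesis
    by (rule typed_eqI, (rule typed_intros | (simp add: f; fail))+)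
      (use r in \<open>simp add: f whisk_norm\<close>)
qed

lemma RuT_nat:
  assumes f: "f \<in> Arr C"
  shows "([] |> Mc f <| [T1 (u (Src C f))]) ;;
    ([m (Trg C f)] |> FT (Uc f) <| []) ;;
    ([] |> RuT (Trg C f) <| [T1 f]) =
    ([T1 f] |> RuT (Src C f) <| [])"
proof -
  have h: "f \<in> hom1 C (Src C f) (Trg C f)" using f by (simp add: hom1_iff)
  note r = nat_raw(2)[OF h, unfolded pn_defs, simplified pfs pnat.simps map_cell_atom f simp_thms, folded cel_atom]
  show ?thesis
    by (rule typed_eqI, (rule typed_intros | (simp add: f; fail))+)
      (use r in \<open>simp add: f whisk_norm\<close>)
qed

lemma O1_nat:
  assumes f: "f \<in> Arr C"
  shows "([] |> FP (Uc f) <| []) ;;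
    ([] |> O1 (Trg C f) <| [P1 f]) =
    ([P1 (T1 f)] |> O1 (Src C f) <| []) ;;
    ([] |> Lc f <| [u (PO (Src C f))]) ;;
    ([l (Trg C f)] |> Uc (P1 f) <| [])"
proof -
  have h: "f \<in> hom1 C (Src C f) (Trg C f)" using f by (simp add: hom1_iff)
  note r = nat_raw(5)[OF h, unfolded pn_defs, simplified pfs pnat.simps map_cell_atom f simp_thms, folded cel_atom]
  show ?thesis
    by (rule typed_eqI, (rule typed_intros | (simp add: f; fail))+)
      (use r in \<open>simp add: f whisk_norm\<close>)
qed

lemma O2_nat:
  assumes f: "f \<in> Arr C"
  shows "([] |> Lc f <| [T1 (\<eta> (Src C f))]) ;;
    ([l (Trg C f)] |> FT (Ec f) <| []) ;;
    ([] |> O2 (Trg C f) <| [T1 f]) =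
    ([P1 (T1 f)] |> O2 (Src C f) <| []) ;;
    ([] |> Ec (T1 f) <| [])"
proof -
  have h: "f \<in> hom1 C (Src C f) (Trg C f)" using f by (simp add: hom1_iff)
  note r = nat_raw(6)[OF h, unfolded pn_defs, simplified pfs pnat.simps map_cell_atom f simp_thms, folded cel_atom]
  show ?thesis
    by (rule typed_eqI, (rule typed_intros | (simp add: f; fail))+)
      (use r in \<open>simp add: f whisk_norm\<close>)
qed

lemma O3_nat:
  assumes f: "f \<in> Arr C"
  shows "([] |> FP (Mc f) <| [l (TO (Src C f)), T1 (l (Src C f))]) ;;
    ([P1 (m (Trg C f))] |> Lc (T1 f) <| [T1 (l (Src C f))]) ;;
    ([P1 (m (Trg C f)), l (TO (Trg C f))] |> FT (Lc f) <| []) ;;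
    ([] |> O3 (Trg C f) <| [T1 (T1 (P1 f))]) =
    ([P1 (T1 f)] |> O3 (Src C f) <| []) ;;
    ([] |> Lc f <| [m (PO (Src C f))]) ;;
    ([l (Trg C f)] |> Mc (P1 f) <| [])"
proof -
  have h: "f \<in> hom1 C (Src C f) (Trg C f)" using f by (simp add: hom1_iff)
  note r = nat_raw(7)[OF h, unfolded pn_defs, simplified pfs pnat.simps map_cell_atom f simp_thms, folded cel_atom]
  show ?thesis
    by (rule typed_eqI, (rule typed_intros | (simp add: f; fail))+)
      (use r in \<open>simp add: f whisk_norm\<close>)
qed

lemma O4_nat:
  assumes f: "f \<in> Arr C"
  shows "([] |> Lc f <| [T1 (\<mu> (Src C f))]) ;;
    ([l (Trg C f)] |> FT (Muc f) <| []) ;;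
    ([] |> O4 (Trg C f) <| [T1 (P1 (P1 f))]) =
    ([P1 (T1 f)] |> O4 (Src C f) <| []) ;;
    ([] |> Muc (T1 f) <| [P1 (l (Src C f)), l (PO (Src C f))]) ;;
    ([\<mu> (TO (Trg C f))] |> FP (Lc f) <| [l (PO (Src C f))]) ;;
    ([\<mu> (TO (Trg C f)), P1 (l (Trg C f))] |> Lc (P1 f) <| [])"
proof -
  have h: "f \<in> hom1 C (Src C f) (Trg C f)" using f by (simp add: hom1_iff)
  note r = nat_raw(8)[OF h, unfolded pn_defs, simplified pfs pnat.simps map_cell_atom f simp_thms, folded cel_atom]
  show ?thesis
    by (rule typed_eqI, (rule typed_intros | (simp add: f; fail))+)
      (use r in \<open>simp add: f whisk_norm\<close>)
qed

lemma unit_cell: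
  assumes X: "X \<in> Ob C"
  shows "map_cell C P [m X, T1 (u X)] (right_unit MT X) [Id1 C (TO X)] \<Zsemi> inv2 C (unitor P (TO X)) = cel (FP (RuT X))"
    "map_cell C T [\<mu> X, \<eta> (PO X)] (left_unit MP X) [Id1 C (PO X)] \<Zsemi> inv2 C (unitor T (PO X)) = cel (FT (LuP X))"
  using map_cell_unit_fm[OF pf(2) good_atom(9)[OF X, unfolded RuT_def]]
    map_cell_unit_fm[OF pf(1) good_atom(6)[OF X, unfolded LuP_def]]
  by (simp_all add: RuT_def LuP_def)

lemma piso_FT [simp]: "piso x \<Longrightarrow> piso (FT x)" "piso x \<Longrightarrow> piso (FP x)"
  using piso_fm(1) pf by auto

section \<open>The axioms (W1), (W2) and (W5) as equations of pasting cells\<close>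

lemmas W_fold = cel_atom[symmetric] cel_pinv[symmetric]

lemma W1_pasting:
  assumes W: "W1 C MT MP D" and X: "X \<in> Ob C"
  shows "([] |> pinv (FP (RuT X)) <| [l X]) ;;
    ([P1 (m X)] |> Lc (u X) <| []) ;;
    ([P1 (m X), l (TO X)] |> FT (O1 X) <| []) ;;
    ([] |> O3 X <| [T1 (u (PO X))]) ;;
    ([l X] |> RuT (PO X) <| []) =
    idp (TO (PO X)) [l X] (PO (TO X))"
proof -
  note r = W[unfolded W1_def Let_def, rule_format, OF X, simplified map_cell_atom unit_cell X simp_thms]
  show ?thesis
    by (rule typed_eqI, (rule typed_intros | (simp add: X; fail))+)
      (use r in \<open>simp add: X W_fold whisk_norm\<close>)
qed

lemma W2_pasting:
  assumes W: "W2 C MT MP D" and X: "X \<in> Ob C"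
  shows "([l X] |> pinv (FT (LuP X)) <| []) ;;
    ([] |> O4 X <| [T1 (\<eta> (PO X))]) ;;
    ([\<mu> (TO X), P1 (l X)] |> O2 (PO X) <| []) ;;
    ([\<mu> (TO X)] |> Ec (l X) <| []) ;;
    ([] |> LuP (TO X) <| [l X]) =
    idp (TO (PO X)) [l X] (PO (TO X))"
proof -
  note r = W[unfolded W2_def Let_def, rule_format, OF X, simplified map_cell_atom unit_cell X simp_thms]
  show ?thesis
    by (rule typed_eqI, (rule typed_intros | (simp add: X; fail))+)
      (use r in \<open>simp add: X W_fold whisk_norm\<close>)
qed

lemma W5_pasting:
  assumes W: "W5 C MT MP D" and X: "X \<in> Ob C"
  shows "([P1 (m X), l (TO X)] |> FT (O4 X) <| []) ;;
    ([P1 (m X)] |> O4 (TO X) <| [T1 (P1 (l X)), T1 (l (PO X))]) ;;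
    ([] |> Muc (m X) <| [P1 (l (TO X)), l (PO (TO X)), T1 (P1 (l X)), T1 (l (PO X))]) ;;
    ([\<mu> (TO X), P1 (P1 (m X)), P1 (l (TO X))] |> pinv (Lc (l X)) <| [T1 (l (PO X))]) ;;
    ([\<mu> (TO X)] |> FP (O3 X) <| [l (TO (PO X)), T1 (l (PO X))]) ;;
    ([\<mu> (TO X), P1 (l X)] |> O3 (PO X) <| []) =
    ([] |> O3 X <| [T1 (T1 (\<mu> X))]) ;;
    ([l X] |> pinv (Mc (\<mu> X)) <| []) ;;
    ([] |> O4 X <| [m (PO (PO X))])"
proof -
  note r = W[unfolded W5_def Let_def, rule_format, OF X, simplified map_cell_atom unit_cell X simp_thms]
  show ?thesis
    by (rule typed_eqI, (rule typed_intros | (simp add: X; fail))+)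
      (use r in \<open>simp add: X W_fold whisk_norm\<close>)
qed

declare nat_path.simps(2) [simp del]

text \<open>Unfolds only words with at least two letters. One-letter words are left to
  \<open>nat_path_single\<close>, which yields the bare constraint without an identity
  slice.\<close>

lemmas nat_path_Cons2 = nat_path.simps(2)[where p = "g # p" for g p]

lemma fm_pfs [simp]:
  "fm (pf_comp C T T) x = FT (FT x)" "fm (pf_comp C P P) x = FP (FP x)"
  "fm (pf_comp C T P) x = FT (FP x)" "fm (pf_comp C P T) x = FP (FT x)"
  "good x \<Longrightarrow> fm (pf_id C) x = x"
  using fm_pf_comp fm_pf_id pf by auto

lemmas Uc_single = nat_path_single[OF pf(3) pf(1) pn(1), folded Uc_def]
lemmas Mc_single = nat_path_single[OF pf(4) pf(1) pn(2), folded Mc_def]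
lemmas Ec_single = nat_path_single[OF pf(3) pf(2) pn(3), folded Ec_def]
lemmas Muc_single = nat_path_single[OF pf(5) pf(2) pn(4), folded Muc_def]
lemmas Lc_single = nat_path_single[OF pf(6) pf(7) pn(5), folded Lc_def]

lemmas nat_path_singles = Uc_single Mc_single Ec_single Muc_single Lc_single nat_path_Cons2 atom_defs(1-5)[symmetric]

lemmas Uc_natural = nat_path_natural[OF pf(3) pf(1) pn(1)]
lemmas Mc_natural = nat_path_natural[OF pf(4) pf(1) pn(2)]
lemmas Ec_natural = nat_path_natural[OF pf(3) pf(2) pn(3)]
lemmas Muc_natural = nat_path_natural[OF pf(5) pf(2) pn(4)]
lemmas Lc_natural = nat_path_natural[OF pf(6) pf(7) pn(5)]

lemma FT_vc_wh:
  "good (x ;; y) \<Longrightarrow> FT (x ;; y) = FT x ;; FT y" "good (x ;; y) \<Longrightarrow> FP (x ;; y) = FP x ;; FP y"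
  "good (a |> x <| b) \<Longrightarrow> FT (a |> x <| b) = (map T1 a |> FT x <| map T1 b)"
  "good (a |> x <| b) \<Longrightarrow> FP (a |> x <| b) = (map P1 a |> FP x <| map P1 b)"
  using fm_vc fm_wh pf by auto

subsection \<open>The axiom (W8)\<close>

text \<open>(W2) solved for the slices containing \<omega>\<open>\<^sub>4\<close> and
  \<omega>\<open>\<^sub>2\<close>: an \<omega>\<open>\<^sub>4\<close> that meets T\<eta>P can then
  be rewritten away inside a longer pasting.\<close>

lemma W2_unit:
  assumes W2: "W2 C MT MP D" and X: "X \<in> Ob C"
  shows "([] |> O4 X <| [T1 (\<eta> (PO X))]) ;; ([\<mu> (TO X), P1 (l X)] |> O2 (PO X) <| []) ;;
    ([\<mu> (TO X)] |> Ec (l X) <| []) ;; ([] |> LuP (TO X) <| [l X]) =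
    ([l X] |> FT (LuP X) <| [])"
  by (rule trans[OF shift_l_inv[OF W2_pasting[OF W2 X]] vc_idp])
    (simp_all add: X wh_sel good_wh)

text \<open>The form of (W2) for places where \<omega>\<open>\<^sub>2\<close> is not followed by the
  constraint of \<eta> and the left unit; these two slices are moved across as inverses.\<close>

lemma W2_unit_shifted:
  assumes W2: "W2 C MT MP D" and X: "X \<in> Ob C"
  shows "([] |> O4 X <| [T1 (\<eta> (PO X))]) ;; ([\<mu> (TO X), P1 (l X)] |> O2 (PO X) <| []) =
    ([l X] |> FT (LuP X) <| []) ;; ([] |> pinv (LuP (TO X)) <| [l X]) ;;
    ([\<mu> (TO X)] |> pinv (Ec (l X)) <| [])"
proof -
  note r = shift_r[OF W2_unit[OF W2 X, folded vc_assoc]]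
  note r2 = shift_r[OF r]
  show ?thesis
    by (rule r2[unfolded vc_assoc]) (simp_all only: piso_atom Ob_simps comp_simps X, (rule good_typed, (rule typed_intros | (simp add: X; fail))+)+)
qed

text \<open>The first slice of (W5) is T\<omega>\<open>\<^sub>4\<close>, so (W2) is needed under
  \<open>T\<close> as well.\<close>

lemma T_W2_unit_shifted:
  assumes W2: "W2 C MT MP D" and X: "X \<in> Ob C"
  shows "([] |> FT (O4 X) <| [T1 (T1 (\<eta> (PO X)))]) ;;
    ([T1 (\<mu> (TO X)), T1 (P1 (l X))] |> FT (O2 (PO X)) <| []) =
    ([T1 (l X)] |> FT (FT (LuP X)) <| []) ;; ([] |> pinv (FT (LuP (TO X))) <| [T1 (l X)]) ;;
    ([T1 (\<mu> (TO X))] |> pinv (FT (Ec (l X))) <| [])"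
proof -
  have g: "good (([l X] |> FT (LuP X) <| []) ;; ([] |> pinv (LuP (TO X)) <| [l X]) ;;
    ([\<mu> (TO X)] |> pinv (Ec (l X)) <| []))"
    by (rule good_typed, (rule typed_intros | (simp add: X; fail))+)
  have g': "good (([] |> O4 X <| [T1 (\<eta> (PO X))]) ;; ([\<mu> (TO X), P1 (l X)] |> O2 (PO X) <| []))"
    by (rule good_typed, (rule typed_intros | (simp add: X; fail))+)
  show ?thesis
    using arg_cong[OF W2_unit_shifted[OF W2 X], of FT] g g'
    by (simp add: FT_vc_wh good_vc piso_fm X)
qed

text \<open>Naturality of \<open>m\<close> at the left unit modification of \<open>P\<close>. Its
  domain word has two letters, hence two constraints of \<open>m\<close>; its codomain word is empty
  and contributes none.\<close>

lemma Mc_LuP: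
  assumes X: "X \<in> Ob C"
  shows "([] |> pinv (Mc (\<mu> X)) <| [T1 (T1 (\<eta> (PO X)))]) ;; ([T1 (\<mu> X)] |> pinv (Mc (\<eta> (PO X))) <| []) ;;
    ([] |> FT (LuP X) <| [m (PO X)]) =
    ([m (PO X)] |> FT (FT (LuP X)) <| [])"
proof -
  have r: "([] |> FT (LuP X) <| [m (PO X)]) =
    ([T1 (\<mu> X)] |> Mc (\<eta> (PO X)) <| []) ;; ([] |> Mc (\<mu> X) <| [T1 (T1 (\<eta> (PO X)))]) ;;
    ([m (PO X)] |> FT (FT (LuP X)) <| [])"
    using Mc_natural[of "LuP X"] X
    by (simp add: nat_path_singles wh_simps good_wh wh_sel)
  show ?thesis
    by (simp add: r, subst pinv_wh_cancel, simp add: X, (rule good_typed, (rule typed_intros | (simp add: X; fail))+), subst pinv_wh_cancel, simp add: X, (rule good_typed, (rule typed_intros | (simp add: X; fail))+))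
qed

text \<open>The modification square of \<omega>\<open>\<^sub>2\<close> at the 1-cell
  \<open>l X\<close>, solved for the inverse constraint of \<lambda> at \<lambda> that occurs in
  (W5).\<close>

lemma O2_l:
  assumes X: "X \<in> Ob C"
  shows "([] |> pinv (Lc (l X)) <| [T1 (\<eta> (TO (PO X)))]) ;; ([P1 (T1 (l X))] |> O2 (TO (PO X)) <| []) =
    ([l (PO (TO X))] |> FT (Ec (l X)) <| []) ;; ([] |> O2 (PO (TO X)) <| [T1 (l X)]) ;;
    ([] |> pinv (Ec (T1 (l X))) <| [])"
proof -
  have r: "([] |> Lc (l X) <| [T1 (\<eta> (TO (PO X)))]) ;; ([l (PO (TO X))] |> FT (Ec (l X)) <| []) ;;
    ([] |> O2 (PO (TO X)) <| [T1 (l X)]) =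
    ([P1 (T1 (l X))] |> O2 (TO (PO X)) <| []) ;; ([] |> Ec (T1 (l X)) <| [])"
    using O2_nat[of "l X"] X by simp
  have r': "([] |> Lc (l X) <| [T1 (\<eta> (TO (PO X)))]) ;; ([l (PO (TO X))] |> FT (Ec (l X)) <| []) ;;
    ([] |> O2 (PO (TO X)) <| [T1 (l X)]) ;; ([] |> pinv (Ec (T1 (l X))) <| []) =
    ([P1 (T1 (l X))] |> O2 (TO (PO X)) <| [])"
    by (rule shift_r[OF r[symmetric], symmetric, unfolded vc_assoc]) (simp_all add: X, (rule good_typed, (rule typed_intros | (simp add: X; fail))+)+)
  show ?thesis
    by (rule shift_l[OF r', symmetric]) (simp_all add: X, (rule good_typed, (rule typed_intros | (simp add: X; fail))+)+)
qed

text \<open>Naturality of \<eta> at the 2-cell \<omega>\<open>\<^sub>3\<close>: it trades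
  P\<omega>\<open>\<^sub>3\<close> for \<omega>\<open>\<^sub>3\<close> itself.\<close>

lemma Ec_O3:
  assumes X: "X \<in> Ob C"
  shows "([P1 (P1 (m X)), P1 (l (TO X))] |> pinv (Ec (T1 (l X))) <| []) ;;
    ([] |> FP (O3 X) <| [\<eta> (TO (TO (PO X)))]) ;; ([P1 (l X)] |> Ec (m (PO X)) <| []) ;;
    ([] |> Ec (l X) <| [m (PO X)]) =
    ([P1 (P1 (m X))] |> Ec (l (TO X)) <| [T1 (l X)]) ;;
    ([] |> Ec (P1 (m X)) <| [l (TO X), T1 (l X)]) ;; ([\<eta> (PO (TO X))] |> O3 X <| [])"
proof -
  have r: "([] |> FP (O3 X) <| [\<eta> (TO (TO (PO X)))]) ;; ([P1 (l X)] |> Ec (m (PO X)) <| []) ;;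
    ([] |> Ec (l X) <| [m (PO X)]) =
    ([P1 (P1 (m X)), P1 (l (TO X))] |> Ec (T1 (l X)) <| []) ;;
    ([P1 (P1 (m X))] |> Ec (l (TO X)) <| [T1 (l X)]) ;;
    ([] |> Ec (P1 (m X)) <| [l (TO X), T1 (l X)]) ;; ([\<eta> (PO (TO X))] |> O3 X <| [])"
    using Ec_natural[of "O3 X"] X by (simp add: nat_path_singles wh_simps)
  show ?thesis
    by (simp add: r, subst pinv_wh_cancel, simp add: X, (rule good_typed, (rule typed_intros | (simp add: X; fail))+))
qed

lemma Muc_LuP_m:
  assumes X: "X \<in> Ob C"
  shows "([] |> Muc (m X) <| [\<eta> (PO (TO (TO X)))]) ;; ([\<mu> (TO X)] |> Ec (P1 (m X)) <| []) ;;
    ([] |> LuP (TO X) <| [P1 (m X)]) =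
    ([P1 (m X)] |> LuP (TO (TO X)) <| [])"
  using LuP_nat[of "m X"] X by simp

lemma W8_whiskered_right:
  assumes W2: "W2 C MT MP D" and X: "X \<in> Ob C"
  shows "([P1 (m X), l (TO X)] |> FT (O4 X) <| [T1 (T1 (\<eta> (PO X)))]) ;;
    ([P1 (m X)] |> O4 (TO X) <| [T1 (P1 (l X)), T1 (l (PO X)), T1 (T1 (\<eta> (PO X)))]) ;;
    ([] |> Muc (m X) <| [P1 (l (TO X)), l (PO (TO X)), T1 (P1 (l X)), T1 (l (PO X)), T1 (T1 (\<eta> (PO X)))]) ;;
    ([\<mu> (TO X), P1 (P1 (m X)), P1 (l (TO X))] |> pinv (Lc (l X)) <| [T1 (l (PO X)), T1 (T1 (\<eta> (PO X)))]) ;;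
    ([\<mu> (TO X)] |> FP (O3 X) <| [l (TO (PO X)), T1 (l (PO X)), T1 (T1 (\<eta> (PO X)))]) ;;
    ([\<mu> (TO X), P1 (l X), P1 (m (PO X)), l (TO (PO X))] |> FT (O2 (PO X)) <| []) ;;
    ([\<mu> (TO X), P1 (l X), P1 (m (PO X))] |> O2 (TO (PO X)) <| []) ;;
    ([\<mu> (TO X), P1 (l X)] |> Ec (m (PO X)) <| []) ;; ([\<mu> (TO X)] |> Ec (l X) <| [m (PO X)]) ;;
    ([] |> LuP (TO X) <| [l X, m (PO X)]) =
    ([P1 (m X), l (TO X), T1 (l X)] |> FT (FT (LuP X)) <| []) ;; ([] |> O3 X <| [])" (is "?lhs = ?rhs")
proof -
  let ?s1 = "([P1 (m X), l (TO X)] |> FT (O4 X) <| [T1 (T1 (\<eta> (PO X)))])"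
  let ?s2 = "([\<mu> (TO X), P1 (l X), P1 (m (PO X))] |> O2 (TO (PO X)) <| [])"
  let ?s3 = "([\<mu> (TO X), P1 (l X)] |> Ec (m (PO X)) <| [])"
  let ?s4 = "([\<mu> (TO X)] |> Ec (l X) <| [m (PO X)])"
  let ?s5 = "([] |> LuP (TO X) <| [l X, m (PO X)])"
  let ?s6 = "([P1 (m X)] |> O4 (TO X) <| [T1 (P1 (l X)), T1 (\<eta> (TO (PO X)))])"
  let ?s7 = "([] |> Muc (m X) <| [P1 (l (TO X)), l (PO (TO X)), T1 (P1 (l X)), T1 (\<eta> (TO (PO X)))])"
  let ?s8 = "([\<mu> (TO X), P1 (P1 (m X)), P1 (l (TO X))] |> pinv (Lc (l X)) <| [T1 (\<eta> (TO (PO X)))])"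
  let ?s9 = "([\<mu> (TO X)] |> FP (O3 X) <| [l (TO (PO X)), T1 (\<eta> (TO (PO X)))])"
  let ?s10 = "([P1 (m X), l (TO X), T1 (l X)] |> FT (FT (LuP X)) <| [])"
  let ?s11 = "([P1 (m X), l (TO X)] |> pinv (FT (LuP (TO X))) <| [T1 (l X)])"
  let ?s12 = "([P1 (m X), l (TO X), T1 (\<mu> (TO X))] |> pinv (FT (Ec (l X))) <| [])"
  let ?s13 = "([\<mu> (TO X)] |> FP (O3 X) <| [\<eta> (TO (TO (PO X)))])"
  let ?s14 = "([\<mu> (TO X), P1 (P1 (m X)), P1 (l (TO X))] |> O2 (PO (TO X)) <| [T1 (l X)])"
  let ?s15 = "([\<mu> (TO X), P1 (P1 (m X)), P1 (l (TO X))] |> pinv (Ec (T1 (l X))) <| [])"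
  let ?s16 = "([P1 (m X)] |> O4 (TO X) <| [T1 (\<eta> (PO (TO X))), T1 (l X)])"
  let ?s17 = "([] |> Muc (m X) <| [P1 (l (TO X)), l (PO (TO X)), T1 (\<eta> (PO (TO X))), T1 (l X)])"
  let ?s18 = "([] |> Muc (m X) <| [P1 (l (TO X)), \<eta> (TO (PO (TO X))), T1 (l X)])"
  let ?s19 = "([P1 (m X)] |> pinv (LuP (TO (TO X))) <| [l (TO X), T1 (l X)])"
  let ?s20 = "([P1 (m X), \<mu> (TO (TO X))] |> pinv (Ec (l (TO X))) <| [T1 (l X)])"
  let ?s21 = "([] |> Muc (m X) <| [\<eta> (PO (TO (TO X))), l (TO X), T1 (l X)])"
  let ?s22 = "([\<mu> (TO X), P1 (P1 (m X))] |> pinv (Ec (l (TO X))) <| [T1 (l X)])"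
  let ?s23 = "([\<mu> (TO X)] |> Ec (P1 (m X)) <| [l (TO X), T1 (l X)])"
  let ?s24 = "([\<mu> (TO X), \<eta> (PO (TO X))] |> O3 X <| [])"
  \<comment> \<open>T\<omega>\<open>\<^sub>2\<close> commutes with everything between it and
    T\<omega>\<open>\<^sub>4\<close>, so (W2) becomes applicable under \<open>T\<close>.\<close>
  have "?lhs = ?s1 ;; ([P1 (m X), l (TO X), T1 (\<mu> (TO X)), T1 (P1 (l X))] |> FT (O2 (PO X)) <| []) ;; ?s6 ;; ?s7 ;;
    ?s8 ;; ?s9 ;; ?s2 ;; ?s3 ;; ?s4 ;; ?s5"
    by (simp add: slide slide_vc X del: wh_Nil)
  also have "\<dots> = ?s10 ;; ?s11 ;; ?s12 ;; ?s6 ;; ?s7 ;; ?s8 ;; ?s9 ;; ?s2 ;; ?s3 ;; ?s4 ;; ?s5"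
    by (simp only: whisk_cong_vc[OF T_W2_unit_shifted[OF W2 X], of "[P1 (m X), l (TO X)]" "[]", simplified wh_simps] vc_assoc)
  \<comment> \<open>The second \<omega>\<open>\<^sub>2\<close> is brought in front of
    P\<omega>\<open>\<^sub>3\<close>, next to the inverse constraint of \<lambda>, and carried
    across it by \<open>O2_l\<close>. The constraint of \<eta> that this produces cancels the
    inverse one left by (W2) under \<open>T\<close>.\<close>
  also have "\<dots> = ?s10 ;; ?s11 ;; ?s12 ;; ?s6 ;; ?s7 ;; ?s8 ;;
    ([\<mu> (TO X), P1 (P1 (m X)), P1 (l (TO X)), P1 (T1 (l X))] |> O2 (TO (PO X)) <| []) ;; ?s13 ;; ?s3 ;;
    ?s4 ;; ?s5"
    by (simp add: slide slide_vc X del: wh_Nil)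
  also have "\<dots> = ?s10 ;; ?s11 ;; ?s12 ;; ?s6 ;; ?s7 ;;
    ([\<mu> (TO X), P1 (P1 (m X)), P1 (l (TO X)), l (PO (TO X))] |> FT (Ec (l X)) <| []) ;; ?s14 ;; ?s15 ;;
    ?s13 ;; ?s3 ;; ?s4 ;; ?s5"
    by (simp only: whisk_cong_vc[OF O2_l[OF X], of "[\<mu> (TO X), P1 (P1 (m X)), P1 (l (TO X))]" "[]", simplified wh_simps] vc_assoc)
  also have "\<dots> = ?s10 ;; ?s11 ;; ?s12 ;; ([P1 (m X), l (TO X), T1 (\<mu> (TO X))] |> FT (Ec (l X)) <| []) ;; ?s16 ;;
    ?s17 ;; ?s14 ;; ?s15 ;; ?s13 ;; ?s3 ;; ?s4 ;; ?s5"
    by (simp add: slide slide_vc X del: wh_Nil)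
  also have "\<dots> = ?s10 ;; ?s11 ;; ?s16 ;; ?s17 ;; ?s14 ;; ?s15 ;; ?s13 ;; ?s3 ;; ?s4 ;; ?s5"
    by (subst pinv_wh_cancel, simp add: X, (rule good_typed, (rule typed_intros | (simp add: X; fail))+))
  \<comment> \<open>Now \<omega>\<open>\<^sub>2\<close> stands at the index PTX and can meet the
    \<omega>\<open>\<^sub>4\<close> at TX, so (W2) applies at TX.\<close>
  also have "\<dots> = ?s10 ;; ?s11 ;; ?s16 ;;
    ([P1 (m X), \<mu> (TO (TO X)), P1 (l (TO X))] |> O2 (PO (TO X)) <| [T1 (l X)]) ;; ?s18 ;; ?s15 ;;
    ?s13 ;; ?s3 ;; ?s4 ;; ?s5"
    by (simp add: slide slide_vc X del: wh_Nil)
  also have "\<dots> = ?s10 ;; ?s11 ;; ([P1 (m X), l (TO X)] |> FT (LuP (TO X)) <| [T1 (l X)]) ;; ?s19 ;; ?s20 ;; ?s18 ;;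
    ?s15 ;; ?s13 ;; ?s3 ;; ?s4 ;; ?s5"
    by (simp only: whisk_cong_vc[OF W2_unit_shifted[OF W2 Ob_simps(1)[OF X]], of "[P1 (m X)]" "[T1 (l X)]", simplified wh_simps] vc_assoc)
  also have "\<dots> = ?s10 ;; ?s19 ;; ?s20 ;; ?s18 ;; ?s15 ;; ?s13 ;; ?s3 ;; ?s4 ;; ?s5"
    by (subst pinv_wh_cancel, simp add: X, (rule good_typed, (rule typed_intros | (simp add: X; fail))+))
  \<comment> \<open>What remains is P\<omega>\<open>\<^sub>3\<close> between constraints of \<eta>;
    \<open>Ec_O3\<close> replaces it by \<omega>\<open>\<^sub>3\<close>, and naturality of the left
    unit at \<open>m X\<close> removes \<mu> and \<eta>.\<close>
  also have "\<dots> = ?s10 ;; ?s19 ;; ?s21 ;; ?s22 ;; ?s15 ;; ?s13 ;; ?s3 ;; ?s4 ;; ?s5"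
    by (simp add: slide slide_vc X del: wh_Nil)
  also have "\<dots> = ?s10 ;; ?s19 ;; ?s21 ;; ?s22 ;; ([\<mu> (TO X), P1 (P1 (m X))] |> Ec (l (TO X)) <| [T1 (l X)]) ;; ?s23 ;;
    ?s24 ;; ?s5"
    by (simp only: whisk_cong_vc[OF Ec_O3[OF X], of "[\<mu> (TO X)]" "[]", simplified wh_simps] vc_assoc)
  also have "\<dots> = ?s10 ;; ?s19 ;; ?s21 ;; ?s23 ;; ?s24 ;; ?s5"
    by (subst pinv_wh_cancel, simp add: X, (rule good_typed, (rule typed_intros | (simp add: X; fail))+))
  also have "\<dots> = ?s10 ;; ?s19 ;; ?s21 ;; ?s23 ;; ([] |> LuP (TO X) <| [P1 (m X), l (TO X), T1 (l X)]) ;;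
    ([] |> O3 X <| [])"
    by (simp add: slide slide_vc X del: wh_Nil)
  also have "\<dots> = ?s10 ;; ?s19 ;; ([P1 (m X)] |> LuP (TO (TO X)) <| [l (TO X), T1 (l X)]) ;; ([] |> O3 X <| [])"
    by (simp only: whisk_cong_vc[OF Muc_LuP_m[OF X], of "[]" "[l (TO X), T1 (l X)]", simplified wh_simps] vc_assoc)
  also have "\<dots> = ?rhs"
    by (subst pinv_wh_cancel, simp add: X, (rule good_typed, (rule typed_intros | (simp add: X; fail))+))
  finally show ?thesis .
qed

text \<open>The left side of (W8) at PX starts with the \<omega>\<open>\<^sub>3\<close> that
  completes the left side of (W5). After (W5), the single \<omega>\<open>\<^sub>4\<close> meets
  \<omega>\<open>\<^sub>2\<close> and disappears by (W2), and naturality of \<open>m\<close> at the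
  left unit absorbs both constraints of \<open>m\<close>.\<close>

lemma W8_whiskered_left:
  assumes W2: "W2 C MT MP D" and W5: "W5 C MT MP D" and X: "X \<in> Ob C"
  shows "([P1 (m X), l (TO X)] |> FT (O4 X) <| [T1 (T1 (\<eta> (PO X)))]) ;;
    ([P1 (m X)] |> O4 (TO X) <| [T1 (P1 (l X)), T1 (l (PO X)), T1 (T1 (\<eta> (PO X)))]) ;;
    ([] |> Muc (m X) <| [P1 (l (TO X)), l (PO (TO X)), T1 (P1 (l X)), T1 (l (PO X)), T1 (T1 (\<eta> (PO X)))]) ;;
    ([\<mu> (TO X), P1 (P1 (m X)), P1 (l (TO X))] |> pinv (Lc (l X)) <| [T1 (l (PO X)), T1 (T1 (\<eta> (PO X)))]) ;;
    ([\<mu> (TO X)] |> FP (O3 X) <| [l (TO (PO X)), T1 (l (PO X)), T1 (T1 (\<eta> (PO X)))]) ;;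
    ([\<mu> (TO X), P1 (l X)] |> O3 (PO X) <| [T1 (T1 (\<eta> (PO X)))]) ;;
    ([\<mu> (TO X), P1 (l X), l (PO X)] |> pinv (Mc (\<eta> (PO X))) <| []) ;;
    ([\<mu> (TO X), P1 (l X)] |> O2 (PO X) <| [m (PO X)]) ;; ([\<mu> (TO X)] |> Ec (l X) <| [m (PO X)]) ;;
    ([] |> LuP (TO X) <| [l X, m (PO X)]) =
    ([P1 (m X), l (TO X), T1 (l X)] |> FT (FT (LuP X)) <| []) ;; ([] |> O3 X <| [])" (is "?lhs = ?rhs")
proof -
  let ?s1 = "([\<mu> (TO X), P1 (l X), l (PO X)] |> pinv (Mc (\<eta> (PO X))) <| [])"
  let ?s2 = "([\<mu> (TO X), P1 (l X)] |> O2 (PO X) <| [m (PO X)])"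
  let ?s3 = "([\<mu> (TO X)] |> Ec (l X) <| [m (PO X)])"
  let ?s4 = "([] |> LuP (TO X) <| [l X, m (PO X)])"
  let ?s5 = "([] |> O3 X <| [T1 (T1 (\<mu> X)), T1 (T1 (\<eta> (PO X)))])"
  let ?s6 = "([l X] |> pinv (Mc (\<mu> X)) <| [T1 (T1 (\<eta> (PO X)))])"
  let ?s7 = "([l X, T1 (\<mu> X)] |> pinv (Mc (\<eta> (PO X))) <| [])"
  have "?lhs = ?s5 ;; ?s6 ;; ([] |> O4 X <| [m (PO (PO X)), T1 (T1 (\<eta> (PO X)))]) ;; ?s1 ;; ?s2 ;; ?s3 ;; ?s4"
    by (simp only: whisk_cong_vc[OF W5_pasting[OF W5 X], of "[]" "[T1 (T1 (\<eta> (PO X)))]", simplified wh_simps] vc_assoc)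
  also have "\<dots> = ?s5 ;; ?s6 ;; ?s7 ;; ([] |> O4 X <| [T1 (\<eta> (PO X)), m (PO X)]) ;; ?s2 ;; ?s3 ;; ?s4"
    by (simp add: slide slide_vc X del: wh_Nil)
  also have "\<dots> = ?s5 ;; ?s6 ;; ?s7 ;; ([l X] |> FT (LuP X) <| [m (PO X)])"
    by (simp only: whisk_cong[OF W2_unit[OF W2 X], of "[]" "[m (PO X)]", simplified wh_simps] vc_assoc)
  also have "\<dots> = ?s5 ;; ([l X, m (PO X)] |> FT (FT (LuP X)) <| [])"
    by (simp only: whisk_cong[OF Mc_LuP[OF X], of "[l X]" "[]", simplified wh_simps] vc_assoc)
  also have "\<dots> = ?rhs"
    by (simp add: slide slide_vc X del: wh_Nil)
  finally show ?thesis .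
qed

text \<open>Both composites above end in the same cell. Their common slices, five in front and two
  behind, are invertible and are cancelled.\<close>

lemma W8_whiskered:
  assumes W2: "W2 C MT MP D" and W5: "W5 C MT MP D" and X: "X \<in> Ob C"
  shows "([\<mu> (TO X), P1 (l X)] |> O3 (PO X) <| [T1 (T1 (\<eta> (PO X)))]) ;;
    ([\<mu> (TO X), P1 (l X), l (PO X)] |> pinv (Mc (\<eta> (PO X))) <| []) ;;
    ([\<mu> (TO X), P1 (l X)] |> O2 (PO X) <| [m (PO X)]) =
    ([\<mu> (TO X), P1 (l X), P1 (m (PO X)), l (TO (PO X))] |> FT (O2 (PO X)) <| []) ;;
    ([\<mu> (TO X), P1 (l X), P1 (m (PO X))] |> O2 (TO (PO X)) <| []) ;;
    ([\<mu> (TO X), P1 (l X)] |> Ec (m (PO X)) <| [])" (is "?lhs = ?rhs")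
proof -
  note r = trans[OF W8_whiskered_left[OF W2 W5 X] W8_whiskered_right[OF W2 X, symmetric]]
  have r': "(?lhs ;; ([\<mu> (TO X)] |> Ec (l X) <| [m (PO X)])) ;; ([] |> LuP (TO X) <| [l X, m (PO X)]) =
      (?rhs ;; ([\<mu> (TO X)] |> Ec (l X) <| [m (PO X)])) ;; ([] |> LuP (TO X) <| [l X, m (PO X)])"
    unfolding vc_assoc
    by (rule slice_cancel_l[OF slice_cancel_l[OF slice_cancel_l[OF slice_cancel_l[OF slice_cancel_l[OF r]]]]])
      (simp_all add: X, (rule good_typed, (rule typed_intros | (simp add: X; fail))+)+)
  show ?thesis
    by (rule slice_cancel_r[OF slice_cancel_r[OF r']]) (simp_all add: X, (rule good_typed, (rule typed_intros | (simp add: X; fail))+)+)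
qed

section \<open>Passage of (W8) from PX to X\<close>

lemma Mc_Ec:
  assumes X: "X \<in> Ob C"
  shows "([] |> Mc (P1 (\<eta> X)) <| [T1 (T1 (\<eta> X))]) ;; ([m (PO (PO X))] |> FT (FT (Ec (\<eta> X))) <| []) ;;
    ([] |> pinv (Mc (\<eta> (PO X))) <| [T1 (T1 (\<eta> X))]) =
    ([T1 (P1 (\<eta> X))] |> pinv (Mc (\<eta> X)) <| []) ;; ([] |> FT (Ec (\<eta> X)) <| [m X]) ;;
    ([T1 (\<eta> (PO X))] |> Mc (\<eta> X) <| [])"
proof -
  \<comment> \<open>Naturality of \<open>m\<close> at the constraint of \<eta> at its own component,
    a 2-cell from P\<eta> \<cdot> \<eta> to \<eta>P \<cdot> \<eta>. This cell arises because X is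
    compared with PX along \<eta> itself.\<close>
  have r: "(([T1 (P1 (\<eta> X))] |> Mc (\<eta> X) <| []) ;; ([] |> Mc (P1 (\<eta> X)) <| [T1 (T1 (\<eta> X))])) ;; ([m (PO (PO X))] |> FT (FT (Ec (\<eta> X))) <| []) =
      (([] |> FT (Ec (\<eta> X)) <| [m X]) ;; ([T1 (\<eta> (PO X))] |> Mc (\<eta> X) <| [])) ;; ([] |> Mc (\<eta> (PO X)) <| [T1 (T1 (\<eta> X))])"
    using Mc_natural[of "Ec (\<eta> X)"] X by (simp add: nat_path_singles wh_simps)
  have r': "([T1 (P1 (\<eta> X))] |> Mc (\<eta> X) <| []) ;; ([] |> Mc (P1 (\<eta> X)) <| [T1 (T1 (\<eta> X))]) ;;
    ([m (PO (PO X))] |> FT (FT (Ec (\<eta> X))) <| []) ;; ([] |> pinv (Mc (\<eta> (PO X))) <| [T1 (T1 (\<eta> X))]) =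
    ([] |> FT (Ec (\<eta> X)) <| [m X]) ;; ([T1 (\<eta> (PO X))] |> Mc (\<eta> X) <| [])"
    by (rule shift_r[OF r[symmetric], symmetric, unfolded vc_assoc]) (simp_all add: X, (rule good_typed, (rule typed_intros | (simp add: X; fail))+)+)
  show ?thesis
    by (rule shift_l[OF r']) (simp_all add: X, (rule good_typed, (rule typed_intros | (simp add: X; fail))+)+)
qed

text \<open>The left side of (W8) is a composite of modifications, hence natural at
  \<open>\<eta> X\<close>. The four slices in front and the two at the end are shared with
  \<open>W8_right_natural\<close>, so that they drop out when the two are compared.\<close>

lemma W8_left_natural:
  assumes X: "X \<in> Ob C"
  shows "([] |> FP (Mc (\<eta> X)) <| [l (TO X), T1 (l X), T1 (T1 (\<eta> X))]) ;;
    ([P1 (m (PO X))] |> Lc (T1 (\<eta> X)) <| [T1 (l X), T1 (T1 (\<eta> X))]) ;;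
    ([P1 (m (PO X)), l (TO (PO X))] |> FT (Lc (\<eta> X)) <| [T1 (T1 (\<eta> X))]) ;;
    ([P1 (m (PO X)), l (TO (PO X)), T1 (l (PO X))] |> FT (FT (Ec (\<eta> X))) <| []) ;;
    ([] |> O3 (PO X) <| [T1 (T1 (\<eta> (PO X))), T1 (T1 (\<eta> X))]) ;;
    ([l (PO X)] |> pinv (Mc (\<eta> (PO X))) <| [T1 (T1 (\<eta> X))]) ;;
    ([] |> O2 (PO X) <| [m (PO X), T1 (T1 (\<eta> X))]) =
    ([P1 (T1 (\<eta> X))] |> O3 X <| [T1 (T1 (\<eta> X))]) ;; ([P1 (T1 (\<eta> X)), l X] |> pinv (Mc (\<eta> X)) <| []) ;;
    ([P1 (T1 (\<eta> X))] |> O2 X <| [m X]) ;; ([] |> Ec (T1 (\<eta> X)) <| [m X]) ;;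
    ([\<eta> (TO (PO X))] |> Mc (\<eta> X) <| [])" (is "?lhs = ?rhs")
proof -
  have n3: "([] |> FP (Mc (\<eta> X)) <| [l (TO X), T1 (l X)]) ;;
    ([P1 (m (PO X))] |> Lc (T1 (\<eta> X)) <| [T1 (l X)]) ;;
    ([P1 (m (PO X)), l (TO (PO X))] |> FT (Lc (\<eta> X)) <| []) ;;
    ([] |> O3 (PO X) <| [T1 (T1 (P1 (\<eta> X)))]) =
    ([P1 (T1 (\<eta> X))] |> O3 X <| []) ;; ([] |> Lc (\<eta> X) <| [m (PO X)]) ;;
    ([l (PO X)] |> Mc (P1 (\<eta> X)) <| [])"
    using O3_nat[of "\<eta> X"] X by simp
  have n2: "([] |> Lc (\<eta> X) <| [T1 (\<eta> X)]) ;; ([l (PO X)] |> FT (Ec (\<eta> X)) <| []) ;;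
    ([] |> O2 (PO X) <| [T1 (\<eta> X)]) =
    ([P1 (T1 (\<eta> X))] |> O2 X <| []) ;; ([] |> Ec (T1 (\<eta> X)) <| [])"
    using O2_nat[of "\<eta> X"] X by simp
  let ?s1 = "([] |> FP (Mc (\<eta> X)) <| [l (TO X), T1 (l X), T1 (T1 (\<eta> X))])"
  let ?s2 = "([P1 (m (PO X))] |> Lc (T1 (\<eta> X)) <| [T1 (l X), T1 (T1 (\<eta> X))])"
  let ?s3 = "([P1 (m (PO X)), l (TO (PO X))] |> FT (Lc (\<eta> X)) <| [T1 (T1 (\<eta> X))])"
  let ?s4 = "([l (PO X)] |> pinv (Mc (\<eta> (PO X))) <| [T1 (T1 (\<eta> X))])"
  let ?s5 = "([] |> O2 (PO X) <| [m (PO X), T1 (T1 (\<eta> X))])"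
  let ?s6 = "([l (PO X), m (PO (PO X))] |> FT (FT (Ec (\<eta> X))) <| [])"
  let ?s7 = "([P1 (T1 (\<eta> X))] |> O3 X <| [T1 (T1 (\<eta> X))])"
  let ?s8 = "([] |> Lc (\<eta> X) <| [m (PO X), T1 (T1 (\<eta> X))])"
  let ?s9 = "([l (PO X)] |> FT (Ec (\<eta> X)) <| [m X])"
  have "?lhs = ?s1 ;; ?s2 ;; ?s3 ;; ([] |> O3 (PO X) <| [T1 (T1 (P1 (\<eta> X))), T1 (T1 (\<eta> X))]) ;; ?s6 ;; ?s4 ;; ?s5"
    by (simp add: slide slide_vc X del: wh_Nil)
  also have "\<dots> = ?s7 ;; ?s8 ;; ([l (PO X)] |> Mc (P1 (\<eta> X)) <| [T1 (T1 (\<eta> X))]) ;; ?s6 ;; ?s4 ;; ?s5"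
    by (simp only: whisk_cong_vc[OF n3, of "[]" "[T1 (T1 (\<eta> X))]", simplified wh_simps] vc_assoc)
  also have "\<dots> = ?s7 ;; ?s8 ;; ([l (PO X), T1 (P1 (\<eta> X))] |> pinv (Mc (\<eta> X)) <| []) ;; ?s9 ;;
    ([l (PO X), T1 (\<eta> (PO X))] |> Mc (\<eta> X) <| []) ;; ?s5"
    by (simp only: whisk_cong_vc[OF Mc_Ec[OF X], of "[l (PO X)]" "[]", simplified wh_simps] vc_assoc)
  also have "\<dots> = ?s7 ;; ([P1 (T1 (\<eta> X)), l X] |> pinv (Mc (\<eta> X)) <| []) ;; ([] |> Lc (\<eta> X) <| [T1 (\<eta> X), m X]) ;;
    ?s9 ;; ([] |> O2 (PO X) <| [T1 (\<eta> X), m X]) ;; ([\<eta> (TO (PO X))] |> Mc (\<eta> X) <| [])"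
    by (simp add: slide slide_vc X del: wh_Nil)
  also have "\<dots> = ?rhs"
    by (simp only: whisk_cong_vc[OF n2, of "[]" "[m X]", simplified wh_simps] vc_assoc)
  finally show ?thesis .
qed

text \<open>The right side of (W8) contains \<omega>\<open>\<^sub>2\<close> under \<open>T\<close>,
  at TX and a constraint of \<eta>. Accordingly the square of \<omega>\<open>\<^sub>2\<close> is
  used under \<open>T\<close> and at the 1-cell \<open>T1 (\<eta> X)\<close>, and naturality of
  \<eta> at the constraint of \<open>m\<close>.\<close>

lemma W8_right_natural:
  assumes X: "X \<in> Ob C"
  shows "([] |> FP (Mc (\<eta> X)) <| [l (TO X), T1 (l X), T1 (T1 (\<eta> X))]) ;;
    ([P1 (m (PO X))] |> Lc (T1 (\<eta> X)) <| [T1 (l X), T1 (T1 (\<eta> X))]) ;;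
    ([P1 (m (PO X)), l (TO (PO X))] |> FT (Lc (\<eta> X)) <| [T1 (T1 (\<eta> X))]) ;;
    ([P1 (m (PO X)), l (TO (PO X)), T1 (l (PO X))] |> FT (FT (Ec (\<eta> X))) <| []) ;;
    ([P1 (m (PO X)), l (TO (PO X))] |> FT (O2 (PO X)) <| [T1 (T1 (\<eta> X))]) ;;
    ([P1 (m (PO X))] |> O2 (TO (PO X)) <| [T1 (T1 (\<eta> X))]) ;;
    ([] |> Ec (m (PO X)) <| [T1 (T1 (\<eta> X))]) =
    ([P1 (T1 (\<eta> X)), P1 (m X), l (TO X)] |> FT (O2 X) <| []) ;;
    ([P1 (T1 (\<eta> X)), P1 (m X)] |> O2 (TO X) <| []) ;; ([P1 (T1 (\<eta> X))] |> Ec (m X) <| []) ;;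
    ([] |> Ec (T1 (\<eta> X)) <| [m X]) ;; ([\<eta> (TO (PO X))] |> Mc (\<eta> X) <| [])" (is "?lhs = ?rhs")
proof -
  have n2: "([] |> Lc (\<eta> X) <| [T1 (\<eta> X)]) ;; ([l (PO X)] |> FT (Ec (\<eta> X)) <| []) ;;
    ([] |> O2 (PO X) <| [T1 (\<eta> X)]) =
    ([P1 (T1 (\<eta> X))] |> O2 X <| []) ;; ([] |> Ec (T1 (\<eta> X)) <| [])"
    using O2_nat[of "\<eta> X"] X by simp
  have g: "good (([] |> Lc (\<eta> X) <| [T1 (\<eta> X)]) ;; ([l (PO X)] |> FT (Ec (\<eta> X)) <| []) ;;
    ([] |> O2 (PO X) <| [T1 (\<eta> X)]))" "good (([P1 (T1 (\<eta> X))] |> O2 X <| []) ;; ([] |> Ec (T1 (\<eta> X)) <| []))"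
    by (rule good_typed, (rule typed_intros | (simp add: X; fail))+)+
  have Tn2: "([] |> FT (Lc (\<eta> X)) <| [T1 (T1 (\<eta> X))]) ;; ([T1 (l (PO X))] |> FT (FT (Ec (\<eta> X))) <| []) ;;
    ([] |> FT (O2 (PO X)) <| [T1 (T1 (\<eta> X))]) =
    ([T1 (P1 (T1 (\<eta> X)))] |> FT (O2 X) <| []) ;; ([] |> FT (Ec (T1 (\<eta> X))) <| [])"
    using arg_cong[OF n2, of FT] g by (simp add: FT_vc_wh good_vc X)
  have nT: "([] |> Lc (T1 (\<eta> X)) <| [T1 (\<eta> (TO X))]) ;; ([l (TO (PO X))] |> FT (Ec (T1 (\<eta> X))) <| []) ;;
    ([] |> O2 (TO (PO X)) <| [T1 (T1 (\<eta> X))]) =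
    ([P1 (T1 (T1 (\<eta> X)))] |> O2 (TO X) <| []) ;; ([] |> Ec (T1 (T1 (\<eta> X))) <| [])"
    using O2_nat[of "T1 (\<eta> X)"] X by simp
  have nE: "([] |> FP (Mc (\<eta> X)) <| [\<eta> (TO (TO X))]) ;; ([P1 (m (PO X))] |> Ec (T1 (T1 (\<eta> X))) <| []) ;;
    ([] |> Ec (m (PO X)) <| [T1 (T1 (\<eta> X))]) =
    ([P1 (T1 (\<eta> X))] |> Ec (m X) <| []) ;; ([] |> Ec (T1 (\<eta> X)) <| [m X]) ;;
    ([\<eta> (TO (PO X))] |> Mc (\<eta> X) <| [])"
    using Ec_natural[of "Mc (\<eta> X)"] X by (simp add: nat_path_singles wh_simps)
  let ?s1 = "([] |> FP (Mc (\<eta> X)) <| [l (TO X), T1 (l X), T1 (T1 (\<eta> X))])"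
  let ?s2 = "([P1 (m (PO X))] |> Lc (T1 (\<eta> X)) <| [T1 (l X), T1 (T1 (\<eta> X))])"
  let ?s3 = "([P1 (m (PO X))] |> O2 (TO (PO X)) <| [T1 (T1 (\<eta> X))])"
  let ?s4 = "([] |> Ec (m (PO X)) <| [T1 (T1 (\<eta> X))])"
  let ?s5 = "([P1 (m (PO X)), l (TO (PO X))] |> FT (Ec (T1 (\<eta> X))) <| [])"
  let ?s6 = "([P1 (T1 (\<eta> X)), P1 (m X), l (TO X)] |> FT (O2 X) <| [])"
  let ?s7 = "([] |> FP (Mc (\<eta> X)) <| [l (TO X), T1 (\<eta> (TO X))])"
  let ?s8 = "([P1 (m (PO X))] |> Ec (T1 (T1 (\<eta> X))) <| [])"
  have "?lhs = ?s1 ;; ?s2 ;; ([P1 (m (PO X)), l (TO (PO X)), T1 (P1 (T1 (\<eta> X)))] |> FT (O2 X) <| []) ;; ?s5 ;;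
    ?s3 ;; ?s4"
    by (simp only: whisk_cong_vc[OF Tn2, of "[P1 (m (PO X)), l (TO (PO X))]" "[]", simplified wh_simps] vc_assoc)
  also have "\<dots> = ?s6 ;; ?s7 ;; ([P1 (m (PO X))] |> Lc (T1 (\<eta> X)) <| [T1 (\<eta> (TO X))]) ;; ?s5 ;; ?s3 ;; ?s4"
    by (simp add: slide slide_vc X del: wh_Nil)
  also have "\<dots> = ?s6 ;; ?s7 ;; ([P1 (m (PO X)), P1 (T1 (T1 (\<eta> X)))] |> O2 (TO X) <| []) ;; ?s8 ;; ?s4"
    by (simp only: whisk_cong_vc[OF nT, of "[P1 (m (PO X))]" "[]", simplified wh_simps] vc_assoc)
  also have "\<dots> = ?s6 ;; ([P1 (T1 (\<eta> X)), P1 (m X)] |> O2 (TO X) <| []) ;;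
    ([] |> FP (Mc (\<eta> X)) <| [\<eta> (TO (TO X))]) ;; ?s8 ;; ?s4"
    by (simp add: slide slide_vc X del: wh_Nil)
  also have "\<dots> = ?rhs"
    by (simp only: whisk_cong[OF nE, of "[]" "[]", simplified wh_simps] vc_assoc)
  finally show ?thesis .
qed

text \<open>The whisker is isomorphic to an identity: P\<omega>\<open>\<^sub>2\<close> leads to
  \<mu>T \<cdot> P\<eta>T, and the right unit of \<open>P\<close> to the empty word. The equation is
  transported along these two invertible cells.\<close>

lemma whisker_unit_cancel:
  assumes X: "X \<in> Ob C" and g: "good x" "good y" and s: "psrc x = psrc y" "ptrg x = PO (TO X)" "ptrg y = PO (TO X)"
    "dm x = dm y" "cd x = cd y"
    and e: "([\<mu> (TO X), P1 (l X), P1 (T1 (\<eta> X))] |> x <| []) = ([\<mu> (TO X), P1 (l X), P1 (T1 (\<eta> X))] |> y <| [])"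
  shows "x = y"
proof -
  have w: "is_path (psrc x) (dm x) (PO (TO X))" "psrc x \<in> Ob C" using good_is_path(1)[OF g(1)] good_Ob[OF g(1)] s by auto
  note t = is_path_path_trg[OF w(1)] is_path_path_src[OF w(1)]
  have e1: "([\<mu> (TO X), P1 (\<eta> (TO X))] |> x <| []) = ([\<mu> (TO X), P1 (\<eta> (TO X))] |> y <| [])"
    using whisker_transport[of "FP (O2 X)" "[\<mu> (TO X)]" x y] X g s e w t
    by (simp add: good_vc good_wh wh_sel)
  have "([] |> x <| []) = ([] |> y <| [])"
    using whisker_transport[of "RuP (TO X)" "[]" x y] X g s e1 w t
    by (simp add: good_vc good_wh wh_sel del: wh_Nil)
  then show ?thesis using g by simp
qed

lemma W8_from_W5:
  assumes W2: "W2 C MT MP D" and W5: "W5 C MT MP D" and X: "X \<in> Ob C"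
  shows "([] |> O3 X <| [T1 (T1 (\<eta> X))]) ;; ([l X] |> pinv (Mc (\<eta> X)) <| []) ;; ([] |> O2 X <| [m X]) =
    ([P1 (m X), l (TO X)] |> FT (O2 X) <| []) ;; ([P1 (m X)] |> O2 (TO X) <| []) ;;
    ([] |> Ec (m X) <| [])" (is "?lhs = ?rhs")
proof -
  let ?A = "([\<mu> (TO X), P1 (l X), P1 (T1 (\<eta> X))] |> O3 X <| [T1 (T1 (\<eta> X))]) ;;
    ([\<mu> (TO X), P1 (l X), P1 (T1 (\<eta> X)), l X] |> pinv (Mc (\<eta> X)) <| []) ;;
    ([\<mu> (TO X), P1 (l X), P1 (T1 (\<eta> X))] |> O2 X <| [m X])"
  let ?B = "([\<mu> (TO X), P1 (l X), P1 (T1 (\<eta> X)), P1 (m X), l (TO X)] |> FT (O2 X) <| []) ;;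
    ([\<mu> (TO X), P1 (l X), P1 (T1 (\<eta> X)), P1 (m X)] |> O2 (TO X) <| []) ;;
    ([\<mu> (TO X), P1 (l X), P1 (T1 (\<eta> X))] |> Ec (m X) <| [])"
  \<comment> \<open>Behind the common prefix of the two naturality lemmas, the sides of (W8) at PX
    agree by \<open>W8_whiskered\<close>. The naturality lemmas turn them into \<open>?A\<close> and
    \<open>?B\<close>, each followed by the same two invertible slices.\<close>
  have r: "(?A ;; ([\<mu> (TO X), P1 (l X)] |> Ec (T1 (\<eta> X)) <| [m X])) ;; ([\<mu> (TO X), P1 (l X), \<eta> (TO (PO X))] |> Mc (\<eta> X) <| []) =
      (?B ;; ([\<mu> (TO X), P1 (l X)] |> Ec (T1 (\<eta> X)) <| [m X])) ;; ([\<mu> (TO X), P1 (l X), \<eta> (TO (PO X))] |> Mc (\<eta> X) <| [])"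
    using whisk_cong[OF W8_left_natural[OF X], of "[\<mu> (TO X), P1 (l X)]" "[]"] whisk_cong[OF W8_right_natural[OF X], of "[\<mu> (TO X), P1 (l X)]" "[]"]
      whisk_cong[OF W8_whiskered[OF W2 W5 X], of "[]" "[T1 (T1 (\<eta> X))]"]
    by (simp add: wh_simps)
  have "?A = ?B"
    by (rule slice_cancel_r[OF slice_cancel_r[OF r]]) (simp_all add: X, (rule good_typed, (rule typed_intros | (simp add: X; fail))+)+)
  then have "([\<mu> (TO X), P1 (l X), P1 (T1 (\<eta> X))] |> ?lhs <| []) = ([\<mu> (TO X), P1 (l X), P1 (T1 (\<eta> X))] |> ?rhs <| [])"
    by (simp add: wh_simps del: wh_Nil)
  moreover have "good ?lhs \<and> psrc ?lhs = TO (TO X) \<and> dm ?lhs = [P1 (m X), l (TO X), T1 (l X), T1 (T1 (\<eta> X))] \<and> cd ?lhs = [\<eta> (TO X), m X] \<and> ptrg ?lhs = PO (TO X)"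
    by (rule typed_sel, (rule typed_intros | (simp add: X; fail))+)
  moreover have "good ?rhs \<and> psrc ?rhs = TO (TO X) \<and> dm ?rhs = [P1 (m X), l (TO X), T1 (l X), T1 (T1 (\<eta> X))] \<and> cd ?rhs = [\<eta> (TO X), m X] \<and> ptrg ?rhs = PO (TO X)"
    by (rule typed_sel, (rule typed_intros | (simp add: X; fail))+)
  ultimately show ?thesis
    using whisker_unit_cancel[OF X] by (auto simp del: wh_Nil)
qed

lemma W8_of_pasting:
  assumes W: "\<And>X. X \<in> Ob C \<Longrightarrow> ([] |> O3 X <| [T1 (T1 (\<eta> X))]) ;; ([l X] |> pinv (Mc (\<eta> X)) <| []) ;; ([] |> O2 X <| [m X]) =
    ([P1 (m X), l (TO X)] |> FT (O2 X) <| []) ;; ([P1 (m X)] |> O2 (TO X) <| []) ;;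
    ([] |> Ec (m X) <| [])"
  shows "W8 C MT MP D"
  unfolding W8_def Let_def
proof (intro ballI, goal_cases)
  case X: (1 X)
  show ?case
    by (rule typed_cel_eq[OF W[OF X]], (rule typed_intros | (simp add: X; fail))+)
      (simp add: X, simp add: X map_cell_atom cel_atom cel_pinv)+
qed

subsection \<open>The axiom (W9)\<close>

text \<open>(W1) solved for the slices with \<omega>\<open>\<^sub>1\<close> and
  \<omega>\<open>\<^sub>3\<close>: an \<omega>\<open>\<^sub>3\<close> that meets TuP can be
  rewritten away. Its image under \<open>P\<close>, proved next, serves for the
  P\<omega>\<open>\<^sub>3\<close> in (W5).\<close>

lemma W1_unit_shifted:
  assumes W1: "W1 C MT MP D" and X: "X \<in> Ob C"
  shows "([P1 (m X), l (TO X)] |> FT (O1 X) <| []) ;; ([] |> O3 X <| [T1 (u (PO X))]) ;;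
    ([l X] |> RuT (PO X) <| []) =
    ([P1 (m X)] |> pinv (Lc (u X)) <| []) ;; ([] |> FP (RuT X) <| [l X])"
proof -
  have r: "([P1 (m X)] |> Lc (u X) <| []) ;; ([P1 (m X), l (TO X)] |> FT (O1 X) <| []) ;;
    ([] |> O3 X <| [T1 (u (PO X))]) ;; ([l X] |> RuT (PO X) <| []) =
    ([] |> FP (RuT X) <| [l X])"
    by (rule trans[OF shift_l_inv[OF W1_pasting[OF W1 X]] vc_idp]) (simp_all add: X wh_sel good_wh piso_fm)
  show ?thesis
    by (rule shift_l[OF r]) (simp_all add: X, (rule good_typed, (rule typed_intros | (simp add: X; fail))+)+)
qed

lemma P_W1_unit_shifted:
  assumes W1: "W1 C MT MP D" and X: "X \<in> Ob C"
  shows "([P1 (P1 (m X)), P1 (l (TO X))] |> FP (FT (O1 X)) <| []) ;;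
    ([] |> FP (O3 X) <| [P1 (T1 (u (PO X)))]) ;; ([P1 (l X)] |> FP (RuT (PO X)) <| []) =
    ([P1 (P1 (m X))] |> pinv (FP (Lc (u X))) <| []) ;; ([] |> FP (FP (RuT X)) <| [P1 (l X)])"
proof -
  have g: "good (([P1 (m X), l (TO X)] |> FT (O1 X) <| []) ;; ([] |> O3 X <| [T1 (u (PO X))]) ;;
    ([l X] |> RuT (PO X) <| []))" "good (([P1 (m X)] |> pinv (Lc (u X)) <| []) ;; ([] |> FP (RuT X) <| [l X]))"
    by (rule good_typed, (rule typed_intros | (simp add: X; fail))+)+
  show ?thesis
    using arg_cong[OF W1_unit_shifted[OF W1 X], of FP] g
    by (simp add: FT_vc_wh good_vc piso_fm X)
qed

lemma RuT_mu:
  assumes X: "X \<in> Ob C"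
  shows "([] |> pinv (Mc (\<mu> X)) <| [T1 (u (PO (PO X)))]) ;; ([T1 (\<mu> X)] |> RuT (PO (PO X)) <| []) =
    ([m (PO X)] |> FT (Uc (\<mu> X)) <| []) ;; ([] |> RuT (PO X) <| [T1 (\<mu> X)])"
proof -
  have r: "([] |> Mc (\<mu> X) <| [T1 (u (PO (PO X)))]) ;; ([m (PO X)] |> FT (Uc (\<mu> X)) <| []) ;;
    ([] |> RuT (PO X) <| [T1 (\<mu> X)]) =
    ([T1 (\<mu> X)] |> RuT (PO (PO X)) <| [])"
    using RuT_nat[of "\<mu> X"] X by simp
  show ?thesis
    by (rule shift_l[OF r, symmetric]) (simp_all add: X, (rule good_typed, (rule typed_intros | (simp add: X; fail))+)+)
qed

text \<open>Naturality of \<lambda> at the 2-cell \<omega>\<open>\<^sub>1\<close> trades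
  TP\<omega>\<open>\<^sub>1\<close> for PT\<omega>\<open>\<^sub>1\<close>, the form in which (W1)
  under \<open>P\<close> applies.\<close>

lemma Lc_O1:
  assumes X: "X \<in> Ob C"
  shows "([l (PO (TO X))] |> FT (FP (O1 X)) <| []) ;; ([] |> pinv (Lc (l X)) <| [T1 (P1 (u (PO X)))]) ;;
    ([P1 (T1 (l X))] |> pinv (Lc (u (PO X))) <| []) =
    ([] |> pinv (Lc (P1 (u X))) <| []) ;; ([] |> FP (FT (O1 X)) <| [l (PO X)])"
proof -
  have r: "(([] |> Lc (P1 (u X)) <| []) ;; ([l (PO (TO X))] |> FT (FP (O1 X)) <| [])) =
      (([] |> FP (FT (O1 X)) <| [l (PO X)]) ;; ([P1 (T1 (l X))] |> Lc (u (PO X)) <| [])) ;; ([] |> Lc (l X) <| [T1 (P1 (u (PO X)))])"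
    using Lc_natural[of "O1 X"] X by (simp add: nat_path_singles wh_simps)
  have r': "(([] |> Lc (P1 (u X)) <| []) ;; ([l (PO (TO X))] |> FT (FP (O1 X)) <| []) ;;
    ([] |> pinv (Lc (l X)) <| [T1 (P1 (u (PO X)))])) =
    ([] |> FP (FT (O1 X)) <| [l (PO X)]) ;; ([P1 (T1 (l X))] |> Lc (u (PO X)) <| [])"
    by (rule shift_r[OF r[symmetric], symmetric, unfolded vc_assoc]) (simp_all add: X, (rule good_typed, (rule typed_intros | (simp add: X; fail))+)+)
  have r'': "(([] |> Lc (P1 (u X)) <| []) ;; ([l (PO (TO X))] |> FT (FP (O1 X)) <| []) ;;
    ([] |> pinv (Lc (l X)) <| [T1 (P1 (u (PO X)))]) ;;
    ([P1 (T1 (l X))] |> pinv (Lc (u (PO X))) <| [])) =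
    ([] |> FP (FT (O1 X)) <| [l (PO X)])"
    by (rule shift_r[OF r'[symmetric], symmetric, unfolded vc_assoc]) (simp_all add: X, (rule good_typed, (rule typed_intros | (simp add: X; fail))+)+)
  show ?thesis
    by (rule shift_l[OF r'']) (simp_all add: X, (rule good_typed, (rule typed_intros | (simp add: X; fail))+)+)
qed

text \<open>The modification square of \<omega>\<open>\<^sub>4\<close> at the 1-cell
  \<open>u X\<close>, solved so that the constraints of \<lambda> occur as inverses, as they do
  after (W1).\<close>

lemma O4_u:
  assumes X: "X \<in> Ob C"
  shows "([l (TO X)] |> FT (Muc (u X)) <| []) ;; ([] |> O4 (TO X) <| [T1 (P1 (P1 (u X)))]) ;;
    ([\<mu> (TO (TO X)), P1 (l (TO X))] |> pinv (Lc (P1 (u X))) <| []) ;;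
    ([\<mu> (TO (TO X))] |> pinv (FP (Lc (u X))) <| [l (PO X)]) =
    ([] |> pinv (Lc (u X)) <| [T1 (\<mu> X)]) ;; ([P1 (T1 (u X))] |> O4 X <| []) ;;
    ([] |> Muc (T1 (u X)) <| [P1 (l X), l (PO X)])"
proof -
  have r: "(([] |> Lc (u X) <| [T1 (\<mu> X)]) ;; ([l (TO X)] |> FT (Muc (u X)) <| []) ;;
    ([] |> O4 (TO X) <| [T1 (P1 (P1 (u X)))])) =
      (([P1 (T1 (u X))] |> O4 X <| []) ;; ([] |> Muc (T1 (u X)) <| [P1 (l X), l (PO X)]) ;;
    ([\<mu> (TO (TO X))] |> FP (Lc (u X)) <| [l (PO X)])) ;; ([\<mu> (TO (TO X)), P1 (l (TO X))] |> Lc (P1 (u X)) <| [])"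
    using O4_nat[of "u X"] X by (simp add: vc_assoc)
  have r': "(([] |> Lc (u X) <| [T1 (\<mu> X)]) ;; ([l (TO X)] |> FT (Muc (u X)) <| []) ;;
    ([] |> O4 (TO X) <| [T1 (P1 (P1 (u X)))]) ;;
    ([\<mu> (TO (TO X)), P1 (l (TO X))] |> pinv (Lc (P1 (u X))) <| [])) =
      (([P1 (T1 (u X))] |> O4 X <| []) ;; ([] |> Muc (T1 (u X)) <| [P1 (l X), l (PO X)])) ;; ([\<mu> (TO (TO X))] |> FP (Lc (u X)) <| [l (PO X)])"
    unfolding vc_assoc by (rule shift_r[OF r[symmetric], symmetric, unfolded vc_assoc]) (simp_all add: X, (rule good_typed, (rule typed_intros | (simp add: X; fail))+)+)
  have r'': "(([] |> Lc (u X) <| [T1 (\<mu> X)]) ;; ([l (TO X)] |> FT (Muc (u X)) <| []) ;;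
    ([] |> O4 (TO X) <| [T1 (P1 (P1 (u X)))]) ;;
    ([\<mu> (TO (TO X)), P1 (l (TO X))] |> pinv (Lc (P1 (u X))) <| []) ;;
    ([\<mu> (TO (TO X))] |> pinv (FP (Lc (u X))) <| [l (PO X)])) =
    ([P1 (T1 (u X))] |> O4 X <| []) ;; ([] |> Muc (T1 (u X)) <| [P1 (l X), l (PO X)])"
    by (rule shift_r[OF r'[symmetric], symmetric, unfolded vc_assoc]) (simp_all add: X, (rule good_typed, (rule typed_intros | (simp add: X; fail))+)+)
  show ?thesis
    by (rule shift_l[OF r'']) (simp_all add: X, (rule good_typed, (rule typed_intros | (simp add: X; fail))+)+)
qed

lemma Muc_RuT:
  assumes X: "X \<in> Ob C"
  shows "([P1 (m X)] |> Muc (T1 (u X)) <| []) ;; ([] |> Muc (m X) <| [P1 (P1 (T1 (u X)))]) ;;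
    ([\<mu> (TO X)] |> FP (FP (RuT X)) <| []) =
    ([] |> FP (RuT X) <| [\<mu> (TO X)])"
  using Muc_natural[of "RuT X"] X
  by (simp add: nat_path_singles wh_simps good_wh wh_sel)

text \<open>The left side of (W9) under \<open>T\<close> ends with the
  T\<omega>\<open>\<^sub>4\<close> that starts (W5). After (W5), naturality of the right unit at
  \<mu> cancels the constraint of \<open>u\<close>, and the remaining
  \<omega>\<open>\<^sub>3\<close> meets T\<omega>\<open>\<^sub>1\<close>, so that (W1) leaves only
  \<omega>\<open>\<^sub>4\<close> and unit data.\<close>

lemma W9_whiskered_left:
  assumes W1: "W1 C MT MP D" and W5: "W5 C MT MP D" and X: "X \<in> Ob C"
  shows "([P1 (m X), l (TO X)] |> FT (O1 X) <| [T1 (\<mu> X)]) ;;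
    ([P1 (m X), l (TO X), T1 (l X)] |> pinv (FT (Uc (\<mu> X))) <| []) ;;
    ([P1 (m X), l (TO X)] |> FT (O4 X) <| [T1 (u (PO (PO X)))]) ;;
    ([P1 (m X)] |> O4 (TO X) <| [T1 (P1 (l X)), T1 (l (PO X)), T1 (u (PO (PO X)))]) ;;
    ([] |> Muc (m X) <| [P1 (l (TO X)), l (PO (TO X)), T1 (P1 (l X)), T1 (l (PO X)), T1 (u (PO (PO X)))]) ;;
    ([\<mu> (TO X), P1 (P1 (m X)), P1 (l (TO X))] |> pinv (Lc (l X)) <| [T1 (l (PO X)), T1 (u (PO (PO X)))]) ;;
    ([\<mu> (TO X)] |> FP (O3 X) <| [l (TO (PO X)), T1 (l (PO X)), T1 (u (PO (PO X)))]) ;;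
    ([\<mu> (TO X), P1 (l X)] |> O3 (PO X) <| [T1 (u (PO (PO X)))]) ;;
    ([\<mu> (TO X), P1 (l X), l (PO X)] |> RuT (PO (PO X)) <| []) =
    ([P1 (m X)] |> pinv (Lc (u X)) <| [T1 (\<mu> X)]) ;; ([] |> FP (RuT X) <| [l X, T1 (\<mu> X)]) ;;
    ([] |> O4 X <| [])" (is "?lhs = ?rhs")
proof -
  let ?s1 = "([P1 (m X), l (TO X)] |> FT (O1 X) <| [T1 (\<mu> X)])"
  let ?s2 = "([P1 (m X), l (TO X), T1 (l X)] |> pinv (FT (Uc (\<mu> X))) <| [])"
  let ?s3 = "([\<mu> (TO X), P1 (l X), l (PO X)] |> RuT (PO (PO X)) <| [])"
  let ?s4 = "([] |> O3 X <| [T1 (T1 (\<mu> X)), T1 (u (PO (PO X)))])"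
  let ?s5 = "([l X] |> pinv (Mc (\<mu> X)) <| [T1 (u (PO (PO X)))])"
  let ?s6 = "([l X] |> RuT (PO X) <| [T1 (\<mu> X)])"
  let ?s7 = "([] |> O3 X <| [T1 (u (PO X)), T1 (\<mu> X)])"
  have "?lhs = ?s1 ;; ?s2 ;; ?s4 ;; ?s5 ;; ([] |> O4 X <| [m (PO (PO X)), T1 (u (PO (PO X)))]) ;; ?s3"
    by (simp only: whisk_cong_vc[OF W5_pasting[OF W5 X], of "[]" "[T1 (u (PO (PO X)))]", simplified wh_simps] vc_assoc)
  also have "\<dots> = ?s1 ;; ?s2 ;; ?s4 ;; ?s5 ;; ([l X, T1 (\<mu> X)] |> RuT (PO (PO X)) <| []) ;; ([] |> O4 X <| [])"
    by (simp add: slide slide_vc X del: wh_Nil)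
  also have "\<dots> = ?s1 ;; ?s2 ;; ?s4 ;; ([l X, m (PO X)] |> FT (Uc (\<mu> X)) <| []) ;; ?s6 ;; ([] |> O4 X <| [])"
    by (simp only: whisk_cong_vc[OF RuT_mu[OF X], of "[l X]" "[]", simplified wh_simps] vc_assoc)
  also have "\<dots> = ?s1 ;; ?s2 ;; ([P1 (m X), l (TO X), T1 (l X)] |> FT (Uc (\<mu> X)) <| []) ;; ?s7 ;; ?s6 ;;
    ([] |> O4 X <| [])"
    by (simp add: slide slide_vc X del: wh_Nil)
  also have "\<dots> = ?s1 ;; ?s7 ;; ?s6 ;; ([] |> O4 X <| [])"
    by (subst pinv_wh_cancel, simp add: X, (rule good_typed, (rule typed_intros | (simp add: X; fail))+))
  also have "\<dots> = ?rhs"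
    by (simp only: whisk_cong_vc[OF W1_unit_shifted[OF W1 X], of "[]" "[T1 (\<mu> X)]", simplified wh_simps] vc_assoc)
  finally show ?thesis .
qed

text \<open>The right side of (W9) has an \<omega>\<open>\<^sub>1\<close> for each
  \<omega>\<open>\<^sub>3\<close> in the rest of (W5): (W1) is used at PX for the outer one and
  under \<open>P\<close> for P\<omega>\<open>\<^sub>3\<close>. The remaining
  \<omega>\<open>\<^sub>4\<close> at TX is moved to X by its square at \<open>u X\<close>, which
  gives the same cell as the left side.\<close>

lemma W9_whiskered_right:
  assumes W1: "W1 C MT MP D" and X: "X \<in> Ob C"
  shows "([P1 (m X), l (TO X)] |> FT (Muc (u X)) <| []) ;;
    ([P1 (m X), l (TO X), T1 (\<mu> (TO X))] |> FT (FP (O1 X)) <| []) ;;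
    ([P1 (m X), l (TO X), T1 (\<mu> (TO X)), T1 (P1 (l X))] |> FT (O1 (PO X)) <| []) ;;
    ([P1 (m X)] |> O4 (TO X) <| [T1 (P1 (l X)), T1 (l (PO X)), T1 (u (PO (PO X)))]) ;;
    ([] |> Muc (m X) <| [P1 (l (TO X)), l (PO (TO X)), T1 (P1 (l X)), T1 (l (PO X)), T1 (u (PO (PO X)))]) ;;
    ([\<mu> (TO X), P1 (P1 (m X)), P1 (l (TO X))] |> pinv (Lc (l X)) <| [T1 (l (PO X)), T1 (u (PO (PO X)))]) ;;
    ([\<mu> (TO X)] |> FP (O3 X) <| [l (TO (PO X)), T1 (l (PO X)), T1 (u (PO (PO X)))]) ;;
    ([\<mu> (TO X), P1 (l X)] |> O3 (PO X) <| [T1 (u (PO (PO X)))]) ;;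
    ([\<mu> (TO X), P1 (l X), l (PO X)] |> RuT (PO (PO X)) <| []) =
    ([P1 (m X)] |> pinv (Lc (u X)) <| [T1 (\<mu> X)]) ;; ([] |> FP (RuT X) <| [l X, T1 (\<mu> X)]) ;;
    ([] |> O4 X <| [])" (is "?lhs = ?rhs")
proof -
  let ?s1 = "([P1 (m X), l (TO X)] |> FT (Muc (u X)) <| [])"
  let ?s2 = "([P1 (m X), l (TO X), T1 (\<mu> (TO X))] |> FT (FP (O1 X)) <| [])"
  let ?s3 = "([\<mu> (TO X), P1 (l X)] |> O3 (PO X) <| [T1 (u (PO (PO X)))])"
  let ?s4 = "([\<mu> (TO X), P1 (l X), l (PO X)] |> RuT (PO (PO X)) <| [])"
  let ?s5 = "([P1 (m X)] |> O4 (TO X) <| [T1 (P1 (l X)), T1 (P1 (u (PO X)))])"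
  let ?s6 = "([] |> Muc (m X) <| [P1 (l (TO X)), l (PO (TO X)), T1 (P1 (l X)), T1 (P1 (u (PO X)))])"
  let ?s7 = "([\<mu> (TO X), P1 (P1 (m X)), P1 (l (TO X))] |> pinv (Lc (l X)) <| [T1 (P1 (u (PO X)))])"
  let ?s8 = "([\<mu> (TO X)] |> FP (O3 X) <| [l (TO (PO X)), T1 (P1 (u (PO X)))])"
  let ?s9 = "([\<mu> (TO X), P1 (l X)] |> FP (RuT (PO X)) <| [l (PO X)])"
  let ?s10 = "([P1 (m X)] |> O4 (TO X) <| [T1 (P1 (P1 (u X)))])"
  let ?s11 = "([] |> Muc (m X) <| [P1 (l (TO X)), l (PO (TO X)), T1 (P1 (P1 (u X)))])"
  let ?s12 = "([\<mu> (TO X)] |> FP (O3 X) <| [P1 (T1 (u (PO X))), l (PO X)])"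
  let ?s13 = "([\<mu> (TO X), P1 (P1 (m X)), P1 (l (TO X))] |> pinv (Lc (P1 (u X))) <| [])"
  let ?s14 = "([\<mu> (TO X)] |> FP (FP (RuT X)) <| [P1 (l X), l (PO X)])"
  let ?s15 = "([] |> Muc (m X) <| [P1 (P1 (T1 (u X))), P1 (l X), l (PO X)])"
  let ?s16 = "([P1 (m X)] |> pinv (Lc (u X)) <| [T1 (\<mu> X)])"
  let ?s17 = "([P1 (m X), P1 (T1 (u X))] |> O4 X <| [])"
  have "?lhs = ?s1 ;; ?s2 ;; ?s5 ;; ?s6 ;; ?s7 ;; ?s8 ;;
    ([\<mu> (TO X), P1 (l X), P1 (m (PO X)), l (TO (PO X))] |> FT (O1 (PO X)) <| []) ;; ?s3 ;; ?s4"
    by (simp add: slide slide_vc X del: wh_Nil)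
  also have "\<dots> = ?s1 ;; ?s2 ;; ?s5 ;; ?s6 ;; ?s7 ;; ?s8 ;;
    ([\<mu> (TO X), P1 (l X), P1 (m (PO X))] |> pinv (Lc (u (PO X))) <| []) ;; ?s9"
    by (simp only: whisk_cong[OF W1_unit_shifted[OF W1 Ob_simps(2)[OF X]], of "[\<mu> (TO X), P1 (l X)]" "[]", simplified wh_simps] vc_assoc)
  \<comment> \<open>TP\<omega>\<open>\<^sub>1\<close> is delayed until it stands before the inverse
    constraints of \<lambda>; \<open>Lc_O1\<close> then moves it under \<open>P\<close>, where it
    meets P\<omega>\<open>\<^sub>3\<close>.\<close>
  also have "\<dots> = ?s1 ;; ?s10 ;; ?s11 ;;
    ([\<mu> (TO X), P1 (P1 (m X)), P1 (l (TO X)), l (PO (TO X))] |> FT (FP (O1 X)) <| []) ;; ?s7 ;;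
    ([\<mu> (TO X), P1 (P1 (m X)), P1 (l (TO X)), P1 (T1 (l X))] |> pinv (Lc (u (PO X))) <| []) ;; ?s12 ;;
    ?s9"
    by (simp add: slide slide_vc X del: wh_Nil)
  also have "\<dots> = ?s1 ;; ?s10 ;; ?s11 ;; ?s13 ;;
    ([\<mu> (TO X), P1 (P1 (m X)), P1 (l (TO X))] |> FP (FT (O1 X)) <| [l (PO X)]) ;; ?s12 ;; ?s9"
    by (simp only: whisk_cong_vc[OF Lc_O1[OF X], of "[\<mu> (TO X), P1 (P1 (m X)), P1 (l (TO X))]" "[]", simplified wh_simps] vc_assoc)
  also have "\<dots> = ?s1 ;; ?s10 ;; ?s11 ;; ?s13 ;; ([\<mu> (TO X), P1 (P1 (m X))] |> pinv (FP (Lc (u X))) <| [l (PO X)]) ;;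
    ?s14"
    by (simp only: whisk_cong[OF P_W1_unit_shifted[OF W1 X], of "[\<mu> (TO X)]" "[l (PO X)]", simplified wh_simps] vc_assoc)
  also have "\<dots> = ?s1 ;; ?s10 ;; ([P1 (m X), \<mu> (TO (TO X)), P1 (l (TO X))] |> pinv (Lc (P1 (u X))) <| []) ;;
    ([P1 (m X), \<mu> (TO (TO X))] |> pinv (FP (Lc (u X))) <| [l (PO X)]) ;; ?s15 ;; ?s14"
    by (simp add: slide slide_vc X del: wh_Nil)
  also have "\<dots> = ?s16 ;; ?s17 ;; ([P1 (m X)] |> Muc (T1 (u X)) <| [P1 (l X), l (PO X)]) ;; ?s15 ;; ?s14"
    by (simp only: whisk_cong_vc[OF O4_u[OF X], of "[P1 (m X)]" "[]", simplified wh_simps] vc_assoc)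
  also have "\<dots> = ?s16 ;; ?s17 ;; ([] |> FP (RuT X) <| [\<mu> (TO X), P1 (l X), l (PO X)])"
    by (simp only: whisk_cong[OF Muc_RuT[OF X], of "[]" "[P1 (l X), l (PO X)]", simplified wh_simps] vc_assoc)
  also have "\<dots> = ?rhs"
    by (simp add: slide slide_vc X del: wh_Nil)
  finally show ?thesis .
qed

text \<open>Precomposing with \<open>u\<close> turns the image under \<open>T\<close> into the cell
  itself whiskered by \<open>u\<close>, by naturality along the boundary words. The whisker is then
  Pm \<cdot> \<lambda>T \<cdot> uPT, which \<omega>\<open>\<^sub>1\<close> and the left unit of
  \<open>T\<close> identify with the identity.\<close>

lemma whisker_mul_cancel:
  assumes X: "X \<in> Ob C" and g: "good x" "good y" and s: "psrc x = psrc y" "ptrg x = PO (TO X)" "ptrg y = PO (TO X)"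
    "dm x = dm y" "cd x = cd y"
    and e: "([P1 (m X), l (TO X)] |> FT x <| []) = ([P1 (m X), l (TO X)] |> FT y <| [])"
  shows "x = y"
proof -
  have w: "is_path (psrc x) (dm x) (PO (TO X))" "psrc x \<in> Ob C" using good_is_path(1)[OF g(1)] good_Ob[OF g(1)] s by auto
  note t = is_path_path_trg[OF w(1)] is_path_path_src[OF w(1)]
  let ?p = "nat_path (pf_id C) T (un MT) (psrc x) (dm x)" and ?q = "nat_path (pf_id C) T (un MT) (psrc x) (cd x)"
  have p: "piso ?p" using piso_nat_path[OF pf(3) pf(1) pn(1) w(1)] .
  note pp = nat_path_props[OF pf(3) pf(1) pn(1) w(1)]
  have n: "([] |> FT x <| [u (psrc x)]) ;; ?q = ?p ;; ([u (PO (TO X))] |> x <| [])"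
    "([] |> FT y <| [u (psrc x)]) ;; ?q = ?p ;; ([u (PO (TO X))] |> y <| [])"
    using Uc_natural[OF g(1)] Uc_natural[OF g(2)] g s by simp_all
  have r: "([P1 (m X), l (TO X)] |> ?p <| []) ;; ([P1 (m X), l (TO X), u (PO (TO X))] |> x <| []) =
    ([P1 (m X), l (TO X)] |> ?p <| []) ;; ([P1 (m X), l (TO X), u (PO (TO X))] |> y <| [])"
    using whisk_cong[OF n(1), of "[P1 (m X), l (TO X)]" "[]"] whisk_cong[OF n(2), of "[P1 (m X), l (TO X)]" "[]"]
      whisk_cong[OF e, of "[]" "[u (psrc x)]"]
    by (simp add: wh_vc wh_wh)
  have e1: "([P1 (m X), l (TO X), u (PO (TO X))] |> x <| []) = ([P1 (m X), l (TO X), u (PO (TO X))] |> y <| [])"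
    by (rule slice_cancel_l[OF r p]) (use pp g s w t X pf_id_map in \<open>simp add: good_vc good_wh wh_sel\<close>)
  \<comment> \<open>\<open>whisker_transport\<close> goes from domain to codomain, and
    \<omega>\<open>\<^sub>1\<close> starts at Pu, hence the inverse.\<close>
  have e2: "([P1 (m X), P1 (u (TO X))] |> x <| []) = ([P1 (m X), P1 (u (TO X))] |> y <| [])"
    using whisker_transport[of "pinv (O1 (TO X))" "[P1 (m X)]" x y] X g s e1 w t
    by (simp add: good_vc good_wh wh_sel)
  have "([] |> x <| []) = ([] |> y <| [])"
    using whisker_transport[of "FP (LuT X)" "[]" x y] X g s e2 w t
    by (simp add: good_vc good_wh wh_sel del: wh_Nil)
  then show ?thesis using g by simp
qed

lemma W9_from_W5:
  assumes W1: "W1 C MT MP D" and W5: "W5 C MT MP D" and X: "X \<in> Ob C"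
  shows "([] |> O1 X <| [\<mu> X]) ;; ([l X] |> pinv (Uc (\<mu> X)) <| []) ;; ([] |> O4 X <| [u (PO (PO X))]) =
    ([] |> Muc (u X) <| []) ;; ([\<mu> (TO X)] |> FP (O1 X) <| []) ;;
    ([\<mu> (TO X), P1 (l X)] |> O1 (PO X) <| [])" (is "?lhs = ?rhs")
proof -
  have A: "good ?lhs \<and> psrc ?lhs = PO (PO X) \<and> dm ?lhs = [P1 (u X), \<mu> X] \<and> cd ?lhs = [\<mu> (TO X), P1 (l X), l (PO X), u (PO (PO X))] \<and> ptrg ?lhs = PO (TO X)"
    by (rule typed_sel, (rule typed_intros | (simp add: X; fail))+)
  have B: "good ?rhs \<and> psrc ?rhs = PO (PO X) \<and> dm ?rhs = [P1 (u X), \<mu> X] \<and> cd ?rhs = [\<mu> (TO X), P1 (l X), l (PO X), u (PO (PO X))] \<and> ptrg ?rhs = PO (TO X)"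
    by (rule typed_sel, (rule typed_intros | (simp add: X; fail))+)
  have TA: "FT (?lhs) = ([] |> FT (O1 X) <| [T1 (\<mu> X)]) ;; ([T1 (l X)] |> pinv (FT (Uc (\<mu> X))) <| []) ;;
    ([] |> FT (O4 X) <| [T1 (u (PO (PO X)))])"
    using A by (simp add: FT_vc_wh good_vc piso_fm X)
  have TB: "FT (?rhs) = ([] |> FT (Muc (u X)) <| []) ;; ([T1 (\<mu> (TO X))] |> FT (FP (O1 X)) <| []) ;;
    ([T1 (\<mu> (TO X)), T1 (P1 (l X))] |> FT (O1 (PO X)) <| [])"
    using B by (simp add: FT_vc_wh good_vc piso_fm X)
  let ?a = "([P1 (m X), l (TO X)] |> FT (O1 X) <| [T1 (\<mu> X)]) ;;
    ([P1 (m X), l (TO X), T1 (l X)] |> pinv (FT (Uc (\<mu> X))) <| []) ;;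
    ([P1 (m X), l (TO X)] |> FT (O4 X) <| [T1 (u (PO (PO X)))])"
  let ?b = "([P1 (m X), l (TO X)] |> FT (Muc (u X)) <| []) ;;
    ([P1 (m X), l (TO X), T1 (\<mu> (TO X))] |> FT (FP (O1 X)) <| []) ;;
    ([P1 (m X), l (TO X), T1 (\<mu> (TO X)), T1 (P1 (l X))] |> FT (O1 (PO X)) <| [])"
  let ?r0 = "([P1 (m X)] |> O4 (TO X) <| [T1 (P1 (l X)), T1 (l (PO X)), T1 (u (PO (PO X)))])"
  let ?r1 = "([] |> Muc (m X) <| [P1 (l (TO X)), l (PO (TO X)), T1 (P1 (l X)), T1 (l (PO X)), T1 (u (PO (PO X)))])"
  let ?r2 = "([\<mu> (TO X), P1 (P1 (m X)), P1 (l (TO X))] |> pinv (Lc (l X)) <| [T1 (l (PO X)), T1 (u (PO (PO X)))])"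
  let ?r3 = "([\<mu> (TO X)] |> FP (O3 X) <| [l (TO (PO X)), T1 (l (PO X)), T1 (u (PO (PO X)))])"
  let ?r4 = "([\<mu> (TO X), P1 (l X)] |> O3 (PO X) <| [T1 (u (PO (PO X)))])"
  let ?r5 = "([\<mu> (TO X), P1 (l X), l (PO X)] |> RuT (PO (PO X)) <| [])"
  \<comment> \<open>The slices \<open>?r0\<close> to \<open>?r5\<close> are the rest of the left
    side of (W5) at TuP and the right unit. They are shared and invertible; bracketing to the left
    exposes them one by one for cancellation.\<close>
  have r: "(((((?a ;; ?r0) ;; ?r1) ;; ?r2) ;; ?r3) ;; ?r4) ;; ?r5 =
      (((((?b ;; ?r0) ;; ?r1) ;; ?r2) ;; ?r3) ;; ?r4) ;; ?r5"
    unfolding vc_assoc by (rule trans[OF W9_whiskered_left[OF W1 W5 X] W9_whiskered_right[OF W1 X, symmetric]])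
  have "?a = ?b"
    by (rule slice_cancel_r[OF slice_cancel_r[OF slice_cancel_r[OF slice_cancel_r[OF slice_cancel_r[OF slice_cancel_r[OF r]]]]]])
      (simp_all add: X, (rule good_typed, (rule typed_intros | (simp add: X; fail))+)+)
  then have e: "([P1 (m X), l (TO X)] |> FT (?lhs) <| []) = ([P1 (m X), l (TO X)] |> FT (?rhs) <| [])"
    unfolding TA TB by (simp add: wh_simps)
  show ?thesis
    by (rule whisker_mul_cancel[OF X _ _ _ _ _ _ _ e]) (simp_all only: A B)
qed

lemma W9_of_pasting:
  assumes W: "\<And>X. X \<in> Ob C \<Longrightarrow> ([] |> O1 X <| [\<mu> X]) ;; ([l X] |> pinv (Uc (\<mu> X)) <| []) ;; ([] |> O4 X <| [u (PO (PO X))]) =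
    ([] |> Muc (u X) <| []) ;; ([\<mu> (TO X)] |> FP (O1 X) <| []) ;;
    ([\<mu> (TO X), P1 (l X)] |> O1 (PO X) <| [])"
  shows "W9 C MT MP D"
  unfolding W9_def Let_def
proof (intro ballI, goal_cases)
  case X: (1 X)
  show ?case
    by (rule typed_cel_eq[OF W[OF X]], (rule typed_intros | (simp add: X; fail))+)
      (simp add: X, simp add: X map_cell_atom cel_atom cel_pinv)+
qed

subsection \<open>The axiom (W10)\<close>

lemma Uc_LuP:
  assumes X: "X \<in> Ob C"
  shows "([] |> pinv (Uc (\<mu> X)) <| [\<eta> (PO X)]) ;; ([T1 (\<mu> X)] |> pinv (Uc (\<eta> (PO X))) <| []) ;;
    ([] |> FT (LuP X) <| [u (PO X)]) =
    ([u (PO X)] |> LuP X <| [])"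
proof -
  have r: "([] |> FT (LuP X) <| [u (PO X)]) =
    ([T1 (\<mu> X)] |> Uc (\<eta> (PO X)) <| []) ;; ([] |> Uc (\<mu> X) <| [\<eta> (PO X)]) ;;
    ([u (PO X)] |> LuP X <| [])"
    using Uc_natural[of "LuP X"] X
    by (simp add: nat_path_singles wh_simps good_wh wh_sel)
  show ?thesis
    by (simp add: r, subst pinv_wh_cancel, simp add: X, (rule good_typed, (rule typed_intros | (simp add: X; fail))+), subst pinv_wh_cancel, simp add: X, (rule good_typed, (rule typed_intros | (simp add: X; fail))+))
qed

text \<open>Read from right to left, (W9) introduces an \<omega>\<open>\<^sub>4\<close>, which the
  \<omega>\<open>\<^sub>2\<close> of (W10) removes by (W2). Naturality of \<open>u\<close> at the
  left unit of \<open>P\<close> absorbs its two constraints.\<close>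

lemma W10_whiskered_left:
  assumes W1: "W1 C MT MP D" and W2: "W2 C MT MP D" and W5: "W5 C MT MP D" and X: "X \<in> Ob C"
  shows "([] |> Muc (u X) <| [\<eta> (PO X)]) ;; ([\<mu> (TO X)] |> FP (O1 X) <| [\<eta> (PO X)]) ;;
    ([\<mu> (TO X), P1 (l X)] |> O1 (PO X) <| [\<eta> (PO X)]) ;;
    ([\<mu> (TO X), P1 (l X), l (PO X)] |> pinv (Uc (\<eta> (PO X))) <| []) ;;
    ([\<mu> (TO X), P1 (l X)] |> O2 (PO X) <| [u (PO X)]) ;; ([\<mu> (TO X)] |> Ec (l X) <| [u (PO X)]) ;;
    ([] |> LuP (TO X) <| [l X, u (PO X)]) =
    ([P1 (u X)] |> LuP X <| []) ;; ([] |> O1 X <| [])" (is "?lhs = ?rhs")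
proof -
  let ?s1 = "([\<mu> (TO X), P1 (l X), l (PO X)] |> pinv (Uc (\<eta> (PO X))) <| [])"
  let ?s2 = "([\<mu> (TO X), P1 (l X)] |> O2 (PO X) <| [u (PO X)])"
  let ?s3 = "([\<mu> (TO X)] |> Ec (l X) <| [u (PO X)])"
  let ?s4 = "([] |> LuP (TO X) <| [l X, u (PO X)])"
  let ?s5 = "([] |> O1 X <| [\<mu> X, \<eta> (PO X)])"
  let ?s6 = "([l X] |> pinv (Uc (\<mu> X)) <| [\<eta> (PO X)])"
  let ?s7 = "([l X, T1 (\<mu> X)] |> pinv (Uc (\<eta> (PO X))) <| [])"
  have "?lhs = ?s5 ;; ?s6 ;; ([] |> O4 X <| [u (PO (PO X)), \<eta> (PO X)]) ;; ?s1 ;; ?s2 ;; ?s3 ;; ?s4"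
    by (simp only: whisk_cong_vc[OF W9_from_W5[OF W1 W5 X, symmetric], of "[]" "[\<eta> (PO X)]", simplified wh_simps] vc_assoc)
  also have "\<dots> = ?s5 ;; ?s6 ;; ?s7 ;; ([] |> O4 X <| [T1 (\<eta> (PO X)), u (PO X)]) ;; ?s2 ;; ?s3 ;; ?s4"
    by (simp add: slide slide_vc X del: wh_Nil)
  also have "\<dots> = ?s5 ;; ?s6 ;; ?s7 ;; ([l X] |> FT (LuP X) <| [u (PO X)])"
    by (simp only: whisk_cong[OF W2_unit[OF W2 X], of "[]" "[u (PO X)]", simplified wh_simps] vc_assoc)
  also have "\<dots> = ?s5 ;; ([l X, u (PO X)] |> LuP X <| [])"
    by (simp only: whisk_cong[OF Uc_LuP[OF X], of "[l X]" "[]", simplified wh_simps] vc_assoc)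
  also have "\<dots> = ?rhs"
    by (simp add: slide slide_vc X del: wh_Nil)
  finally show ?thesis .
qed

text \<open>Naturality of \<eta> at \<omega>\<open>\<^sub>1\<close> trades
  P\<omega>\<open>\<^sub>1\<close> for \<omega>\<open>\<^sub>1\<close>, and naturality of the left
  unit at \<open>u X\<close> removes \<mu> against \<eta>. The result is the cell reached from the
  other side of (W10).\<close>

lemma W10_whiskered_right:
  assumes X: "X \<in> Ob C"
  shows "([] |> Muc (u X) <| [\<eta> (PO X)]) ;; ([\<mu> (TO X)] |> FP (O1 X) <| [\<eta> (PO X)]) ;;
    ([\<mu> (TO X), P1 (l X)] |> Ec (u (PO X)) <| []) ;; ([\<mu> (TO X)] |> Ec (l X) <| [u (PO X)]) ;;
    ([] |> LuP (TO X) <| [l X, u (PO X)]) =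
    ([P1 (u X)] |> LuP X <| []) ;; ([] |> O1 X <| [])" (is "?lhs = ?rhs")
proof -
  have nE: "([] |> FP (O1 X) <| [\<eta> (PO X)]) ;; ([P1 (l X)] |> Ec (u (PO X)) <| []) ;;
    ([] |> Ec (l X) <| [u (PO X)]) =
    ([] |> Ec (P1 (u X)) <| []) ;; ([\<eta> (PO (TO X))] |> O1 X <| [])"
    using Ec_natural[of "O1 X"] X by (simp add: nat_path_singles wh_simps)
  have nL: "([] |> Muc (u X) <| [\<eta> (PO X)]) ;; ([\<mu> (TO X)] |> Ec (P1 (u X)) <| []) ;;
    ([] |> LuP (TO X) <| [P1 (u X)]) =
    ([P1 (u X)] |> LuP X <| [])"
    using LuP_nat[of "u X"] X by simp
  let ?s1 = "([] |> Muc (u X) <| [\<eta> (PO X)])"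
  let ?s2 = "([] |> LuP (TO X) <| [l X, u (PO X)])"
  let ?s3 = "([\<mu> (TO X)] |> Ec (P1 (u X)) <| [])"
  have "?lhs = ?s1 ;; ?s3 ;; ([\<mu> (TO X), \<eta> (PO (TO X))] |> O1 X <| []) ;; ?s2"
    by (simp only: whisk_cong_vc[OF nE, of "[\<mu> (TO X)]" "[]", simplified wh_simps] vc_assoc)
  also have "\<dots> = ?s1 ;; ?s3 ;; ([] |> LuP (TO X) <| [P1 (u X)]) ;; ([] |> O1 X <| [])"
    by (simp add: slide slide_vc X del: wh_Nil)
  also have "\<dots> = ?rhs"
    by (simp only: whisk_cong_vc[OF nL, of "[]" "[]", simplified wh_simps] vc_assoc)
  finally show ?thesis .
qed

lemma W10_whiskered:
  assumes W1: "W1 C MT MP D" and W2: "W2 C MT MP D" and W5: "W5 C MT MP D" and X: "X \<in> Ob C"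
  shows "([\<mu> (TO X), P1 (l X)] |> O1 (PO X) <| [\<eta> (PO X)]) ;;
    ([\<mu> (TO X), P1 (l X), l (PO X)] |> pinv (Uc (\<eta> (PO X))) <| []) ;;
    ([\<mu> (TO X), P1 (l X)] |> O2 (PO X) <| [u (PO X)]) =
    ([\<mu> (TO X), P1 (l X)] |> Ec (u (PO X)) <| [])" (is "?lhs = ?rhs")
proof -
  note r = trans[OF W10_whiskered_left[OF W1 W2 W5 X] W10_whiskered_right[OF X, symmetric]]
  have r': "(?lhs ;; ([\<mu> (TO X)] |> Ec (l X) <| [u (PO X)])) ;; ([] |> LuP (TO X) <| [l X, u (PO X)]) = (?rhs ;; ([\<mu> (TO X)] |> Ec (l X) <| [u (PO X)])) ;; ([] |> LuP (TO X) <| [l X, u (PO X)])"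
    unfolding vc_assoc by (rule slice_cancel_l[OF slice_cancel_l[OF r]]) (simp_all add: X, (rule good_typed, (rule typed_intros | (simp add: X; fail))+)+)
  show ?thesis
    by (rule slice_cancel_r[OF slice_cancel_r[OF r']]) (simp_all add: X, (rule good_typed, (rule typed_intros | (simp add: X; fail))+)+)
qed

section \<open>Passage of (W10) from PX to X\<close>

lemma Uc_Ec:
  assumes X: "X \<in> Ob C"
  shows "([] |> Uc (P1 (\<eta> X)) <| [\<eta> X]) ;; ([u (PO (PO X))] |> Ec (\<eta> X) <| []) ;;
    ([] |> pinv (Uc (\<eta> (PO X))) <| [\<eta> X]) =
    ([T1 (P1 (\<eta> X))] |> pinv (Uc (\<eta> X)) <| []) ;; ([] |> FT (Ec (\<eta> X)) <| [u X]) ;;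
    ([T1 (\<eta> (PO X))] |> Uc (\<eta> X) <| [])"
proof -
  have r: "(([T1 (P1 (\<eta> X))] |> Uc (\<eta> X) <| []) ;; ([] |> Uc (P1 (\<eta> X)) <| [\<eta> X])) ;; ([u (PO (PO X))] |> Ec (\<eta> X) <| []) =
      (([] |> FT (Ec (\<eta> X)) <| [u X]) ;; ([T1 (\<eta> (PO X))] |> Uc (\<eta> X) <| [])) ;; ([] |> Uc (\<eta> (PO X)) <| [\<eta> X])"
    using Uc_natural[of "Ec (\<eta> X)"] X by (simp add: nat_path_singles wh_simps)
  have r': "([T1 (P1 (\<eta> X))] |> Uc (\<eta> X) <| []) ;; ([] |> Uc (P1 (\<eta> X)) <| [\<eta> X]) ;;
    ([u (PO (PO X))] |> Ec (\<eta> X) <| []) ;; ([] |> pinv (Uc (\<eta> (PO X))) <| [\<eta> X]) =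
    ([] |> FT (Ec (\<eta> X)) <| [u X]) ;; ([T1 (\<eta> (PO X))] |> Uc (\<eta> X) <| [])"
    by (rule shift_r[OF r[symmetric], symmetric, unfolded vc_assoc]) (simp_all add: X, (rule good_typed, (rule typed_intros | (simp add: X; fail))+)+)
  show ?thesis
    by (rule shift_l[OF r']) (simp_all add: X, (rule good_typed, (rule typed_intros | (simp add: X; fail))+)+)
qed

lemma W10_left_natural:
  assumes X: "X \<in> Ob C"
  shows "([] |> FP (Uc (\<eta> X)) <| [\<eta> X]) ;; ([P1 (u (PO X))] |> Ec (\<eta> X) <| []) ;;
    ([] |> O1 (PO X) <| [\<eta> (PO X), \<eta> X]) ;; ([l (PO X)] |> pinv (Uc (\<eta> (PO X))) <| [\<eta> X]) ;;
    ([] |> O2 (PO X) <| [u (PO X), \<eta> X]) =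
    ([P1 (T1 (\<eta> X))] |> O1 X <| [\<eta> X]) ;; ([P1 (T1 (\<eta> X)), l X] |> pinv (Uc (\<eta> X)) <| []) ;;
    ([P1 (T1 (\<eta> X))] |> O2 X <| [u X]) ;; ([] |> Ec (T1 (\<eta> X)) <| [u X]) ;;
    ([\<eta> (TO (PO X))] |> Uc (\<eta> X) <| [])" (is "?lhs = ?rhs")
proof -
  have n1: "([] |> FP (Uc (\<eta> X)) <| []) ;; ([] |> O1 (PO X) <| [P1 (\<eta> X)]) =
    ([P1 (T1 (\<eta> X))] |> O1 X <| []) ;; ([] |> Lc (\<eta> X) <| [u (PO X)]) ;;
    ([l (PO X)] |> Uc (P1 (\<eta> X)) <| [])"
    using O1_nat[of "\<eta> X"] X by simp
  have n2: "([] |> Lc (\<eta> X) <| [T1 (\<eta> X)]) ;; ([l (PO X)] |> FT (Ec (\<eta> X)) <| []) ;;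
    ([] |> O2 (PO X) <| [T1 (\<eta> X)]) =
    ([P1 (T1 (\<eta> X))] |> O2 X <| []) ;; ([] |> Ec (T1 (\<eta> X)) <| [])"
    using O2_nat[of "\<eta> X"] X by simp
  let ?s1 = "([] |> FP (Uc (\<eta> X)) <| [\<eta> X])"
  let ?s2 = "([l (PO X)] |> pinv (Uc (\<eta> (PO X))) <| [\<eta> X])"
  let ?s3 = "([] |> O2 (PO X) <| [u (PO X), \<eta> X])"
  let ?s4 = "([l (PO X), u (PO (PO X))] |> Ec (\<eta> X) <| [])"
  let ?s5 = "([P1 (T1 (\<eta> X))] |> O1 X <| [\<eta> X])"
  let ?s6 = "([] |> Lc (\<eta> X) <| [u (PO X), \<eta> X])"
  let ?s7 = "([l (PO X)] |> FT (Ec (\<eta> X)) <| [u X])"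
  have "?lhs = ?s1 ;; ([] |> O1 (PO X) <| [P1 (\<eta> X), \<eta> X]) ;; ?s4 ;; ?s2 ;; ?s3"
    by (simp add: slide slide_vc X del: wh_Nil)
  also have "\<dots> = ?s5 ;; ?s6 ;; ([l (PO X)] |> Uc (P1 (\<eta> X)) <| [\<eta> X]) ;; ?s4 ;; ?s2 ;; ?s3"
    by (simp only: whisk_cong_vc[OF n1, of "[]" "[\<eta> X]", simplified wh_simps] vc_assoc)
  also have "\<dots> = ?s5 ;; ?s6 ;; ([l (PO X), T1 (P1 (\<eta> X))] |> pinv (Uc (\<eta> X)) <| []) ;; ?s7 ;;
    ([l (PO X), T1 (\<eta> (PO X))] |> Uc (\<eta> X) <| []) ;; ?s3"
    by (simp only: whisk_cong_vc[OF Uc_Ec[OF X], of "[l (PO X)]" "[]", simplified wh_simps] vc_assoc)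
  also have "\<dots> = ?s5 ;; ([P1 (T1 (\<eta> X)), l X] |> pinv (Uc (\<eta> X)) <| []) ;; ([] |> Lc (\<eta> X) <| [T1 (\<eta> X), u X]) ;;
    ?s7 ;; ([] |> O2 (PO X) <| [T1 (\<eta> X), u X]) ;; ([\<eta> (TO (PO X))] |> Uc (\<eta> X) <| [])"
    by (simp add: slide slide_vc X del: wh_Nil)
  also have "\<dots> = ?rhs"
    by (simp only: whisk_cong_vc[OF n2, of "[]" "[u X]", simplified wh_simps] vc_assoc)
  finally show ?thesis .
qed

text \<open>The right side of (W10) is a single constraint of \<eta>, so naturality of \<eta> at the
  constraint of \<open>u\<close> at \<eta> suffices.\<close>

lemma W10_right_natural:
  assumes X: "X \<in> Ob C"
  shows "([] |> FP (Uc (\<eta> X)) <| [\<eta> X]) ;; ([P1 (u (PO X))] |> Ec (\<eta> X) <| []) ;;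
    ([] |> Ec (u (PO X)) <| [\<eta> X]) =
    ([P1 (T1 (\<eta> X))] |> Ec (u X) <| []) ;; ([] |> Ec (T1 (\<eta> X)) <| [u X]) ;;
    ([\<eta> (TO (PO X))] |> Uc (\<eta> X) <| [])"
  using Ec_natural[of "Uc (\<eta> X)"] X by (simp add: nat_path_singles wh_simps)

lemma W10_from_W5:
  assumes W1: "W1 C MT MP D" and W2: "W2 C MT MP D" and W5: "W5 C MT MP D" and X: "X \<in> Ob C"
  shows "([] |> O1 X <| [\<eta> X]) ;; ([l X] |> pinv (Uc (\<eta> X)) <| []) ;; ([] |> O2 X <| [u X]) =
    ([] |> Ec (u X) <| [])" (is "?lhs = ?rhs")
proof -
  let ?A = "([\<mu> (TO X), P1 (l X), P1 (T1 (\<eta> X))] |> O1 X <| [\<eta> X]) ;;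
    ([\<mu> (TO X), P1 (l X), P1 (T1 (\<eta> X)), l X] |> pinv (Uc (\<eta> X)) <| []) ;;
    ([\<mu> (TO X), P1 (l X), P1 (T1 (\<eta> X))] |> O2 X <| [u X])"
  let ?B = "([\<mu> (TO X), P1 (l X), P1 (T1 (\<eta> X))] |> Ec (u X) <| [])"
  have r: "(?A ;; ([\<mu> (TO X), P1 (l X)] |> Ec (T1 (\<eta> X)) <| [u X])) ;; ([\<mu> (TO X), P1 (l X), \<eta> (TO (PO X))] |> Uc (\<eta> X) <| []) =
      (?B ;; ([\<mu> (TO X), P1 (l X)] |> Ec (T1 (\<eta> X)) <| [u X])) ;; ([\<mu> (TO X), P1 (l X), \<eta> (TO (PO X))] |> Uc (\<eta> X) <| [])"
    using whisk_cong[OF W10_left_natural[OF X], of "[\<mu> (TO X), P1 (l X)]" "[]"] whisk_cong[OF W10_right_natural[OF X], of "[\<mu> (TO X), P1 (l X)]" "[]"]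
      whisk_cong[OF W10_whiskered[OF W1 W2 W5 X], of "[]" "[\<eta> X]"]
    by (simp add: wh_simps)
  have "?A = ?B"
    by (rule slice_cancel_r[OF slice_cancel_r[OF r]]) (simp_all add: X, (rule good_typed, (rule typed_intros | (simp add: X; fail))+)+)
  then have "([\<mu> (TO X), P1 (l X), P1 (T1 (\<eta> X))] |> ?lhs <| []) = ([\<mu> (TO X), P1 (l X), P1 (T1 (\<eta> X))] |> ?rhs <| [])"
    by (simp add: wh_simps del: wh_Nil)
  moreover have "good ?lhs \<and> psrc ?lhs = X \<and> dm ?lhs = [P1 (u X), \<eta> X] \<and> cd ?lhs = [\<eta> (TO X), u X] \<and> ptrg ?lhs = PO (TO X)"
    by (rule typed_sel, (rule typed_intros | (simp add: X; fail))+)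
  moreover have "good ?rhs \<and> psrc ?rhs = X \<and> dm ?rhs = [P1 (u X), \<eta> X] \<and> cd ?rhs = [\<eta> (TO X), u X] \<and> ptrg ?rhs = PO (TO X)"
    by (rule typed_sel, (rule typed_intros | (simp add: X; fail))+)
  ultimately show ?thesis
    using whisker_unit_cancel[OF X] by (auto simp del: wh_Nil)
qed

lemma W10_of_pasting:
  assumes W: "\<And>X. X \<in> Ob C \<Longrightarrow> ([] |> O1 X <| [\<eta> X]) ;; ([l X] |> pinv (Uc (\<eta> X)) <| []) ;; ([] |> O2 X <| [u X]) =
    ([] |> Ec (u X) <| [])"
  shows "W10 C MT MP D"
  unfolding W10_def Let_def
proof (intro ballI, goal_cases)
  case X: (1 X)
  show ?case
    by (rule typed_cel_eq[OF W[OF X]], (rule typed_intros | (simp add: X; fail))+)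
      (simp add: X, simp add: X map_cell_atom cel_atom cel_pinv)+
qed

subsection \<open>The categories of pseudodistributive laws\<close>

lemma pdl_morphism_Ident: "pdl_morphism C MT MP D D (\<lambda>X \<in> Ob C. Id2 C (l X))"
proof -
  have o: "pcell (lam D) f \<in> Cell C" "Dom C (pcell (lam D) f) = P1 (T1 f) \<cdot> l (Src C f)"
    "Cod C (pcell (lam D) f) = l (Trg C f) \<cdot> T1 (P1 f)" if "f \<in> Arr C" for f
    using good_cel[of "Lc f"] that by (simp_all add: cel_atom)
  have "modification C (pf_comp C T P) (pf_comp C P T) (lam D) (lam D) (\<lambda>X \<in> Ob C. Id2 C (l X))"
    by unfold_locales (auto simp: hom1_iff hom2_iff Src_Ob Trg_Ob o)
  moreover have "cell_map T (Id2 C (l X)) = Id2 C (T1 (l X))" "cell_map P (Id2 C (l X)) = Id2 C (P1 (l X))" if "X \<in> Ob C" for X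
    using pseudofunctor.cell_map_Id2[OF pf(1)] pseudofunctor.cell_map_Id2[OF pf(2)] that by auto
  ultimately show ?thesis
    using iso2_cell[OF om_iso(5)] iso2_cell[OF om_iso(6)] iso2_cell[OF om_iso(7)] iso2_cell[OF om_iso(8)]
    by (simp add: pdl_morphism_def)
qed

text \<open>The compatibility squares of \<Gamma> and \<Delta> are pasted together. For
  \<omega>\<open>\<^sub>3\<close> and \<omega>\<open>\<^sub>4\<close>, which involve \<lambda>
  twice, interchange first splits the horizontal composite of the two components.\<close>

lemma pdl_morphism_Comp:
  assumes D': "pdl_data C MT MP D'" and D'': "pdl_data C MT MP D''"
    and G: "pdl_morphism C MT MP D D' \<Gamma>" and H: "pdl_morphism C MT MP D' D'' \<Delta>"
  shows "pdl_morphism C MT MP D D'' (\<lambda>X \<in> Ob C. \<Gamma> X \<Zsemi> \<Delta> X)"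
proof -
  interpret D': pdl_setting C MT MP D' by (rule pdl_setting.intro[OF two_category_axioms pdl_setting_axioms.intro[OF MT MP D']])
  interpret D'': pdl_setting C MT MP D'' by (rule pdl_setting.intro[OF two_category_axioms pdl_setting_axioms.intro[OF MT MP D'']])
  have mG: "modification C (pf_comp C T P) (pf_comp C P T) (lam D) (lam D') \<Gamma>"
    and mH: "modification C (pf_comp C T P) (pf_comp C P T) (lam D') (lam D'') \<Delta>"
    using G H by (auto simp: pdl_morphism_def)
  have t: "\<Gamma> X \<in> Cell C" "Dom C (\<Gamma> X) = l X" "Cod C (\<Gamma> X) = pcomp (lam D') X"
    "\<Delta> X \<in> Cell C" "Dom C (\<Delta> X) = pcomp (lam D') X" "Cod C (\<Delta> X) = pcomp (lam D'') X" if "X \<in> Ob C" for X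
    using modification.component[OF mG that] modification.component[OF mH that] by (auto simp: hom2_iff)
  have p: "pcell (lam D) f \<in> Cell C" "Dom C (pcell (lam D) f) = P1 (T1 f) \<cdot> l (Src C f)"
    "Cod C (pcell (lam D) f) = l (Trg C f) \<cdot> T1 (P1 f)"
    "pcell (lam D') f \<in> Cell C" "Dom C (pcell (lam D') f) = P1 (T1 f) \<cdot> pcomp (lam D') (Src C f)"
    "Cod C (pcell (lam D') f) = pcomp (lam D') (Trg C f) \<cdot> T1 (P1 f)"
    "pcell (lam D'') f \<in> Cell C" "Dom C (pcell (lam D'') f) = P1 (T1 f) \<cdot> pcomp (lam D'') (Src C f)"
    "Cod C (pcell (lam D'') f) = pcomp (lam D'') (Trg C f) \<cdot> T1 (P1 f)" if "f \<in> Arr C" for f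
    using good_cel[of "Lc f"] good_cel[of "D'.Lc f"] good_cel[of "D''.Lc f"] that
    by (simp_all add: cel_atom D'.cel_atom D''.cel_atom)
  have n: "pcell (lam D) f \<Zsemi> ((\<Gamma> Y \<Zsemi> \<Delta> Y) \<lhd> T1 (P1 f)) = (P1 (T1 f) \<rhd> (\<Gamma> X \<Zsemi> \<Delta> X)) \<Zsemi> pcell (lam D'') f"
    if f: "f \<in> hom1 C X Y" for f X Y
  proof -
    have o: "f \<in> Arr C" "Src C f = X" "Trg C f = Y" "X \<in> Ob C" "Y \<in> Ob C"
      using f hom1_Ob by (auto simp: hom1_iff)
    have nG: "pcell (lam D) f \<Zsemi> (\<Gamma> Y \<lhd> T1 (P1 f)) = (P1 (T1 f) \<rhd> \<Gamma> X) \<Zsemi> pcell (lam D') f"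
      using modification.natural[OF mG f] by simp
    have nH: "pcell (lam D') f \<Zsemi> (\<Delta> Y \<lhd> T1 (P1 f)) = (P1 (T1 f) \<rhd> \<Delta> X) \<Zsemi> pcell (lam D'') f"
      using modification.natural[OF mH f] by simp
    have "pcell (lam D) f \<Zsemi> ((\<Gamma> Y \<Zsemi> \<Delta> Y) \<lhd> T1 (P1 f)) =
        (pcell (lam D) f \<Zsemi> (\<Gamma> Y \<lhd> T1 (P1 f))) \<Zsemi> (\<Delta> Y \<lhd> T1 (P1 f))"
      using o p[OF o(1)] t by (simp add: rwhisk_vcomp)
    also have "\<dots> = (P1 (T1 f) \<rhd> \<Gamma> X) \<Zsemi> (pcell (lam D') f \<Zsemi> (\<Delta> Y \<lhd> T1 (P1 f)))"
      unfolding nG using o p[OF o(1)] t by simp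
    also have "\<dots> = (P1 (T1 f) \<rhd> (\<Gamma> X \<Zsemi> \<Delta> X)) \<Zsemi> pcell (lam D'') f"
      unfolding nH using o p[OF o(1)] t by (simp add: lwhisk_vcomp)
    finally show ?thesis .
  qed
  have m: "modification C (pf_comp C T P) (pf_comp C P T) (lam D) (lam D'') (\<lambda>X \<in> Ob C. \<Gamma> X \<Zsemi> \<Delta> X)"
  proof
    fix f X Y
    assume f: "f \<in> hom1 C X Y"
    then show "pcell (lam D) f \<Zsemi> ((\<lambda>X \<in> Ob C. \<Gamma> X \<Zsemi> \<Delta> X) Y \<lhd> arr_map (pf_comp C T P) f) =
      (arr_map (pf_comp C P T) f \<rhd> (\<lambda>X \<in> Ob C. \<Gamma> X \<Zsemi> \<Delta> X) X) \<Zsemi> pcell (lam D'') f"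
      using n[OF f] hom1_Ob[OF f] by simp
  qed (use t in \<open>simp add: hom2_iff\<close>)
  have eqs: "om1 D X \<Zsemi> ((\<Gamma> X \<Zsemi> \<Delta> X) \<lhd> u (PO X)) = om1 D'' X \<and>
      ((\<Gamma> X \<Zsemi> \<Delta> X) \<lhd> T1 (\<eta> X)) \<Zsemi> om2 D'' X = om2 D X \<and>
      (P1 (m X) \<rhd> ((\<Gamma> (TO X) \<Zsemi> \<Delta> (TO X)) \<star> cell_map T (\<Gamma> X \<Zsemi> \<Delta> X))) \<Zsemi> om3 D'' X =
        om3 D X \<Zsemi> ((\<Gamma> X \<Zsemi> \<Delta> X) \<lhd> m (PO X)) \<and>
      ((\<Gamma> X \<Zsemi> \<Delta> X) \<lhd> T1 (\<mu> X)) \<Zsemi> om4 D'' X =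
        om4 D X \<Zsemi> (\<mu> (TO X) \<rhd> (cell_map P (\<Gamma> X \<Zsemi> \<Delta> X) \<star> (\<Gamma> (PO X) \<Zsemi> \<Delta> (PO X))))"
    if X: "X \<in> Ob C" for X
  proof -
    note tt = t[OF X] t[OF Ob_simps(1)[OF X]] t[OF Ob_simps(2)[OF X]]
      pf_cell[OF pf(1)] pf_cell[OF pf(2)] X
    note oo = iso2_cell(1-3)[OF om_iso(5)[OF X]] iso2_cell(1-3)[OF om_iso(6)[OF X]]
      iso2_cell(1-3)[OF om_iso(7)[OF X]] iso2_cell(1-3)[OF om_iso(8)[OF X]]
      iso2_cell(1-3)[OF D'.om_iso(5)[OF X]] iso2_cell(1-3)[OF D'.om_iso(6)[OF X]]
      iso2_cell(1-3)[OF D'.om_iso(7)[OF X]] iso2_cell(1-3)[OF D'.om_iso(8)[OF X]]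
      iso2_cell(1-3)[OF D''.om_iso(5)[OF X]] iso2_cell(1-3)[OF D''.om_iso(6)[OF X]]
      iso2_cell(1-3)[OF D''.om_iso(7)[OF X]] iso2_cell(1-3)[OF D''.om_iso(8)[OF X]]
    have g: "om1 D X \<Zsemi> (\<Gamma> X \<lhd> u (PO X)) = om1 D' X" "(\<Gamma> X \<lhd> T1 (\<eta> X)) \<Zsemi> om2 D' X = om2 D X"
      "(P1 (m X) \<rhd> (\<Gamma> (TO X) \<star> cell_map T (\<Gamma> X))) \<Zsemi> om3 D' X = om3 D X \<Zsemi> (\<Gamma> X \<lhd> m (PO X))"
      "(\<Gamma> X \<lhd> T1 (\<mu> X)) \<Zsemi> om4 D' X = om4 D X \<Zsemi> (\<mu> (TO X) \<rhd> (cell_map P (\<Gamma> X) \<star> \<Gamma> (PO X)))"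
      using G X by (auto simp: pdl_morphism_def)
    have h: "om1 D' X \<Zsemi> (\<Delta> X \<lhd> u (PO X)) = om1 D'' X" "(\<Delta> X \<lhd> T1 (\<eta> X)) \<Zsemi> om2 D'' X = om2 D' X"
      "(P1 (m X) \<rhd> (\<Delta> (TO X) \<star> cell_map T (\<Delta> X))) \<Zsemi> om3 D'' X = om3 D' X \<Zsemi> (\<Delta> X \<lhd> m (PO X))"
      "(\<Delta> X \<lhd> T1 (\<mu> X)) \<Zsemi> om4 D'' X = om4 D' X \<Zsemi> (\<mu> (TO X) \<rhd> (cell_map P (\<Delta> X) \<star> \<Delta> (PO X)))"
      using H X by (auto simp: pdl_morphism_def)
    have v: "cell_map T (\<Gamma> X \<Zsemi> \<Delta> X) = cell_map T (\<Gamma> X) \<Zsemi> cell_map T (\<Delta> X)"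
      "cell_map P (\<Gamma> X \<Zsemi> \<Delta> X) = cell_map P (\<Gamma> X) \<Zsemi> cell_map P (\<Delta> X)"
      using pseudofunctor.cell_map_vcomp[OF pf(1), of "\<Gamma> X" _ _ "\<Delta> X"]
        pseudofunctor.cell_map_vcomp[OF pf(2), of "\<Gamma> X" _ _ "\<Delta> X"] tt by (simp_all add: hom2_iff)
    have "om1 D X \<Zsemi> ((\<Gamma> X \<Zsemi> \<Delta> X) \<lhd> u (PO X)) = (om1 D X \<Zsemi> (\<Gamma> X \<lhd> u (PO X))) \<Zsemi> (\<Delta> X \<lhd> u (PO X))"
      using tt oo by (simp add: rwhisk_vcomp)
    then have 1: "om1 D X \<Zsemi> ((\<Gamma> X \<Zsemi> \<Delta> X) \<lhd> u (PO X)) = om1 D'' X" by (simp add: g h)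
    have "((\<Gamma> X \<Zsemi> \<Delta> X) \<lhd> T1 (\<eta> X)) \<Zsemi> om2 D'' X = (\<Gamma> X \<lhd> T1 (\<eta> X)) \<Zsemi> ((\<Delta> X \<lhd> T1 (\<eta> X)) \<Zsemi> om2 D'' X)"
      using tt oo by (simp add: rwhisk_vcomp)
    then have 2: "((\<Gamma> X \<Zsemi> \<Delta> X) \<lhd> T1 (\<eta> X)) \<Zsemi> om2 D'' X = om2 D X" by (simp add: g h)
    have "(P1 (m X) \<rhd> ((\<Gamma> (TO X) \<Zsemi> \<Delta> (TO X)) \<star> cell_map T (\<Gamma> X \<Zsemi> \<Delta> X))) \<Zsemi> om3 D'' X =
        (P1 (m X) \<rhd> (\<Gamma> (TO X) \<star> cell_map T (\<Gamma> X))) \<Zsemi> ((P1 (m X) \<rhd> (\<Delta> (TO X) \<star> cell_map T (\<Delta> X))) \<Zsemi> om3 D'' X)"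
      unfolding v using tt oo by (simp add: interchange' lwhisk_vcomp)
    also have "\<dots> = ((P1 (m X) \<rhd> (\<Gamma> (TO X) \<star> cell_map T (\<Gamma> X))) \<Zsemi> om3 D' X) \<Zsemi> (\<Delta> X \<lhd> m (PO X))"
      unfolding h using tt oo by simp
    also have "\<dots> = om3 D X \<Zsemi> ((\<Gamma> X \<Zsemi> \<Delta> X) \<lhd> m (PO X))"
      unfolding g using tt oo by (simp add: rwhisk_vcomp)
    finally have 3: "(P1 (m X) \<rhd> ((\<Gamma> (TO X) \<Zsemi> \<Delta> (TO X)) \<star> cell_map T (\<Gamma> X \<Zsemi> \<Delta> X))) \<Zsemi> om3 D'' X =
        om3 D X \<Zsemi> ((\<Gamma> X \<Zsemi> \<Delta> X) \<lhd> m (PO X))" .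
    have "((\<Gamma> X \<Zsemi> \<Delta> X) \<lhd> T1 (\<mu> X)) \<Zsemi> om4 D'' X = (\<Gamma> X \<lhd> T1 (\<mu> X)) \<Zsemi> ((\<Delta> X \<lhd> T1 (\<mu> X)) \<Zsemi> om4 D'' X)"
      using tt oo by (simp add: rwhisk_vcomp)
    also have "\<dots> = ((\<Gamma> X \<lhd> T1 (\<mu> X)) \<Zsemi> om4 D' X) \<Zsemi> (\<mu> (TO X) \<rhd> (cell_map P (\<Delta> X) \<star> \<Delta> (PO X)))"
      unfolding h using tt oo by simp
    also have "\<dots> = om4 D X \<Zsemi> (\<mu> (TO X) \<rhd> (cell_map P (\<Gamma> X \<Zsemi> \<Delta> X) \<star> (\<Gamma> (PO X) \<Zsemi> \<Delta> (PO X))))"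
      unfolding g v using tt oo by (simp add: interchange' lwhisk_vcomp)
    finally show ?thesis using 1 2 3 by simp
  qed
  show ?thesis
    unfolding pdl_morphism_def using m eqs by simp
qed

end

text \<open>The predicate \<open>axs\<close> only selects objects, so one argument covers both
  categories. Extensionality makes the unit and associativity laws hold as equalities of functions,
  also outside \<open>Ob C\<close>.\<close>

lemma pdl_category_category:
  assumes C: "two_category C" and T: "pseudomonad C T" and P: "pseudomonad C P"
  shows "category (pdl_category C T P axs)"
proof -
  interpret two_category C by (rule C)
  have s: "pdl_setting C T P D" if "pdl_data C T P D" for D
    by (rule pdl_setting.intro[OF C pdl_setting_axioms.intro[OF T P that]])
  have t: "\<Gamma> X \<in> Cell C" "Dom C (\<Gamma> X) = pcomp (lam D) X" "Cod C (\<Gamma> X) = pcomp (lam D') X"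
    if "pdl_morphism C T P D D' \<Gamma>" "X \<in> Ob C" for D D' \<Gamma> X
    using modification.component[of C _ _ "lam D" "lam D'" \<Gamma> X] that
    by (auto simp: pdl_morphism_def hom2_iff)
  show ?thesis
  proof (unfold_locales, goal_cases)
    case (1 a)
    then show ?case
      using pdl_setting.pdl_morphism_Ident[OF s[of a]] by (auto simp: pdl_category_def)
  next
    case (2 a b c f g)
    then show ?case
      using pdl_setting.pdl_morphism_Comp[OF s[of a], of b c f g] by (auto simp: pdl_category_def)
  next
    case (3 a b c d f g h)
    then show ?case
      by (intro ext) (auto simp: pdl_category_def t[of a b] t[of b c] t[of c d] restrict_def)
  next
    case (4 a b f)
    then show ?case
      by (intro ext) (auto simp: pdl_category_def t[of a b] restrict_def extensional_def)
  next
    case (5 a b f)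
    then show ?case
      by (intro ext) (auto simp: pdl_category_def t[of a b] restrict_def extensional_def)
  qed
qed

theorem proposition5p3p2:
  fixes C :: "('o, 'a, 'c) two_cat" and T P :: "('o, 'a, 'c) pmonad"
  assumes "two_category C" and "pseudomonad C T" and "pseudomonad C P"
  shows "(\<forall>D. pdl_data C T P D \<and> W1 C T P D \<and> W2 C T P D \<and> W3 C T P D \<and> W4 C T P D \<and> W5 C T P D
            \<longrightarrow> W8 C T P D \<and> W9 C T P D \<and> W10 C T P D) \<and>
         cat_isomorphism
           (pdl_category C T P (eight_axioms C T P))
           (pdl_category C T P (five_axioms C T P))
           (\<lambda>D. D) (\<lambda>D D' \<Gamma>. \<Gamma>)"
proof
  show W: "\<forall>D. pdl_data C T P D \<and> W1 C T P D \<and> W2 C T P D \<and> W3 C T P D \<and> W4 C T P D \<and> W5 C T P D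
      \<longrightarrow> W8 C T P D \<and> W9 C T P D \<and> W10 C T P D"
  proof (intro allI impI)
    fix D
    assume D: "pdl_data C T P D \<and> W1 C T P D \<and> W2 C T P D \<and> W3 C T P D \<and> W4 C T P D \<and> W5 C T P D"
    then have s: "pdl_setting C T P D"
      using assms by (simp add: pdl_setting.intro pdl_setting_axioms.intro)
    show "W8 C T P D \<and> W9 C T P D \<and> W10 C T P D"
      using D pdl_setting.W8_of_pasting[OF s pdl_setting.W8_from_W5[OF s]]
        pdl_setting.W9_of_pasting[OF s pdl_setting.W9_from_W5[OF s]]
        pdl_setting.W10_of_pasting[OF s pdl_setting.W10_from_W5[OF s]]
      by blast
  qed
  \<comment> \<open>By the first part both predicates select the same objects among the data, and
    the other components do not mention them; the identity functor is therefore its own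
    inverse.\<close>
  have eq: "pdl_category C T P (eight_axioms C T P) = pdl_category C T P (five_axioms C T P)"
    using W unfolding pdl_category_def eight_axioms_def five_axioms_def by auto
  have "cat_functor (pdl_category C T P axs) (pdl_category C T P axs) (\<lambda>D. D) (\<lambda>D D' \<Gamma>. \<Gamma>)" for axs
    using pdl_category_category[OF assms] by (simp add: cat_functor_def cat_functor_axioms_def)
  then show "cat_isomorphism (pdl_category C T P (eight_axioms C T P)) (pdl_category C T P (five_axioms C T P))
      (\<lambda>D. D) (\<lambda>D D' \<Gamma>. \<Gamma>)"
    unfolding eq cat_isomorphism_def by blast
qed

end
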